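(* Let $m\geq 2$ and let $\Sigma\subset\Sigma_m$ be a subshift (one-sided or two-sided). Suppose there are subsets $\mathcal C^{\rm p},\mathcal G,\mathcal C^{\rm s}$ of $\mathcal L(\Sigma)$ with $\mathcal L(\Sigma)=\mathcal C^{\rm p}\mathcal G\mathcal C^{\rm s}$, such that $\mathcal G$ contains the empty word and has (W')-specification, and $h(\mathcal C^{\rm p}\cup\mathcal C^{\rm s})<h_{\rm top}(\Sigma)$. Then for all $a,b\in[0,\infty]$ with $a\leq b$, \[\dim_{\rm H}R_{\sigma,\xi}(a,b)=\dim_{\rm H}\Sigma.\]
   Context: $\Sigma_m$ is either $\{0,\ldots,m-1\}^{\mathbb N}$ (one-sided, $\mathbb N=\{1,2,\ldots\}$) or $\{0,\ldots,m-1\}^{\mathbb Z}$ (two-sided), with metric $d(x,y)=e^{-\min\{|i|\colon x_i\neq y_i\}}$ for $x\neq y$; $\dim_{\rm H}$ is Hausdorff dimension with respect to $d$. $\sigma$ is the left shift, $(\sigma x)_i=x_{i+1}$. A subshift is a nonempty $\sigma$-invariant closed subset. The empty word $\emptyset$ satisfies $\emptyset w=w\emptyset=w$ and has length $0$. The language $\mathcal L(\Sigma)$ is the set consisting of the empty word and all finite words appearing in elements of $\Sigma$; $\mathcal L_n(\Sigma)$ is the set of its words of length $n$. For $\mathcal E\subset\mathcal L(\Sigma)$, $\mathcal E_n=\mathcal E\cap\mathcal L_n(\Sigma)$ and $h(\mathcal E)=\limsup_{n\to\infty}\frac1n\log\#\mathcal E_n$; $h_{\rm top}(\Sigma)=h(\mathcal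 L(\Sigma))$. $\mathcal L(\Sigma)=\mathcal C^{\rm p}\mathcal G\mathcal C^{\rm s}$ means every word of $\mathcal L(\Sigma)$ can be written as $pgs$ with $p\in\mathcal C^{\rm p}$, $g\in\mathcal G$, $s\in\mathcal C^{\rm s}$. (W')-specification: a subset $\mathcal G\subset\mathcal L(\Sigma)$ containing the empty word has (W')-specification if there is an integer $t\geq0$ (gap size) such that for all integers $j,k\geq 2$, all $v^1,\ldots,v^{j+k}\in\mathcal G$ and all $w^1,\ldots,w^{j+k-1}\in\mathcal L(\Sigma)$ with $|w^i|\leq t$ for all $i$ such that $u:=v^1w^1v^2\cdots w^{j-1}v^j\in\mathcal L(\Sigma)$ and $v:=v^{j+1}w^{j+1}v^{j+2}\cdots w^{j+k-1}v^{j+k}\in\mathcal L(\Sigma)$, there is $w\in\mathcal L(\Sigma)$ with $|w|\leq t$ and $uwv\in\mathcal L(\Sigma)$. (I.e. any two concatenations of elements of $\mathcal G$ by connecting words of length at most $t$ can be joined by a word of length at most $t$.) Recurrence sets: $\xi=\{[0],\ldots,[m-1]\}$ with $[j]=\{x\in\Sigma\colon x_1=j\}$; for $x\in\Sigma$ and $n\in\mathbb N$, $\xi_n(x)=\{y\in\Sigma\colon y_i=x_i,\ i=1,\ldots,n\}$. For $A\subset\Sigma$, $\tau_A(x)=\inf\{n\in\mathbb N\colon\sigma^n x\in A\}$ (with $\inf\emptyset=\infty$). For $0\le a\le b\le\infty$, $R_{\sigma,\xi}(a,b)=\{x\in\Sigma\colon \liminf_{n\to\infty}\frac1n\log\tau_{\xi_n(x)}(x)=a,\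 \limsup_{n\to\infty}\frac1n\log\tau_{\xi_n(x)}(x)=b\}$. *)

theory Defs
  imports "HOL-Analysis.Analysis" "HOL-Library.Extended_Real" "HOL-Library.Extended_Nat"
begin

text \<open>Points of the shift space are functions int => nat.  The Boolean parameter ts selects
  the two-sided (ts = True, coordinates in all of the integers) or one-sided (ts = False,
  coordinates 1,2,3,...) setting; in the one-sided case coordinates i < 1 are normalised to 0.\<close>

definition idx :: "bool \<Rightarrow> int set" where
  "idx ts = (if ts then UNIV else {1..})"

definition full_shift :: "bool \<Rightarrow> nat \<Rightarrow> (int \<Rightarrow> nat) set" where
  "full_shift ts m = {x. \<forall>i. (i \<in> idx ts \<longrightarrow> x i < m) \<and> (i \<notin> idx ts \<longrightarrow> x i = 0)}"

definition shift :: "bool \<Rightarrow> (int \<Rightarrow> nat) \<Rightarrow> (int \<Rightarrow> nat)" where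
  "shift ts x = (\<lambda>i. if i \<in> idx ts then x (i + 1) else 0)"

definition sdist :: "(int \<Rightarrow> nat) \<Rightarrow> (int \<Rightarrow> nat) \<Rightarrow> real" where
  "sdist x y = (if x = y then 0
     else exp (- real (LEAST n::nat. \<exists>i::int. nat \<bar>i\<bar> = n \<and> x i \<noteq> y i)))"

definition subshift :: "bool \<Rightarrow> nat \<Rightarrow> (int \<Rightarrow> nat) set \<Rightarrow> bool" where
  "subshift ts m S \<longleftrightarrow> S \<noteq> {} \<and> S \<subseteq> full_shift ts m
     \<and> (if ts then shift ts ` S = S else shift ts ` S \<subseteq> S)
     \<and> (\<forall>x\<in>full_shift ts m. (\<forall>e>0. \<exists>y\<in>S. sdist x y < e) \<longrightarrow> x \<in> S)"

definition language :: "bool \<Rightarrow> (int \<Rightarrow> nat) set \<Rightarrow> nat list set" where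
  "language ts S = {w. \<exists>x\<in>S. \<exists>k\<in>idx ts. \<forall>j<length w. x (k + int j) = w ! j}"

definition words_len :: "nat list set \<Rightarrow> nat \<Rightarrow> nat list set" where
  "words_len E n = {w \<in> E. length w = n}"

definition growth :: "nat list set \<Rightarrow> ereal" where
  "growth E = limsup (\<lambda>n. if card (words_len E n) = 0 then -\<infinity>
                          else ereal (ln (real (card (words_len E n))) / real n))"

definition htop :: "bool \<Rightarrow> (int \<Rightarrow> nat) set \<Rightarrow> ereal" where
  "htop ts S = growth (language ts S)"

definition chain :: "(nat \<Rightarrow> nat list) \<Rightarrow> (nat \<Rightarrow> nat list) \<Rightarrow> nat \<Rightarrow> nat \<Rightarrow> nat list" where
  "chain v w a n = v a @ concat (map (\<lambda>i. w i @ v (Suc i)) [a..<a+n])"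

definition W'_spec :: "bool \<Rightarrow> (int \<Rightarrow> nat) set \<Rightarrow> nat list set \<Rightarrow> bool" where
  "W'_spec ts S G \<longleftrightarrow> [] \<in> G \<and> G \<subseteq> language ts S \<and>
     (\<exists>t::nat. \<forall>j k v w. 2 \<le> j \<longrightarrow> 2 \<le> k
        \<longrightarrow> (\<forall>i\<in>{1..j+k}. v i \<in> G)
        \<longrightarrow> (\<forall>i\<in>{1..j+k-1}. w i \<in> language ts S \<and> length (w i) \<le> t)
        \<longrightarrow> chain v w 1 (j - 1) \<in> language ts S
        \<longrightarrow> chain v w (j + 1) (k - 1) \<in> language ts S
        \<longrightarrow> (\<exists>u\<in>language ts S. length u \<le> t \<and>
               chain v w 1 (j - 1) @ u @ chain v w (j + 1) (k - 1) \<in> language ts S))"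

definition decomposes :: "nat list set \<Rightarrow> nat list set \<Rightarrow> nat list set \<Rightarrow> nat list set \<Rightarrow> bool" where
  "decomposes L Cp G Cs \<longleftrightarrow> (\<forall>w\<in>L. \<exists>p\<in>Cp. \<exists>g\<in>G. \<exists>s\<in>Cs. w = p @ g @ s)"

definition cyl :: "(int \<Rightarrow> nat) set \<Rightarrow> nat \<Rightarrow> (int \<Rightarrow> nat) \<Rightarrow> (int \<Rightarrow> nat) set" where
  "cyl S n x = {y \<in> S. \<forall>i\<in>{1..int n}. y i = x i}"

definition tau :: "bool \<Rightarrow> (int \<Rightarrow> nat) set \<Rightarrow> (int \<Rightarrow> nat) \<Rightarrow> enat" where
  "tau ts A x = (if \<exists>n::nat. 1 \<le> n \<and> (shift ts ^^ n) x \<in> A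
                 then enat (LEAST n::nat. 1 \<le> n \<and> (shift ts ^^ n) x \<in> A) else \<infinity>)"

definition rec_rate :: "bool \<Rightarrow> (int \<Rightarrow> nat) set \<Rightarrow> (int \<Rightarrow> nat) \<Rightarrow> nat \<Rightarrow> ereal" where
  "rec_rate ts S x n = (case tau ts (cyl S n x) x of
      enat k \<Rightarrow> ereal (ln (real k) / real n) | \<infinity> \<Rightarrow> \<infinity>)"

definition Rset :: "bool \<Rightarrow> (int \<Rightarrow> nat) set \<Rightarrow> ereal \<Rightarrow> ereal \<Rightarrow> (int \<Rightarrow> nat) set" where
  "Rset ts S a b = {x \<in> S. liminf (rec_rate ts S x) = a \<and> limsup (rec_rate ts S x) = b}"

definition sdiam :: "(int \<Rightarrow> nat) set \<Rightarrow> real" where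
  "sdiam U = (if U = {} then 0 else Sup {sdist x y | x y. x \<in> U \<and> y \<in> U})"

definition hcontent :: "real \<Rightarrow> real \<Rightarrow> (int \<Rightarrow> nat) set \<Rightarrow> ennreal" where
  "hcontent s \<delta> A = (INF U \<in> {U :: nat \<Rightarrow> (int \<Rightarrow> nat) set. A \<subseteq> (\<Union>i. U i) \<and> (\<forall>i. sdiam (U i) \<le> \<delta>)}.
                        (\<Sum>i. ennreal (sdiam (U i) powr s)))"

definition hmeasure :: "real \<Rightarrow> (int \<Rightarrow> nat) set \<Rightarrow> ennreal" where
  "hmeasure s A = (SUP \<delta> \<in> {0<..}. hcontent s \<delta> A)"

definition hdim :: "(int \<Rightarrow> nat) set \<Rightarrow> ereal" where
  "hdim A = Inf {ereal s | s. 0 < s \<and> hmeasure s A = 0}"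

end

(*
Since L = Cp G Cs and h(Cp \<union> Cs) < h, the words of G alone have growth rate h. Take a set F of about
exp (N h') words of length N in G, with h' < h close to h. Counting gives words V, W in G such that V is
no factor of a concatenation, with gaps of length at most t, of words in F, and W is none of words in
F \<union> {V}. By (W') the words of F can be concatenated freely, starting from W, and at step s j one can
insert a copy of an earlier prefix of length about lam j, followed by V. The marker W then occurs only at
the beginnings of these copies, and V ends the match, so the prefixes of length n with
lam (j - 1) < n \<le> lam j recur first at the j-th copy; its position is s j up to a constant factor.
With ln (s j) / lam j \<longlonglongrightarrow> a and ln (s (j + 1)) / lam j \<longlonglongrightarrow> b the points so obtained lie in R(a,b).
The insertions have density zero, and a point determines the words of F chosen up to the lengths of the
gaps, which costs a factor of at most 3t + 1 per word. A mass distribution argument therefore bounds the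
dimension of R(a,b) from below by h' (one-sided) or 2h' (two-sided), and covering S by cylinders bounds
the dimension of S from above by h or 2h.
*)

theory Submission
  imports Defs "HOL-Probability.Infinite_Product_Measure" "HOL-Library.Sublist" "HOL-Real_Asymp.Real_Asymp"
begin

section \<open>The shift space\<close>

text \<open>Three things escape control. The joining words from (W') have unknown lengths, so time
  is counted in steps, each adding one word of F on the right, and letters are only estimated.
  Copies contain earlier copies, so the marker also recurs inside them; a match found there is
  pulled back to the original prefix and treated by induction. And (W') joins only chains of words
  of G, so a copied prefix must be such a chain: it ends at the end of a step, and its length only
  approximates \<open>lam j\<close>. The period 2c keeps events apart. Insertions occur at steps
  divisible by 2c, prefixes are cut at steps congruent to c, so at least c - 1 steps on each side of
  a cut are free of insertions. Those before it keep the marker away from the end of a copy; those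
  after it contain no V, so V does break the match. This is why c exceeds 3|W| and t + |V|. The size
  (3t + 1) exp (h' (N + t + 1)) demanded of F pays for up to three gaps per step on the right and
  for N + t + 1 letters per step, insertions included. Two-sided points grow on both sides in each
  step by independent words of F, which doubles h'.\<close>

definition agree :: "nat \<Rightarrow> (int \<Rightarrow> nat) \<Rightarrow> (int \<Rightarrow> nat) \<Rightarrow> bool" where
  "agree n x y \<longleftrightarrow> (\<forall>i. \<bar>i\<bar> < int n \<longrightarrow> x i = y i)"

lemma sdist_le_iff_agree: "sdist x y \<le> exp (- real n) \<longleftrightarrow> agree n x y"
proof (cases "x = y")
  case True
  then show ?thesis by (simp add: sdist_def agree_def)
next
  case False
  define P where "P = (\<lambda>n::nat. \<exists>i::int. nat \<bar>i\<bar> = n \<and> x i \<noteq> y i)"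
  have ex: "\<exists>n. P n" using False by (auto simp: P_def)
  have "sdist x y \<le> exp (- real n) \<longleftrightarrow> n \<le> (LEAST n. P n)"
    using False by (simp add: sdist_def P_def)
  also have "\<dots> \<longleftrightarrow> agree n x y"
  proof
    assume *: "n \<le> (LEAST n. P n)"
    show "agree n x y" unfolding agree_def
    proof (intro allI impI, rule ccontr)
      fix i assume "\<bar>i\<bar> < int n" "x i \<noteq> y i"
      then have "P (nat \<bar>i\<bar>)" "nat \<bar>i\<bar> < n" by (auto simp: P_def)
      then show False using * Least_le[of P "nat \<bar>i\<bar>"] by linarith
    qed
  next
    assume *: "agree n x y"
    have "P (LEAST n. P n)" using ex by (rule LeastI_ex)
    then obtain i where "nat \<bar>i\<bar> = (LEAST n. P n)" "x i \<noteq> y i" by (auto simp: P_def)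
    then show "n \<le> (LEAST n. P n)" using * unfolding agree_def by (metis nat_less_iff abs_ge_zero not_le)
  qed
  finally show ?thesis .
qed

lemma sdist_le_1: "sdist x y \<le> 1"
  by (simp add: sdist_def)

lemma sdist_nonneg: "0 \<le> sdist x y"
  by (simp add: sdist_def)

lemma sdist_le_sdiam:
  assumes "x \<in> U" "y \<in> U"
  shows "sdist x y \<le> sdiam U"
proof -
  have "sdist x y \<le> Sup {sdist x y | x y. x \<in> U \<and> y \<in> U}"
    using assms by (intro cSup_upper) (auto simp: bdd_above_def intro!: exI[of _ 1] sdist_le_1)
  then show ?thesis using assms by (auto simp: sdiam_def)
qed

lemma sdiam_le:
  assumes "\<And>x y. x \<in> U \<Longrightarrow> y \<in> U \<Longrightarrow> sdist x y \<le> d" "0 \<le> d"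
  shows "sdiam U \<le> d"
proof (cases "U = {}")
  case False
  then have "Sup {sdist x y | x y. x \<in> U \<and> y \<in> U} \<le> d"
    using assms(1) by (intro cSup_least) blast+
  then show ?thesis using False by (simp add: sdiam_def)
qed (use assms in \<open>simp add: sdiam_def\<close>)

lemma sdiam_nonneg: "0 \<le> sdiam U"
proof (cases "U = {}")
  case False
  then obtain x where "x \<in> U" by blast
  then show ?thesis using sdist_le_sdiam[of x U x] sdist_nonneg order_trans by blast
qed (simp add: sdiam_def)

lemma hcontent_mono: "A \<subseteq> B \<Longrightarrow> hcontent s d A \<le> hcontent s d B"
  unfolding hcontent_def by (rule INF_superset_mono) auto

lemma hmeasure_mono: "A \<subseteq> B \<Longrightarrow> hmeasure s A \<le> hmeasure s B"
  unfolding hmeasure_def by (intro SUP_mono) (auto intro: hcontent_mono)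

lemma hdim_mono:
  assumes "A \<subseteq> B"
  shows "hdim A \<le> hdim B"
proof -
  have "hmeasure s A = 0" if "hmeasure s B = 0" for s
    using hmeasure_mono[OF assms, of s] that by simp
  then show ?thesis unfolding hdim_def by (intro Inf_superset_mono) blast
qed

lemma language_sublist:
  assumes "w \<in> language ts S" "sublist v w"
  shows "v \<in> language ts S"
proof -
  from assms obtain ps ss where w: "w = ps @ v @ ss" by (auto simp: sublist_def)
  from assms obtain x k where x: "x \<in> S" "k \<in> idx ts" "\<forall>j<length w. x (k + int j) = w ! j"
    by (auto simp: language_def)
  have "k + int (length ps) \<in> idx ts" using x by (auto simp: idx_def split: if_splits)
  moreover have "\<forall>j<length v. x (k + int (length ps) + int j) = v ! j"
  proof (intro allI impI)
    fix j assume "j < length v"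
    then show "x (k + int (length ps) + int j) = v ! j"
      using x(3)[rule_format, of "length ps + j"] by (simp add: w nth_append add.assoc)
  qed
  ultimately show ?thesis using x unfolding language_def by blast
qed

lemma shift_funpow: "i \<in> idx ts \<Longrightarrow> (shift ts ^^ n) x i = x (i + int n)"
proof (induction n arbitrary: i)
  case (Suc n)
  have "i + 1 \<in> idx ts" using Suc.prems by (auto simp: idx_def split: if_splits)
  then show ?case using Suc by (simp add: shift_def add.commute add.left_commute)
qed simp

context
  fixes ts m S
  assumes sub: "subshift ts m S"
begin

lemma shift_in: "x \<in> S \<Longrightarrow> shift ts x \<in> S"
  using sub by (auto simp: subshift_def split: if_splits)

lemma shift_funpow_in: "x \<in> S \<Longrightarrow> (shift ts ^^ n) x \<in> S"
  by (induction n) (auto intro: shift_in)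

lemma shift_funpow_surj:
  assumes ts "x \<in> S"
  shows "\<exists>y\<in>S. (shift ts ^^ n) y = x"
proof (induction n)
  case 0 then show ?case using assms by auto
next
  case (Suc n)
  then obtain y where y: "y \<in> S" "(shift ts ^^ n) y = x" by blast
  then have "y \<in> shift ts ` S" using sub assms by (simp add: subshift_def)
  then obtain y' where "y' \<in> S" "shift ts y' = y" by blast
  then show ?case using y by (auto simp: funpow_Suc_right simp del: funpow.simps)
qed

lemma letters_less: "x \<in> S \<Longrightarrow> i \<in> idx ts \<Longrightarrow> x i < m"
  using sub by (auto simp: subshift_def full_shift_def)

lemma letters_zero: "x \<in> S \<Longrightarrow> i \<notin> idx ts \<Longrightarrow> x i = 0"
  using sub by (auto simp: subshift_def full_shift_def)

lemma language_letters:
  assumes "w \<in> language ts S" shows "set w \<subseteq> {..<m}"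
proof -
  from assms obtain x k where x: "x \<in> S" "k \<in> idx ts" "\<forall>j<length w. x (k + int j) = w ! j"
    by (auto simp: language_def)
  have "k + int j \<in> idx ts" for j using x by (auto simp: idx_def split: if_splits)
  then show ?thesis using x letters_less by (auto simp: in_set_conv_nth) metis
qed

lemma finite_words_len: "finite (words_len (language ts S) n)"
  using language_letters
  by (auto simp: words_len_def intro!: finite_subset[OF _ finite_lists_length_eq[of "{..<m}" n]])

lemma window_in_language:
  assumes "x \<in> S" "k \<in> idx ts"
  shows "map (\<lambda>j. x (k + int j)) [0..<n] \<in> language ts S"
  using assms by (auto simp: language_def)

text \<open>S is closed, so it suffices to approximate \<open>x\<close> by points of S. A window of
  \<open>x\<close> occurs somewhere in a point of S, and shifting brings it into place. If it has to
  move to the right, a preimage under the shift is used; this happens only in the two-sided case,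
  because a one-sided window starts at coordinate 1.\<close>

lemma subshiftI:
  assumes zero: "\<And>i. i \<notin> idx ts \<Longrightarrow> x i = 0"
    and win: "\<And>n. map x [(if ts then - int n else 1)..int n] \<in> language ts S"
  shows "x \<in> S"
proof -
  define lo where "lo n = (if ts then - int n else 1)" for n
  have near: "\<exists>y\<in>S. \<forall>i. lo n \<le> i \<longrightarrow> i \<le> int n \<longrightarrow> y i = x i" for n
  proof -
    define w where "w = map x [lo n..int n]"
    have "w \<in> language ts S" using win[of n] by (simp add: w_def lo_def)
    then obtain y k where y: "y \<in> S" "k \<in> idx ts" "\<forall>j<length w. y (k + int j) = w ! j"
      by (auto simp: language_def)
    have yx: "y (i + (k - lo n)) = x i" if "lo n \<le> i" "i \<le> int n" for i
    proof -
      have "nat (i - lo n) < length w" using that by (auto simp: w_def)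
      then have "y (k + int (nat (i - lo n))) = w ! nat (i - lo n)" using y by blast
      also have "\<dots> = x i" using that by (simp add: w_def)
      finally show ?thesis using that by (simp add: algebra_simps)
    qed
    show ?thesis
    proof (cases "0 \<le> k - lo n")
      case True
      have "(shift ts ^^ nat (k - lo n)) y i = x i" if "lo n \<le> i" "i \<le> int n" for i
        using yx[OF that] that True by (subst shift_funpow) (auto simp: lo_def idx_def split: if_splits)
      then show ?thesis using shift_funpow_in[OF y(1)] by blast
    next
      case False
      then have ts: ts using y(2) by (auto simp: lo_def idx_def split: if_splits)
      obtain y' where y': "y' \<in> S" "(shift ts ^^ nat (lo n - k)) y' = y"
        using shift_funpow_surj[OF ts y(1)] by blast
      have "y' i = x i" if "lo n \<le> i" "i \<le> int n" for i
      proof -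
        have "y (i + (k - lo n)) = y' i"
          using False ts by (subst y'(2)[symmetric], subst shift_funpow) (auto simp: idx_def)
        then show ?thesis using yx[OF that] by simp
      qed
      then show ?thesis using y' by blast
    qed
  qed
  have full: "x \<in> full_shift ts m"
  proof -
    have "x i < m" if "i \<in> idx ts" for i
    proof -
      obtain y where "y \<in> S" "\<forall>j. lo (nat \<bar>i\<bar>) \<le> j \<longrightarrow> j \<le> int (nat \<bar>i\<bar>) \<longrightarrow> y j = x j" using near by blast
      moreover have "lo (nat \<bar>i\<bar>) \<le> i" "i \<le> int (nat \<bar>i\<bar>)"
        using that by (auto simp: lo_def idx_def split: if_splits)
      ultimately show ?thesis using letters_less[of y i] that by metis
    qed
    then show ?thesis using zero by (auto simp: full_shift_def)
  qed
  have "\<exists>y\<in>S. sdist x y < e" if "e > 0" for e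
  proof -
    obtain n :: nat where n: "exp (- real n) < e"
    proof -
      obtain n :: nat where "- ln e < real n" using reals_Archimedean2 by blast
      then have "exp (- real n) < exp (ln e)" by (intro exp_less_mono) linarith
      then show ?thesis using that \<open>e > 0\<close> by simp
    qed
    obtain y where y: "y \<in> S" "\<forall>i. lo n \<le> i \<longrightarrow> i \<le> int n \<longrightarrow> y i = x i" using near by blast
    have "agree n x y" unfolding agree_def
    proof (intro allI impI)
      fix i assume i: "\<bar>i\<bar> < int n"
      show "x i = y i"
      proof (cases "i \<in> idx ts")
        case True
        then have "lo n \<le> i" using i by (auto simp: lo_def idx_def split: if_splits)
        then show ?thesis using y i by auto
      qed (use zero letters_zero y in auto)
    qed
    then show ?thesis using n y sdist_le_iff_agree[of x y n] by (auto intro: le_less_trans)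
  qed
  then show ?thesis using full sub by (auto simp: subshift_def)
qed

end

section \<open>A mass distribution principle\<close>

text \<open>The uniform product measure on sequences over \<open>A\<close> is transported to the
  points. \<Phi> is not assumed measurable, so the preimage of a ball is enclosed in a finite union
  of cylinders: by hypothesis, for a suitable k, only few words of length k begin a sequence that is
  sent into the ball.\<close>

lemma hmeasure_pos:
  fixes A :: "'a set" and \<Phi> :: "(nat \<Rightarrow> 'a) \<Rightarrow> int \<Rightarrow> nat" and B s :: real
  assumes A: "finite A" "A \<noteq> {}" and s: "s > 0"
    and bound: "\<And>n z. \<exists>k. real (card {map \<omega> [0..<k] | \<omega>. range \<omega> \<subseteq> A \<and> agree n (\<Phi> \<omega>) z})
                  \<le> B * exp (- (s * real n)) * real (card A) ^ k"
  shows "hmeasure s (\<Phi> ` {\<omega>. range \<omega> \<subseteq> A}) > 0"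
proof -
  define M where "M = uniform_count_measure A"
  define P where "P = PiM (UNIV :: nat set) (\<lambda>_. M)"
  interpret M: prob_space M unfolding M_def using A by (rule prob_space_uniform_count_measure)
  interpret product_prob_space "\<lambda>_::nat. M" UNIV ..
  have space_M: "space M = A" and sets_M: "sets M = Pow A"
    by (simp_all add: M_def space_uniform_count_measure sets_uniform_count_measure)
  have space_P: "space P = {\<omega>. range \<omega> \<subseteq> A}"
    by (auto simp: P_def space_PiM space_M)
  have P1: "emeasure P (space P) = 1" unfolding P_def by (rule P.emeasure_space_1)
  have emM: "emeasure M {a} = ennreal (1 / card A)" if "a \<in> A" for a
    using that A by (simp add: M_def emeasure_uniform_count_measure)
  define q where "q = real (card A)"
  have q: "q > 0" using A by (simp add: q_def card_gt_0_iff)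
  have pre: "{\<omega>\<in>space P. map \<omega> [0..<k] = w} \<in> sets P \<and>
             emeasure P {\<omega>\<in>space P. map \<omega> [0..<k] = w} = ennreal ((1 / q) ^ k)"
    if "w \<in> (\<lambda>\<omega>. map \<omega> [0..<k]) ` {\<omega>. range \<omega> \<subseteq> A}" for w k
  proof -
    have w: "length w = k" "\<And>i. i < k \<Longrightarrow> w ! i \<in> A" using that by auto
    have "{\<omega>\<in>space P. map \<omega> [0..<k] = w}
        = prod_emb UNIV (\<lambda>_. M) {..<k} (Pi\<^sub>E {..<k} (\<lambda>i. {w ! i}))" (is "?L = ?R")
    proof
      show "?L \<subseteq> ?R" by (auto simp: prod_emb_def P_def space_PiM)
      show "?R \<subseteq> ?L"
      proof
        fix \<omega> assume "\<omega> \<in> ?R"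
        then have o: "\<omega> \<in> space P" "restrict \<omega> {..<k} \<in> Pi\<^sub>E {..<k} (\<lambda>i. {w ! i})"
          by (auto simp: prod_emb_def P_def space_PiM)
        have "\<omega> i = w ! i" if "i < k" for i
          using PiE_mem[OF o(2), of i] that by simp
        then show "\<omega> \<in> ?L" using o w by (auto intro!: nth_equalityI)
      qed
    qed
    moreover have "?R \<in> sets P" unfolding P_def
      using w by (intro sets_PiM_I) (auto simp: sets_M)
    moreover have "emeasure P ?R = (\<Prod>i\<in>{..<k}. emeasure M {w ! i})" unfolding P_def
      using w by (intro emeasure_PiM_emb) (auto simp: sets_M)
    moreover have "\<dots> = (\<Prod>i\<in>{..<k}. ennreal (1 / q))"
      using w emM by (intro prod.cong) (auto simp: q_def)
    moreover have "\<dots> = ennreal ((1 / q) ^ k)" using q by (simp add: ennreal_power)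
    ultimately show ?thesis by metis
  qed
  have cylP: "\<exists>E\<in>sets P. {\<omega>\<in>space P. agree n (\<Phi> \<omega>) z} \<subseteq> E \<and> emeasure P E \<le> ennreal (B * exp (- (s * real n)))"
    for n z
  proof -
    obtain k where k: "real (card {map \<omega> [0..<k] | \<omega>. range \<omega> \<subseteq> A \<and> agree n (\<Phi> \<omega>) z})
                  \<le> B * exp (- (s * real n)) * q ^ k" (is "real (card ?W) \<le> _")
      using bound unfolding q_def by blast
    have W: "?W \<subseteq> (\<lambda>\<omega>. map \<omega> [0..<k]) ` {\<omega>. range \<omega> \<subseteq> A}" by auto
    have finW: "finite ?W"
      using A(1) by (intro finite_subset[OF _ finite_lists_length_eq[OF A(1), of k]])
        (auto simp: image_subset_iff)
    define E where "E = (\<Union>w\<in>?W. {\<omega>\<in>space P. map \<omega> [0..<k] = w})"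
    have "emeasure P E \<le> (\<Sum>w\<in>?W. emeasure P {\<omega>\<in>space P. map \<omega> [0..<k] = w})"
      unfolding E_def using pre W finW by (intro emeasure_subadditive_finite) blast+
    also have "\<dots> = (\<Sum>w\<in>?W. ennreal ((1 / q) ^ k))"
      using pre W by (intro sum.cong) blast+
    also have "\<dots> = ennreal (real (card ?W) * (1 / q) ^ k)"
      using q by (simp add: ennreal_mult ennreal_of_nat_eq_real_of_nat)
    also have "\<dots> \<le> ennreal (B * exp (- (s * real n)) * q ^ k * (1 / q) ^ k)"
      using k q by (intro ennreal_leI mult_right_mono) auto
    also have "q ^ k * (1 / q) ^ k = 1" using q by (simp add: power_one_over)
    then have "B * exp (- (s * real n)) * q ^ k * (1 / q) ^ k = B * exp (- (s * real n))"
      by (simp add: mult.assoc)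
    finally have "emeasure P E \<le> ennreal (B * exp (- (s * real n)))" .
    moreover have "E \<in> sets P" unfolding E_def using pre W finW by (intro sets.finite_UN) blast+
    moreover have "{\<omega>\<in>space P. agree n (\<Phi> \<omega>) z} \<subseteq> E"
      by (auto simp: E_def space_P)
    ultimately show ?thesis by blast
  qed
  \<comment> \<open>The factor \<open>exp s\<close> pays for rounding - ln (sdiam U) down to an
    integer; the maximum makes C positive whatever the sign of B.\<close>
  define C where "C = max B 1 * exp s"
  have C: "C > 0" by (auto simp: C_def max_def)
  \<comment> \<open>A set of diameter 0 contributes 0 to the sum in \<open>hcontent\<close>, while
    an enclosing union of cylinders may have positive measure. The extra terms, with sum 1/2, leave
    room for it.\<close>
  have setP: "\<exists>E\<in>sets P. {\<omega>\<in>space P. \<Phi> \<omega> \<in> U} \<subseteq> E \<and>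
       emeasure P E \<le> ennreal (C * sdiam U powr s) + ennreal ((1/2) ^ (i + 2))" for U and i :: nat
  proof (cases "U = {}")
    case True
    then show ?thesis by (intro bexI[of _ "{}"]) auto
  next
    case False
    then obtain z where z: "z \<in> U" by blast
    have red: ?thesis if "sdiam U \<le> exp (- real n)"
      "B * exp (- (s * real n)) \<le> C * sdiam U powr s + (1/2) ^ (i + 2)" for n
    proof -
      have "agree n x z" if "x \<in> U" for x
        using sdist_le_sdiam[OF that z] \<open>sdiam U \<le> _\<close> by (simp flip: sdist_le_iff_agree)
      then have sub: "{\<omega>\<in>space P. \<Phi> \<omega> \<in> U} \<subseteq> {\<omega>\<in>space P. agree n (\<Phi> \<omega>) z}" by auto
      have "ennreal (B * exp (- (s * real n))) \<le> ennreal (C * sdiam U powr s) + ennreal ((1/2) ^ (i + 2))"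
        using ennreal_leI[OF that(2)] C by (simp add: ennreal_plus del: power_Suc)
      then show ?thesis using cylP[of n z] sub by (meson order_trans)
    qed
    show ?thesis
    proof (cases "sdiam U = 0")
      case True
      have "(\<lambda>n. B * exp (- (s * real n))) \<longlonglongrightarrow> 0" using s by real_asymp
      then have "eventually (\<lambda>n. B * exp (- (s * real n)) < (1/2) ^ (i + 2)) sequentially"
        by (rule order_tendstoD) simp
      then obtain n where "B * exp (- (s * real n)) < (1/2) ^ (i + 2)" by (auto simp: eventually_sequentially)
      then show ?thesis using True by (intro red[of n]) auto
    next
      case False
      define d where "d = sdiam U"
      have d: "0 < d" "d \<le> 1" using False sdiam_nonneg[of U] sdiam_le[of U 1] sdist_le_1
        by (auto simp: d_def)
      define n where "n = nat \<lfloor>- ln d\<rfloor>"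
      have "0 \<le> - ln d" using d by (simp add: ln_le_zero_iff)
      then have n: "real n \<le> - ln d" "- ln d < real n + 1"
        unfolding n_def by linarith+
      have "exp (ln d) \<le> exp (- real n)" using n by (intro exp_le_cancel_iff[THEN iffD2]) linarith
      then have d1: "d \<le> exp (- real n)" using d by simp
      have "exp (- (s * real n)) = exp s * exp (s * (- real n - 1))"
        by (simp add: algebra_simps flip: exp_add)
      also have "\<dots> \<le> exp s * exp (s * ln d)" using n s by (intro mult_left_mono) auto
      also have "exp (s * ln d) = d powr s" using d by (simp add: powr_def)
      finally have e: "exp (- (s * real n)) \<le> exp s * d powr s" .
      have "B * exp (- (s * real n)) \<le> max B 1 * exp (- (s * real n))" by (intro mult_right_mono) auto
      also have "\<dots> \<le> max B 1 * (exp s * d powr s)" using e by (intro mult_left_mono) auto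
      also have "\<dots> = C * d powr s" by (simp add: C_def)
      finally show ?thesis using d1 unfolding d_def[symmetric]
        by (intro red[of n, folded d_def]) (auto intro: add_increasing2)
    qed
  qed
  \<comment> \<open>A bound at the single scale 1 suffices, because \<open>hmeasure\<close> is a
    supremum over scales.\<close>
  have "ennreal (1 / (2 * C)) \<le> hcontent s 1 (\<Phi> ` {\<omega>. range \<omega> \<subseteq> A})"
    unfolding hcontent_def
  proof (rule INF_greatest, clarify)
    fix U :: "nat \<Rightarrow> (int \<Rightarrow> nat) set"
    assume cov: "\<Phi> ` {\<omega>. range \<omega> \<subseteq> A} \<subseteq> (\<Union>i. U i)"
    have "\<forall>i. \<exists>E. E \<in> sets P \<and> {\<omega>\<in>space P. \<Phi> \<omega> \<in> U i} \<subseteq> E \<and>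
       emeasure P E \<le> ennreal (C * sdiam (U i) powr s) + ennreal ((1/2) ^ (i + 2))"
      using setP[of "U _"] unfolding Bex_def by (rule allI)
    from choice[OF this] obtain E where E: "\<And>i. E i \<in> sets P" "\<And>i. {\<omega>\<in>space P. \<Phi> \<omega> \<in> U i} \<subseteq> E i"
      "\<And>i. emeasure P (E i) \<le> ennreal (C * sdiam (U i) powr s) + ennreal ((1/2) ^ (i + 2))"
      by auto
    have "space P \<subseteq> (\<Union>i. E i)"
    proof
      fix \<omega> assume o: "\<omega> \<in> space P"
      then obtain i where "\<Phi> \<omega> \<in> U i" using cov by (auto simp: space_P)
      then show "\<omega> \<in> (\<Union>i. E i)" using o E(2) by blast
    qed
    then have "emeasure P (space P) \<le> emeasure P (\<Union>i. E i)"
      using E(1) by (intro emeasure_mono) auto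
    then have "1 \<le> emeasure P (\<Union>i. E i)" using P1 by simp
    also have "\<dots> \<le> (\<Sum>i. emeasure P (E i))"
      using E(1) by (intro emeasure_subadditive_countably) auto
    also have "\<dots> \<le> (\<Sum>i. ennreal (C * sdiam (U i) powr s) + ennreal ((1/2) ^ (i + 2)))"
      using E(3) by (intro suminf_le) auto
    also have "\<dots> = (\<Sum>i. ennreal (C * sdiam (U i) powr s)) + (\<Sum>i. ennreal ((1/2) ^ (i + 2)))"
      by (intro suminf_add[symmetric]) auto
    also have "(\<Sum>i. ennreal ((1/2) ^ (i + 2))) = ennreal (\<Sum>i. (1/2) ^ (i + 2))"
      by (intro suminf_ennreal2 summable_ignore_initial_segment summable_geometric) auto
    also have "(\<Sum>i. (1/2::real) ^ (i + 2)) = 1/2"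
      using sums_unique[OF sums_mult[OF geometric_sums[of "1/2::real"], of "1/4"]] by (simp add: mult.commute)
    also have "(\<Sum>i. ennreal (C * sdiam (U i) powr s)) = ennreal C * (\<Sum>i. ennreal (sdiam (U i) powr s))"
      using C by (simp add: ennreal_mult)
    finally have *: "1 \<le> ennreal C * (\<Sum>i. ennreal (sdiam (U i) powr s)) + ennreal (1/2)" .
    show "ennreal (1 / (2 * C)) \<le> (\<Sum>i. ennreal (sdiam (U i) powr s))"
    proof (cases "(\<Sum>i. ennreal (sdiam (U i) powr s))")
      case (real r)
      have "ennreal 1 \<le> ennreal (C * r + 1/2)"
        using * real C by (simp add: ennreal_mult ennreal_plus)
      then have "1 \<le> C * r + 1/2" using real C by (subst (asm) ennreal_le_iff) auto
      then have "1 / (2 * C) \<le> r" using C by (simp add: field_simps)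
      then show ?thesis using real by (simp add: ennreal_leI)
    qed simp
  qed
  also have "\<dots> \<le> hmeasure s (\<Phi> ` {\<omega>. range \<omega> \<subseteq> A})"
    unfolding hmeasure_def by (rule SUP_upper) simp
  finally show ?thesis using C by (auto intro: less_le_trans[rotated])
qed

section \<open>Growth rates and the dimension of a subshift\<close>

lemma growth_lessD:
  assumes "growth E < ereal h"
  shows "\<forall>\<^sub>F n in sequentially. real (card (words_len E n)) \<le> exp (h * real n)"
proof -
  have "\<forall>\<^sub>F n in sequentially. (if card (words_len E n) = 0 then -\<infinity>
          else ereal (ln (real (card (words_len E n))) / real n)) < ereal h"
    using assms unfolding growth_def by (rule Limsup_lessD)
  then show ?thesis using eventually_gt_at_top[of 0]
  proof eventually_elim
    case (elim n)
    show ?case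
    proof (cases "card (words_len E n) = 0")
      case False
      then have "ln (real (card (words_len E n))) < h * real n"
        using elim by (simp add: field_simps)
      then have "exp (ln (real (card (words_len E n)))) \<le> exp (h * real n)" by simp
      then show ?thesis using False by simp
    qed simp
  qed
qed

lemma growth_leI:
  assumes "\<forall>\<^sub>F n in sequentially. real (card (words_len E n)) \<le> exp (h * real n)"
  shows "growth E \<le> ereal h"
  unfolding growth_def
proof (rule Limsup_bounded)
  show "\<forall>\<^sub>F n in sequentially. (if card (words_len E n) = 0 then -\<infinity>
          else ereal (ln (real (card (words_len E n))) / real n)) \<le> ereal h"
    using assms eventually_gt_at_top[of 0]
  proof eventually_elim
    case (elim n)
    show ?case
    proof (cases "card (words_len E n) = 0")
      case False
      then have "ln (real (card (words_len E n))) \<le> ln (exp (h * real n))"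
        using elim by (intro ln_mono) auto
      then show ?thesis using False elim by (simp add: field_simps)
    qed simp
  qed
qed

text \<open>The cover consists of the cylinders on the coordinates -n..n, or 1..n in the one-sided
  case. For large n they number at most exp (h (2n + 1)) or exp (h n), and each has diameter at most
  exp (-(n + 1)); this is the origin of the factor 2.\<close>

lemma hmeasure_subshift_eq_0:
  fixes h s :: real
  assumes sub: "subshift ts m S" and h: "htop ts S < ereal h"
    and s: "s > (if ts then 2 else 1) * h" "s > 0"
  shows "hmeasure s S = 0"
proof -
  define N where "N n = (if ts then 2 * n + 1 else n)" for n :: nat
  have zero: "hcontent s \<delta> S = 0" if \<delta>: "\<delta> > 0" for \<delta>
  proof -
    define cnt where "cnt n = real (card (words_len (language ts S) (N n)))" for n
    have pe: "exp (- (real n + 1)) powr s = exp (- (s * (real n + 1)))" for n :: nat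
      by (simp add: powr_def algebra_simps)
    have lim: "(\<lambda>n. exp (h * real (N n)) * exp (- (real n + 1)) powr s) \<longlonglongrightarrow> 0"
    proof (cases ts)
      case True
      have "(\<lambda>n. exp (h * (2 * real n + 1)) * exp (- (s * (real n + 1)))) \<longlonglongrightarrow> 0"
      proof -
        have "(\<lambda>n. exp (h * (2 * real n + 1)) * exp (- (s * (real n + 1))))
           = (\<lambda>n. exp (h - s) * exp (- ((s - 2 * h) * real n)))"
          by (simp add: algebra_simps flip: exp_add)
        moreover have "(\<lambda>n. exp (h - s) * exp (- ((s - 2 * h) * real n))) \<longlonglongrightarrow> 0"
        proof -
          have "0 < s - 2 * h" using s True by simp
          then show ?thesis by real_asymp
        qed
        ultimately show ?thesis by simp
      qed
      then show ?thesis unfolding pe N_def using True by (simp add: add.commute)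
    next
      case False
      have "(\<lambda>n. exp (h * real n) * exp (- (s * (real n + 1)))) \<longlonglongrightarrow> 0"
      proof -
        have "(\<lambda>n. exp (h * real n) * exp (- (s * (real n + 1))))
           = (\<lambda>n. exp (- s) * exp (- ((s - h) * real n)))"
          by (simp add: algebra_simps flip: exp_add)
        moreover have "(\<lambda>n. exp (- s) * exp (- ((s - h) * real n))) \<longlonglongrightarrow> 0"
        proof -
          have "0 < s - h" using s False by simp
          then show ?thesis by real_asymp
        qed
        ultimately show ?thesis by simp
      qed
      then show ?thesis unfolding pe N_def using False by simp
    qed
    have bound: "\<forall>\<^sub>F n in sequentially. hcontent s \<delta> S \<le> ennreal (exp (h * real (N n)) * exp (- (real n + 1)) powr s)"
    proof -
      have "filterlim N at_top sequentially"
        unfolding N_def by (rule filterlim_at_top_mono[OF filterlim_ident]) (auto intro!: always_eventually)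
      then have "\<forall>\<^sub>F n in sequentially. cnt n \<le> exp (h * real (N n))"
        using growth_lessD[OF h[unfolded htop_def]] unfolding cnt_def
        by (rule eventually_compose_filterlim[rotated])
      moreover have "\<forall>\<^sub>F n in sequentially. exp (- (real n + 1)) < \<delta>"
      proof -
        have "(\<lambda>n::nat. exp (- (real n + 1))) \<longlonglongrightarrow> 0" by real_asymp
        then show ?thesis using \<delta> by (rule order_tendstoD)
      qed
      ultimately show ?thesis
      proof eventually_elim
        case (elim n)
        define lo where "lo = (if ts then - int n else 1)"
        define Ws where "Ws = words_len (language ts S) (N n)"
        have finW: "finite Ws" unfolding Ws_def by (rule finite_words_len[OF sub])
        obtain f where f: "bij_betw f {0..<card Ws} Ws" using ex_bij_betw_nat_finite[OF finW] by blast
        define U where "U i = (if i < card Ws then {x\<in>S. map (\<lambda>j. x (lo + int j)) [0..<N n] = f i} else {})" for i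
        have diam: "sdiam (U i) \<le> exp (- (real n + 1))" for i
        proof (rule sdiam_le)
          fix x y assume "x \<in> U i" "y \<in> U i"
          then have xy: "x \<in> S" "y \<in> S"
            "map (\<lambda>j. x (lo + int j)) [0..<N n] = map (\<lambda>j. y (lo + int j)) [0..<N n]"
            by (auto simp: U_def simp del: map_eq_conv split: if_splits)
          then have e: "x (lo + int j) = y (lo + int j)" if "j < N n" for j
            using that by simp
          have "agree (n + 1) x y" unfolding agree_def
          proof (intro allI impI)
            fix i :: int assume i: "\<bar>i\<bar> < int (n + 1)"
            show "x i = y i"
            proof (cases "i \<in> idx ts")
              case True
              then have "nat (i - lo) < N n" "lo \<le> i"
                using i by (auto simp: lo_def N_def idx_def split: if_splits)
              then have "x (lo + int (nat (i - lo))) = y (lo + int (nat (i - lo)))"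
                by (intro e)
              moreover have "lo + int (nat (i - lo)) = i" using \<open>lo \<le> i\<close> by simp
              ultimately show ?thesis by (simp only:)
            next
              case False
              then show ?thesis using letters_zero[OF sub xy(1)] letters_zero[OF sub xy(2)] by simp
            qed
          qed
          moreover have "- (real n + 1) = - real (n + 1)" by simp
          ultimately show "sdist x y \<le> exp (- (real n + 1))"
            using sdist_le_iff_agree[of x y "n + 1"] by (simp only:)
        qed simp
        have cov: "S \<subseteq> (\<Union>i. U i)"
        proof
          fix x assume x: "x \<in> S"
          have "map (\<lambda>j. x (lo + int j)) [0..<N n] \<in> Ws"
            using window_in_language[OF sub x, of lo "N n"] by (auto simp: Ws_def words_len_def lo_def idx_def)
          then obtain i where "i < card Ws" "f i = map (\<lambda>j. x (lo + int j)) [0..<N n]"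
            using f by (metis atLeastLessThan_iff bij_betw_imp_surj_on imageE)
          then show "x \<in> (\<Union>i. U i)" using x by (auto simp: U_def intro!: exI[of _ i])
        qed
        have "hcontent s \<delta> S \<le> (\<Sum>i. ennreal (sdiam (U i) powr s))"
          unfolding hcontent_def
        proof (intro INF_lower CollectI conjI allI)
          show "sdiam (U i) \<le> \<delta>" for i using diam[of i] elim(2) by linarith
        qed (rule cov)
        also have "\<dots> = (\<Sum>i<card Ws. ennreal (sdiam (U i) powr s))"
          by (intro suminf_finite) (auto simp: U_def sdiam_def)
        also have "\<dots> \<le> (\<Sum>i<card Ws. ennreal (exp (- (real n + 1)) powr s))"
          using diam sdiam_nonneg s by (intro sum_mono ennreal_leI powr_mono2) auto
        also have "\<dots> = ennreal (cnt n * exp (- (real n + 1)) powr s)"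
          by (simp add: cnt_def Ws_def ennreal_mult ennreal_of_nat_eq_real_of_nat)
        also have "\<dots> \<le> ennreal (exp (h * real (N n)) * exp (- (real n + 1)) powr s)"
          using elim by (intro ennreal_leI mult_right_mono) auto
        finally show ?case .
      qed
    qed
    have "(\<lambda>n. ennreal (exp (h * real (N n)) * exp (- (real n + 1)) powr s)) \<longlonglongrightarrow> ennreal 0"
      using lim by (rule tendsto_ennrealI)
    then have "hcontent s \<delta> S \<le> ennreal 0"
      using bound by (rule tendsto_lowerbound) simp
    then show ?thesis by simp
  qed
  show ?thesis unfolding hmeasure_def using zero by (simp add: SUP_eq_const)
qed

lemma card_words_len_decomposes:
  assumes sub: "subshift ts m S" and dec: "decomposes (language ts S) Cp G Cs"
    and incl: "Cp \<subseteq> language ts S" "G \<subseteq> language ts S" "Cs \<subseteq> language ts S"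
  shows "card (words_len (language ts S) n) \<le>
    (\<Sum>(i,j)\<in>{(i,j). i + j \<le> n}. card (words_len (Cp \<union> Cs) i) * card (words_len G j) * card (words_len (Cp \<union> Cs) (n - i - j)))"
proof -
  define I where "I = {(i,j). i + j \<le> n}"
  have finI: "finite I" unfolding I_def by (rule finite_subset[of _ "{..n} \<times> {..n}"]) auto
  define C where "C = Cp \<union> Cs"
  have fin: "finite (words_len C i)" "finite (words_len G i)" for i
    using incl by (auto simp: C_def words_len_def intro!: finite_subset[OF _ finite_words_len[OF sub, of i]])
  define A where "A = (\<lambda>(i,j). (\<lambda>(p,g,s). p @ g @ s) ` (words_len C i \<times> words_len G j \<times> words_len C (n - i - j)))"
  have "words_len (language ts S) n \<subseteq> (\<Union>ij\<in>I. A ij)"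
  proof
    fix w assume "w \<in> words_len (language ts S) n"
    then have w: "w \<in> language ts S" "length w = n" by (auto simp: words_len_def)
    then obtain p g s where "p \<in> Cp" "g \<in> G" "s \<in> Cs" "w = p @ g @ s"
      using dec by (fastforce simp: decomposes_def)
    then have "w \<in> A (length p, length g)" "(length p, length g) \<in> I"
      using w by (auto simp: A_def I_def C_def words_len_def intro!: image_eqI[of _ _ "(p, g, s)"])
    then show "w \<in> (\<Union>ij\<in>I. A ij)" by blast
  qed
  moreover have finA: "finite (A ij)" for ij using fin by (auto simp: A_def split: prod.split)
  ultimately have "card (words_len (language ts S) n) \<le> card (\<Union>ij\<in>I. A ij)"
    using finI by (intro card_mono) auto
  also have "\<dots> \<le> (\<Sum>ij\<in>I. card (A ij))" using finI by (rule card_UN_le)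
  also have "\<dots> \<le> (\<Sum>(i,j)\<in>I. card (words_len C i) * card (words_len G j) * card (words_len C (n - i - j)))"
  proof (rule sum_mono)
    fix ij assume "ij \<in> I"
    have "card (A ij) \<le> card (words_len C (fst ij) \<times> words_len G (snd ij) \<times> words_len C (n - fst ij - snd ij))"
      unfolding A_def case_prod_beta using fin by (intro card_image_le) auto
    then show "card (A ij) \<le> (case ij of (i, j) \<Rightarrow> card (words_len C i) * card (words_len G j) * card (words_len C (n - i - j)))"
      by (simp add: card_cartesian_product mult.assoc case_prod_beta)
  qed
  finally show ?thesis by (simp add: I_def C_def)
qed

lemma eventually_bound_all:
  fixes f :: "nat \<Rightarrow> real"
  assumes "\<forall>\<^sub>F n in sequentially. f n \<le> exp (h * real n)"
  shows "\<exists>K\<ge>1. \<forall>n. f n \<le> K * exp (h * real n)"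
proof -
  obtain n0 where n0: "\<And>n. n \<ge> n0 \<Longrightarrow> f n \<le> exp (h * real n)"
    using assms by (auto simp: eventually_sequentially)
  define K where "K = 1 + (\<Sum>n<n0. \<bar>f n\<bar> * exp (- (h * real n)))"
  have K1: "K \<ge> 1" unfolding K_def by (simp add: sum_nonneg)
  have "f n \<le> K * exp (h * real n)" for n
  proof (cases "n < n0")
    case True
    have "\<bar>f n\<bar> * exp (- (h * real n)) \<le> (\<Sum>n<n0. \<bar>f n\<bar> * exp (- (h * real n)))"
      using True by (intro member_le_sum) auto
    then have "\<bar>f n\<bar> * exp (- (h * real n)) \<le> K" by (simp add: K_def)
    then have "\<bar>f n\<bar> * exp (- (h * real n)) * exp (h * real n) \<le> K * exp (h * real n)"
      by (rule mult_right_mono) simp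
    then show ?thesis by (simp add: mult.assoc flip: exp_add)
  next
    case False
    then have "f n \<le> 1 * exp (h * real n)" using n0 by simp
    also have "\<dots> \<le> K * exp (h * real n)" using K1 by (intro mult_right_mono) auto
    finally show ?thesis .
  qed
  then show ?thesis using K1 by blast
qed

text \<open>Otherwise the counts of all three factors of a decomposition would be O(exp (h i)) at
  their lengths i, and summing over the at most (n + 1)^2 ways to split n would bound the growth of
  the whole language by h. Growth is a limsup, so only infinitely many lengths are obtained; later
  lengths are picked by \<open>frequently_ex_ge\<close>.\<close>

lemma core_growth:
  fixes h :: real
  assumes sub: "subshift ts m S" and dec: "decomposes (language ts S) Cp G Cs"
    and incl: "Cp \<subseteq> language ts S" "G \<subseteq> language ts S" "Cs \<subseteq> language ts S"
    and h: "growth (Cp \<union> Cs) < ereal h" "ereal h < htop ts S"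
  shows "\<exists>\<^sub>F n in sequentially. exp (h * real n) \<le> real (card (words_len G n))"
proof (rule ccontr)
  assume "\<not> ?thesis"
  then have "\<forall>\<^sub>F n in sequentially. real (card (words_len G n)) \<le> exp (h * real n)"
    by (auto simp: not_frequently elim: eventually_mono)
  from eventually_bound_all[OF this] obtain K1 where K1: "K1 \<ge> 1"
    "\<And>n. real (card (words_len G n)) \<le> K1 * exp (h * real n)" by blast
  from eventually_bound_all[OF growth_lessD[OF h(1)]] obtain K2 where K2: "K2 \<ge> 1"
    "\<And>n. real (card (words_len (Cp \<union> Cs) n)) \<le> K2 * exp (h * real n)" by blast
  have main: "real (card (words_len (language ts S) n)) \<le> real ((n + 1) ^ 2) * (K2 * K1 * K2 * exp (h * real n))" for n
  proof -
    let ?I = "{(i,j). i + j \<le> n}"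
    have I_sub: "?I \<subseteq> {..n} \<times> {..n}" by auto
    have I: "finite ?I" "card ?I \<le> (n + 1) ^ 2"
      using card_mono[OF _ I_sub] finite_subset[OF I_sub]
      by (auto simp: card_cartesian_product power2_eq_square)
    have "real (card (words_len (language ts S) n)) \<le> 
      real (\<Sum>(i,j)\<in>?I. card (words_len (Cp \<union> Cs) i) * card (words_len G j) * card (words_len (Cp \<union> Cs) (n - i - j)))"
      using card_words_len_decomposes[OF sub dec incl, of n] by (rule of_nat_mono)
    also have "\<dots> = (\<Sum>(i,j)\<in>?I. real (card (words_len (Cp \<union> Cs) i)) * real (card (words_len G j)) * real (card (words_len (Cp \<union> Cs) (n - i - j))))"
      by (simp add: case_prod_unfold)
    also have "\<dots> \<le> (\<Sum>ij\<in>?I. K2 * K1 * K2 * exp (h * real n))"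
    proof (rule sum_mono)
      fix ij assume "ij \<in> ?I"
      define i j where "i = fst ij" and "j = snd ij"
      have ij: "i + j \<le> n" using \<open>ij \<in> ?I\<close> by (auto simp: i_def j_def)
      have "real (card (words_len (Cp \<union> Cs) i)) * real (card (words_len G j)) * real (card (words_len (Cp \<union> Cs) (n - i - j)))
        \<le> (K2 * exp (h * real i)) * (K1 * exp (h * real j)) * (K2 * exp (h * real (n - i - j)))"
        using K1 K2 by (intro mult_mono) auto
      also have "\<dots> = K2 * K1 * K2 * exp (h * real i + h * real j + h * real (n - i - j))"
        by (simp add: exp_add)
      also have "h * real i + h * real j + h * real (n - i - j) = h * real n"
        using ij by (simp add: algebra_simps of_nat_diff)
      finally show "(case ij of (i, j) \<Rightarrow> real (card (words_len (Cp \<union> Cs) i)) * real (card (words_len G j))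
          * real (card (words_len (Cp \<union> Cs) (n - i - j)))) \<le> K2 * K1 * K2 * exp (h * real n)"
        by (simp add: i_def j_def case_prod_beta)
    qed
    also have "\<dots> = real (card ?I) * (K2 * K1 * K2 * exp (h * real n))" by simp
    also have "\<dots> \<le> real ((n + 1) ^ 2) * (K2 * K1 * K2 * exp (h * real n))"
      using I K1 K2 by (intro mult_right_mono of_nat_mono) auto
    finally show ?thesis .
  qed
  obtain h' where h': "h < h'" "ereal h' < htop ts S" using ereal_dense2[OF h(2)] by auto
  define K where "K = K2 * K1 * K2"
  have "K > 0" using K1 K2 by (simp add: K_def)
  have "\<forall>\<^sub>F n in sequentially. real ((n + 1) ^ 2) * (K * exp (h * real n)) \<le> exp (h' * real n)"
  proof -
    define d where "d = h' - h"
    have d: "d > 0" using h' by (simp add: d_def)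
    have "\<forall>\<^sub>F n in sequentially. (real n + 1) ^ 2 * K \<le> exp (d * real n)"
      using d \<open>K > 0\<close> by real_asymp
    then show ?thesis
    proof eventually_elim
      case (elim n)
      have "(real n + 1) ^ 2 * K * exp (h * real n) \<le> exp (d * real n) * exp (h * real n)"
        using elim by (rule mult_right_mono) simp
      then show ?case by (simp add: d_def algebra_simps flip: exp_add)
    qed
  qed
  then have "\<forall>\<^sub>F n in sequentially. real (card (words_len (language ts S) n)) \<le> exp (h' * real n)"
    by (rule eventually_mono) (use main K_def in \<open>metis order_trans\<close>)
  then have "htop ts S \<le> ereal h'" unfolding htop_def by (rule growth_leI)
  then show False using h' by simp
qed

section \<open>Gap chains and avoided words\<close>

text \<open>The words that can be joined at will. At least two words of G occur, as (W') asks; a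
  single word of G qualifies after padding with the empty word
  (\<open>gap_chain_gen\<close>).\<close>

definition gap_chain :: "bool \<Rightarrow> (int \<Rightarrow> nat) set \<Rightarrow> nat list set \<Rightarrow> nat \<Rightarrow> nat list \<Rightarrow> bool" where
  "gap_chain ts S G t y \<longleftrightarrow> y \<in> language ts S \<and> (\<exists>n v w. 1 \<le> n \<and> y = chain v w 1 n \<and>
     (\<forall>i\<in>{1..n+1}. v i \<in> G) \<and> (\<forall>i\<in>{1..n}. w i \<in> language ts S \<and> length (w i) \<le> t))"

lemma chain_cong:
  assumes "\<And>i. i \<in> {a..a+n} \<Longrightarrow> v i = v' (i + d)" "\<And>i. i \<in> {a..<a+n} \<Longrightarrow> w i = w' (i + d)"
  shows "chain v w a n = chain v' w' (a + d) n"
proof -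
  have "map (\<lambda>i. w' i @ v' (Suc i)) [a+d..<a+d+n] = map (\<lambda>i. w i @ v (Suc i)) [a..<a+n]"
    using assms(2) assms(1)[of "Suc _"] by (intro nth_equalityI) (auto simp: ac_simps)
  then show ?thesis using assms(1)[of a] by (simp add: chain_def)
qed

lemma chain_split: "chain v w a (n1 + 1 + n2) = chain v w a n1 @ w (a + n1) @ chain v w (a + n1 + 1) n2"
proof -
  have "[a..<a + (n1 + 1 + n2)] = [a..<a + n1] @ [a + n1] @ [a + n1 + 1..<a + n1 + 1 + n2]"
    using upt_add_eq_append[of a "a + n1" "1 + n2"] by (simp add: upt_conv_Cons add.assoc)
  then show ?thesis by (simp add: chain_def)
qed

lemma language_Nil: "subshift ts m S \<Longrightarrow> [] \<in> language ts S"
  by (force simp: subshift_def language_def idx_def split: if_splits)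

lemma gap_chain_gen:
  assumes "subshift ts m S" "G \<subseteq> language ts S" "[] \<in> G" "g \<in> G"
  shows "gap_chain ts S G t g"
  unfolding gap_chain_def
proof (intro conjI exI)
  show "g = chain (\<lambda>i. if i = 1 then g else []) (\<lambda>_. []) 1 1" by (simp add: chain_def)
qed (use assms language_Nil in auto)

lemma gap_chain_join:
  assumes u: "gap_chain ts S G t u" and v: "gap_chain ts S G t v"
    and w: "w \<in> language ts S" "length w \<le> t" and uwv: "u @ w @ v \<in> language ts S"
  shows "gap_chain ts S G t (u @ w @ v)"
proof -
  obtain n1 v1 w1 where 1: "1 \<le> n1" "u = chain v1 w1 1 n1" "\<forall>i\<in>{1..n1+1}. v1 i \<in> G"
    "\<forall>i\<in>{1..n1}. w1 i \<in> language ts S \<and> length (w1 i) \<le> t" using u by (auto simp: gap_chain_def)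
  obtain n2 v2 w2 where 2: "1 \<le> n2" "v = chain v2 w2 1 n2" "\<forall>i\<in>{1..n2+1}. v2 i \<in> G"
    "\<forall>i\<in>{1..n2}. w2 i \<in> language ts S \<and> length (w2 i) \<le> t" using v by (auto simp: gap_chain_def)
  define v' where "v' i = (if i \<le> n1 + 1 then v1 i else v2 (i - (n1 + 1)))" for i
  define w' where "w' i = (if i \<le> n1 then w1 i else if i = n1 + 1 then w else w2 (i - (n1 + 1)))" for i
  have "chain v' w' 1 n1 = chain v1 w1 (1 + 0) n1"
    by (rule chain_cong) (auto simp: v'_def w'_def)
  moreover have "chain v2 w2 1 n2 = chain v' w' (1 + (n1 + 1)) n2"
    by (rule chain_cong) (auto simp: v'_def w'_def)
  ultimately have "u @ w @ v = chain v' w' 1 (n1 + 1 + n2)"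
    using 1 2 by (simp only: chain_split) (simp add: w'_def)
  moreover have "\<forall>i\<in>{1..n1 + 1 + n2 + 1}. v' i \<in> G"
  proof
    fix i assume "i \<in> {1..n1 + 1 + n2 + 1}"
    then have "i \<in> {1..n1 + 1} \<or> \<not> i \<le> n1 + 1 \<and> i - (n1 + 1) \<in> {1..n2 + 1}" by auto
    then show "v' i \<in> G" using 1(3) 2(3) by (auto simp: v'_def)
  qed
  moreover have "\<forall>i\<in>{1..n1 + 1 + n2}. w' i \<in> language ts S \<and> length (w' i) \<le> t"
  proof
    fix i assume "i \<in> {1..n1 + 1 + n2}"
    then have "i \<in> {1..n1} \<or> i = n1 + 1 \<or> \<not> i \<le> n1 + 1 \<and> i - (n1 + 1) \<in> {1..n2}" by auto
    then show "w' i \<in> language ts S \<and> length (w' i) \<le> t" using 1(4) 2(4) w by (auto simp: w'_def)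
  qed
  moreover have "1 \<le> n1 + 1 + n2" by simp
  ultimately show ?thesis using uwv unfolding gap_chain_def by blast
qed

text \<open>Two chains and their connecting word form one longer chain, so (W') turns into a binary
  operation on chains that can be iterated without end.\<close>

lemma W'_spec_gap_chain:
  assumes spec: "W'_spec ts S G" and sub: "subshift ts m S"
  obtains t where "\<And>u v. gap_chain ts S G t u \<Longrightarrow> gap_chain ts S G t v \<Longrightarrow>
    \<exists>w. length w \<le> t \<and> gap_chain ts S G t (u @ w @ v)"
proof -
  obtain t where t: "\<And>j k v w. 2 \<le> j \<Longrightarrow> 2 \<le> k \<Longrightarrow> (\<forall>i\<in>{1..j+k}. v i \<in> G)
        \<Longrightarrow> (\<forall>i\<in>{1..j+k-1}. w i \<in> language ts S \<and> length (w i) \<le> t)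
        \<Longrightarrow> chain v w 1 (j - 1) \<in> language ts S
        \<Longrightarrow> chain v w (j + 1) (k - 1) \<in> language ts S
        \<Longrightarrow> (\<exists>u\<in>language ts S. length u \<le> t \<and>
               chain v w 1 (j - 1) @ u @ chain v w (j + 1) (k - 1) \<in> language ts S)"
    using spec unfolding W'_spec_def by metis
  show thesis
  proof (rule that)
    fix u v assume u: "gap_chain ts S G t u" and v: "gap_chain ts S G t v"
    obtain n1 v1 w1 where 1: "1 \<le> n1" "u = chain v1 w1 1 n1" "\<forall>i\<in>{1..n1+1}. v1 i \<in> G"
      "\<forall>i\<in>{1..n1}. w1 i \<in> language ts S \<and> length (w1 i) \<le> t" using u by (auto simp: gap_chain_def)
    obtain n2 v2 w2 where 2: "1 \<le> n2" "v = chain v2 w2 1 n2" "\<forall>i\<in>{1..n2+1}. v2 i \<in> G"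
      "\<forall>i\<in>{1..n2}. w2 i \<in> language ts S \<and> length (w2 i) \<le> t" using v by (auto simp: gap_chain_def)
    define v' where "v' i = (if i \<le> n1 + 1 then v1 i else v2 (i - (n1 + 1)))" for i
    \<comment> \<open>Index \<open>n1 + 1\<close> belongs to neither chain; the empty word there
      satisfies what (W') requires of every index.\<close>
    define w' where "w' i = (if i \<le> n1 then w1 i else if i = n1 + 1 then [] else w2 (i - (n1 + 1)))" for i
    have c1: "chain v' w' 1 n1 = chain v1 w1 (1 + 0) n1"
      by (rule chain_cong) (auto simp: v'_def w'_def)
    have c2: "chain v2 w2 1 n2 = chain v' w' (1 + (n1 + 1)) n2"
      by (rule chain_cong) (auto simp: v'_def w'_def)
    have "\<forall>i\<in>{1..(n1 + 1) + (n2 + 1)}. v' i \<in> G"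
    proof
      fix i assume "i \<in> {1..(n1 + 1) + (n2 + 1)}"
      then have "i \<in> {1..n1 + 1} \<or> \<not> i \<le> n1 + 1 \<and> i - (n1 + 1) \<in> {1..n2 + 1}" by auto
      then show "v' i \<in> G" using 1(3) 2(3) by (auto simp: v'_def)
    qed
    moreover have "\<forall>i\<in>{1..(n1 + 1) + (n2 + 1) - 1}. w' i \<in> language ts S \<and> length (w' i) \<le> t"
    proof
      fix i assume "i \<in> {1..(n1 + 1) + (n2 + 1) - 1}"
      then have "i \<in> {1..n1} \<or> i = n1 + 1 \<or> \<not> i \<le> n1 + 1 \<and> i - (n1 + 1) \<in> {1..n2}" by auto
      then show "w' i \<in> language ts S \<and> length (w' i) \<le> t"
        using 1(4) 2(4) language_Nil[OF sub] by (auto simp: w'_def)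
    qed
    moreover have u': "chain v' w' 1 ((n1 + 1) - 1) = u" using 1 c1 by simp
    moreover have v': "chain v' w' ((n1 + 1) + 1) ((n2 + 1) - 1) = v" using 2 c2 by (simp add: add.commute)
    ultimately have "\<exists>w\<in>language ts S. length w \<le> t \<and> u @ w @ v \<in> language ts S"
      using t[of "n1 + 1" "n2 + 1" v' w'] 1(1) 2(1) u v by (simp add: gap_chain_def)
    then show "\<exists>w. length w \<le> t \<and> gap_chain ts S G t (u @ w @ v)"
      using gap_chain_join[OF u v] by blast
  qed
qed

definition pieces :: "nat \<Rightarrow> nat \<Rightarrow> nat list set \<Rightarrow> nat list set" where
  "pieces m t F = {u @ f | u f. set u \<subseteq> {..<m} \<and> length u \<le> t \<and> f \<in> F}"

definition avoids :: "nat list set \<Rightarrow> nat list \<Rightarrow> bool" where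
  "avoids P w \<longleftrightarrow> (\<forall>ps. set ps \<subseteq> P \<longrightarrow> \<not> sublist w (concat ps))"

lemma pieces_eq_image:
  "pieces m t F = (\<lambda>(u, f). u @ f) ` ({u. set u \<subseteq> {..<m} \<and> length u \<le> t} \<times> F)"
  by (auto simp: pieces_def)

lemma finite_pieces: "finite F \<Longrightarrow> finite (pieces m t F)"
  unfolding pieces_eq_image by (intro finite_imageI finite_cartesian_product finite_lists_length_le) auto

lemma card_pieces_le:
  assumes "finite F"
  shows "card (pieces m t F) \<le> (\<Sum>i\<le>t. m ^ i) * card F"
proof -
  have fin: "finite {u. set u \<subseteq> {..<m} \<and> length u \<le> t}" by (intro finite_lists_length_le) auto
  have "card (pieces m t F) \<le> card ({u. set u \<subseteq> {..<m} \<and> length u \<le> t} \<times> F)"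
    unfolding pieces_eq_image using assms fin by (intro card_image_le) auto
  also have "\<dots> = (\<Sum>i\<le>t. m ^ i) * card F"
    by (simp add: card_cartesian_product card_lists_length_le)
  finally show ?thesis .
qed

lemma concat_suffix:
  assumes "concat ps = a @ z" "set ps \<subseteq> P" "P \<noteq> {}"
  shows "\<exists>v qs. (\<exists>p\<in>P. suffix v p) \<and> set qs \<subseteq> P \<and> z = v @ concat qs"
  using assms(1,2)
proof (induction ps arbitrary: a)
  case Nil
  then show ?case using assms(3) by (intro exI[of _ "[]"]) auto
next
  case (Cons p ps)
  then have "p @ concat ps = a @ z" by simp
  then consider us where "p = a @ us" "us @ concat ps = z" | us where "a = p @ us" "concat ps = us @ z"
    by (auto simp: append_eq_append_conv2)
  then show ?case
  proof cases
    case 1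
    then show ?thesis using Cons.prems by (intro exI[of _ us] exI[of _ ps]) (auto simp: suffix_def)
  next
    case 2
    then show ?thesis using Cons by auto
  qed
qed

lemma length_concat_ge:
  assumes "\<And>p. p \<in> set ps \<Longrightarrow> N \<le> length p"
  shows "length ps * N \<le> length (concat ps)"
  using assms by (induction ps) fastforce+

text \<open>A factor of length n is determined by the tail of the piece in which it begins and by
  the next n div N + 1 whole pieces, which are long enough to cover the rest. C is the number of
  possible tails.\<close>

lemma card_factors_le:
  assumes P: "finite P" "P \<noteq> {}" and N: "1 \<le> N" "\<And>p. p \<in> P \<Longrightarrow> N \<le> length p"
  shows "\<exists>C. \<forall>n. finite {w. length w = n \<and> \<not> avoids P w} \<and>
    card {w. length w = n \<and> \<not> avoids P w} \<le> C * card P ^ (n div N + 1)"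
proof -
  define T where "T = {v. \<exists>p\<in>P. suffix v p}"
  have finT: "finite T"
  proof -
    have "T = (\<Union>p\<in>P. set (suffixes p))" by (auto simp: T_def)
    then show ?thesis using P by simp
  qed
  obtain p0 where p0: "p0 \<in> P" using P by blast
  have "finite {w. length w = n \<and> \<not> avoids P w} \<and>
    card {w. length w = n \<and> \<not> avoids P w} \<le> card T * card P ^ (n div N + 1)" for n
  proof -
    define K where "K = n div N + 1"
    define D where "D = T \<times> {ps. set ps \<subseteq> P \<and> length ps = K}"
    have sub: "{w. length w = n \<and> \<not> avoids P w} \<subseteq> (\<lambda>(v, ps). take n (v @ concat ps)) ` D"
    proof clarify
      fix w assume n: "n = length w" and "\<not> avoids P w"
      then obtain ps a b where ps: "set ps \<subseteq> P" "concat ps = a @ (w @ b)"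
        by (auto simp: avoids_def sublist_def)
      obtain v qs where v: "v \<in> T" "set qs \<subseteq> P" "w @ b = v @ concat qs"
        using concat_suffix[OF ps(2,1) P(2)] by (auto simp: T_def)
      \<comment> \<open>The padding provides K whole pieces even if the given concatenation ends
        earlier.\<close>
      define rs where "rs = qs @ replicate K p0"
      have rs: "set (take K rs) \<subseteq> P" "length (take K rs) = K"
        using v(2) p0 set_take_subset[of K rs] by (auto simp: rs_def)
      have "n < N * K" using dividend_less_times_div[of N n] N(1) by (simp add: K_def)
      moreover have "length (take K rs) * N \<le> length (concat (take K rs))"
        using rs(1) N(2) by (intro length_concat_ge) blast
      ultimately have len: "n \<le> length (concat (take K rs))" using rs(2) by (simp add: mult.commute)
      have "w = take n (w @ b)" using n by simp
      also have "\<dots> = take n (v @ concat rs)"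
      proof -
        have "v @ concat rs = w @ b @ concat (replicate K p0)"
          using v(3) by (simp add: rs_def flip: append_assoc)
        then show ?thesis using n by simp
      qed
      also have "concat rs = concat (take K rs) @ concat (drop K rs)"
        by (metis append_take_drop_id concat_append)
      also have "take n (v @ concat (take K rs) @ concat (drop K rs)) = take n (v @ concat (take K rs))"
        using len by simp
      finally show "w \<in> (\<lambda>(v, ps). take (length w) (v @ concat ps)) ` D"
        using rs v(1) n by (auto simp: D_def intro!: image_eqI[of _ _ "(v, take K rs)"])
    qed
    have finD: "finite D" using finT P finite_lists_length_eq[of P K] by (auto simp: D_def)
    have "card {w. length w = n \<and> \<not> avoids P w} \<le> card D"
      using sub finD by (rule surj_card_le[rotated])
    also have "card D = card T * card P ^ K"
      using P by (simp add: D_def card_cartesian_product card_lists_length_eq)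
    finally show ?thesis using sub finD finite_subset finite_imageI unfolding K_def by blast
  qed
  then show ?thesis by blast
qed

lemma frequently_ex_ge:
  fixes n0 :: nat
  assumes "\<exists>\<^sub>F n in sequentially. P n" "\<forall>\<^sub>F n in sequentially. Q n"
  shows "\<exists>n\<ge>n0. P n \<and> Q n"
proof -
  have "\<forall>\<^sub>F n in sequentially. Q n \<and> n0 \<le> n"
    using assms(2) eventually_ge_at_top by (rule eventually_conj)
  from frequently_ex[OF frequently_eventually_conj[OF assms(1) this]] show ?thesis by blast
qed

text \<open>At most exp (h3 N) pieces, each costing at least N letters, produce factors of growth
  rate at most h3. For infinitely many lengths G has more words than that.\<close>

lemma exists_avoiding:
  fixes h3 h4 :: real
  assumes P: "finite P" "P \<noteq> {}" and N: "1 \<le> N" "\<And>p. p \<in> P \<Longrightarrow> N \<le> length p"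
    and cP: "real (card P) \<le> exp (h3 * real N)" and h: "0 \<le> h3" "h3 < h4"
    and G: "\<exists>\<^sub>F n in sequentially. exp (h4 * real n) \<le> real (card (words_len G n))"
  shows "\<exists>w\<in>G. n0 \<le> length w \<and> avoids P w"
proof -
  obtain C where C: "\<And>n. finite {w. length w = n \<and> \<not> avoids P w}"
    "\<And>n. card {w. length w = n \<and> \<not> avoids P w} \<le> C * card P ^ (n div N + 1)"
    using card_factors_le[OF P N] by blast
  have up: "real (C * card P ^ (n div N + 1)) \<le> real C * exp (h3 * real N) * exp (h3 * real n)" for n
  proof -
    have "real (card P ^ (n div N + 1)) \<le> exp (h3 * real N) ^ (n div N + 1)"
      unfolding of_nat_power using cP by (rule power_mono) simp
    also have "\<dots> = exp (h3 * real N) * exp (h3 * real (N * (n div N)))"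
      by (simp add: algebra_simps flip: exp_of_nat_mult exp_add)
    also have "\<dots> \<le> exp (h3 * real N) * exp (h3 * real n)"
      using h by (intro mult_left_mono iffD2[OF exp_le_cancel_iff] of_nat_mono) auto
    finally show ?thesis using mult_left_mono[of _ _ "real C"] by (simp add: mult.assoc)
  qed
  have "\<forall>\<^sub>F n in sequentially. real C * exp (h3 * real N) * exp (h3 * real n) < exp (h4 * real n)"
  proof -
    define d where "d = h4 - h3"
    have d: "d > 0" using h by (simp add: d_def)
    define E where "E = real C * exp (h3 * real N)"
    have "\<forall>\<^sub>F n in sequentially. E < exp (d * real n)" using d by real_asymp
    then show ?thesis unfolding E_def[symmetric]
    proof eventually_elim
      case (elim n)
      then have "E * exp (h3 * real n) < exp (d * real n) * exp (h3 * real n)" by simp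
      then show ?case by (simp add: d_def algebra_simps flip: exp_add)
    qed
  qed
  from frequently_ex_ge[OF G this]
  obtain n where n: "exp (h4 * real n) \<le> real (card (words_len G n))"
      "real C * exp (h3 * real N) * exp (h3 * real n) < exp (h4 * real n)" "n0 \<le> n"
    by blast
  have "real (C * card P ^ (n div N + 1)) < real (card (words_len G n))" using up[of n] n by linarith
  then have "C * card P ^ (n div N + 1) < card (words_len G n)" by (simp only: of_nat_less_iff)
  with C(2)[of n] have "card {w. length w = n \<and> \<not> avoids P w} < card (words_len G n)" by (rule le_less_trans)
  then have "\<not> words_len G n \<subseteq> {w. length w = n \<and> \<not> avoids P w}"
    using C(1) card_mono leD by blast
  then show ?thesis using n by (auto simp: words_len_def)
qed

text \<open>A rate h3 strictly between h' and h4 absorbs the number \<open>Q\<close> of possible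
  gaps, so that the pieces over F, and even over F with V added, number at most exp (h3 N). V has
  length at least N because it counts as a block when W is chosen; \<open>t \<le> N\<close> is used
  in \<open>nested\<close>.\<close>

lemma select_words:
  fixes h' h4 :: real
  assumes h: "0 \<le> h'" "h' < h4"
    and G: "\<exists>\<^sub>F n in sequentially. exp (h4 * real n) \<le> real (card (words_len G n))"
    and finG: "\<And>n. finite (words_len G n)" and m: "1 \<le> m"
  obtains N F V W where "1 \<le> N" "t \<le> N" "F \<subseteq> G" "finite F" "F \<noteq> {}" "\<And>f. f \<in> F \<Longrightarrow> length f = N"
    "V \<in> G" "N \<le> length V" "W \<in> G" "1 \<le> length W"
    "avoids (pieces m t F) V" "avoids (pieces m t (insert V F)) W"
    "(3 * real t + 1) * exp (h' * (real N + real t + 1)) \<le> real (card F)"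
proof -
  define h3 where "h3 = (h' + h4) / 2"
  have h3: "h' < h3" "h3 < h4" "0 \<le> h3" using h by (auto simp: h3_def)
  define Q where "Q = real (\<Sum>i\<le>t. m ^ i)"
  have "1 \<le> (\<Sum>i\<le>t. m ^ i)" using member_le_sum[of 0 "{..t}" "\<lambda>i. m ^ i"] by simp
  then have Q1: "Q \<ge> 1" unfolding Q_def by (metis of_nat_1 of_nat_mono)
  define T where "T = real t"
  have T: "T \<ge> 0" by (simp add: T_def)
  \<comment> \<open>The summand 2 covers the rounding in \<open>f\<close> and the additional block
    V.\<close>
  have "\<forall>\<^sub>F n in sequentially. Q * ((3 * T + 1) * exp (h' * (real n + T + 1)) + 2) \<le> exp (h3 * real n)"
  proof -
    define d where "d = h3 - h'"
    have d: "d > 0" using h3 by (simp add: d_def)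
    define E where "E = Q * (3 * T + 1) * exp (h' * (T + 1)) + 2 * Q"
    have "\<forall>\<^sub>F n in sequentially. E < exp (d * real n)" using d by real_asymp
    then show ?thesis
    proof eventually_elim
      case (elim n)
      have "Q * ((3 * T + 1) * exp (h' * (real n + T + 1)) + 2)
          = Q * (3 * T + 1) * exp (h' * (T + 1)) * exp (h' * real n) + 2 * Q * 1"
        by (simp add: algebra_simps flip: exp_add)
      also have "\<dots> \<le> Q * (3 * T + 1) * exp (h' * (T + 1)) * exp (h' * real n) + 2 * Q * exp (h' * real n)"
        using h Q1 by (intro add_left_mono mult_left_mono) auto
      also have "\<dots> = E * exp (h' * real n)" by (simp add: E_def algebra_simps)
      also have "\<dots> \<le> exp (d * real n) * exp (h' * real n)" using elim by (intro mult_right_mono) auto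
      finally show ?case by (simp add: d_def algebra_simps flip: exp_add)
    qed
  qed
  from frequently_ex_ge[OF G this]
  obtain N where N: "exp (h4 * real N) \<le> real (card (words_len G N))"
      "Q * ((3 * T + 1) * exp (h' * (real N + T + 1)) + 2) \<le> exp (h3 * real N)" "t + 1 \<le> N"
    by blast
  \<comment> \<open>F has to be large for the dimension, yet small enough for words of G to escape
    its concatenations; so just \<open>f\<close> of the words of length N are kept.\<close>
  define f where "f = nat \<lceil>(3 * T + 1) * exp (h' * (real N + T + 1))\<rceil>"
  have pos: "(3 * T + 1) * exp (h' * (real N + T + 1)) > 0" using T by (intro mult_pos_pos) auto
  have f: "(3 * T + 1) * exp (h' * (real N + T + 1)) \<le> real f"
    "real f \<le> (3 * T + 1) * exp (h' * (real N + T + 1)) + 1"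
    using pos unfolding f_def by linarith+
  have "real f \<le> Q * ((3 * T + 1) * exp (h' * (real N + T + 1)) + 2)"
    using f pos by (intro order_trans[OF _ mult_right_mono[OF Q1]]) auto
  also have "\<dots> \<le> exp (h4 * real N)" using N(2) h3 by (meson exp_le_cancel_iff less_imp_le mult_right_mono of_nat_0_le_iff order_trans)
  finally have "f \<le> card (words_len G N)" using N(1) by simp
  then obtain F where F: "F \<subseteq> words_len G N" "card F = f" "finite F"
    using obtain_subset_with_card_n by metis
  have "f > 0" using f pos by linarith
  then have "F \<noteq> {}" using F by auto
  have Flen: "length u = N" if "u \<in> F" for u using F(1) that by (auto simp: words_len_def)
  have cardP: "real (card (pieces m t F')) \<le> exp (h3 * real N)" if "finite F'" "card F' \<le> f + 1" for F'
  proof -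
    have "real (card (pieces m t F')) \<le> real ((\<Sum>i\<le>t. m ^ i) * (f + 1))"
      using card_pieces_le[OF that(1), of m t] mult_left_mono[OF that(2), of "\<Sum>i\<le>t. m ^ i"] by (intro of_nat_mono) linarith
    also have "\<dots> = Q * (real f + 1)" by (simp only: Q_def of_nat_mult of_nat_add of_nat_1)
    also have "\<dots> \<le> Q * ((3 * T + 1) * exp (h' * (real N + T + 1)) + 2)"
      using f Q1 by (intro mult_left_mono) auto
    finally show ?thesis using N(2) by linarith
  qed
  have ne: "pieces m t F' \<noteq> {}" if F': "F' \<noteq> {}" for F'
  proof -
    obtain g where "g \<in> F'" using F' by blast
    then have "[] @ g \<in> pieces m t F'" unfolding pieces_def by fastforce
    then show ?thesis by blast
  qed
  have "\<exists>V\<in>G. N \<le> length V \<and> avoids (pieces m t F) V"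
  proof (rule exists_avoiding[OF finite_pieces[OF F(3)] ne _ _ cardP h3(3,2) G])
    show "1 \<le> N" using N by simp
    show "N \<le> length p" if "p \<in> pieces m t F" for p using that Flen by (auto simp: pieces_def)
  qed (use F \<open>F \<noteq> {}\<close> in auto)
  then obtain V where V: "V \<in> G" "N \<le> length V" "avoids (pieces m t F) V" by blast
  have "\<exists>W\<in>G. 1 \<le> length W \<and> avoids (pieces m t (insert V F)) W"
  proof (rule exists_avoiding[OF finite_pieces ne _ _ cardP h3(3,2) G])
    show "1 \<le> N" using N by simp
    show "N \<le> length p" if "p \<in> pieces m t (insert V F)" for p
      using that Flen V by (fastforce simp: pieces_def)
    show "card (insert V F) \<le> f + 1" using F card_insert_le_m1[of "f+1" F V] by simp
  qed (use F in auto)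
  then obtain W where W: "W \<in> G" "1 \<le> length W" "avoids (pieces m t (insert V F)) W" by blast
  show thesis
    using that[of N F V W] N F V W Flen \<open>F \<noteq> {}\<close> f(1) by (auto simp: T_def words_len_def)
qed

section \<open>Occurrences of prefixes and recurrence rates\<close>

text \<open>\<open>X\<close> is a sequence into which copies of its own prefixes have been inserted: at \<open>p i\<close> the
  prefix of length \<open>l i\<close>. The first \<open>M\<close> letters serve as a marker that occurs only where such a copy,
  possibly nested in another one, begins.\<close>

lemma prefix_occurrence:
  fixes X p l :: "nat \<Rightarrow> nat"
  assumes M: "0 < M" and l: "\<And>i. 3 * M \<le> l i" and p0: "3 * M \<le> p 0" and p: "strict_mono p"
    and copy: "\<And>i r. r < l i \<Longrightarrow> X (p i + r) = X r"
    and marker0: "\<And>q. M \<le> q \<Longrightarrow> q + M \<le> p 0 \<Longrightarrow> \<exists>r<M. X (q + r) \<noteq> X r"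
    and marker: "\<And>i q. p i + l i \<le> q + 3 * M \<Longrightarrow> q + M \<le> p (Suc i) \<Longrightarrow> \<exists>r<M. X (q + r) \<noteq> X r"
    and mismatch: "\<And>i. \<exists>r < l i + C. X (p i + r) \<noteq> X r"
    and nested: "\<And>i j. p j < l i \<Longrightarrow> p j + l j + C \<le> l i"
    and q: "1 \<le> q" "\<And>r. r < n \<Longrightarrow> X (q + r) = X r" "3 * M \<le> n"
  shows "\<exists>i. p i \<le> q \<and> q + n < p i + l i + C"
proof -
  \<comment> \<open>A period r < M of the first 3M letters would repeat the marker at a multiple of
    r between M and 2M, where \<open>marker0\<close> excludes it.\<close>
  have period: False if "0 < r" "r < M" "\<And>i. i + r < 3 * M \<Longrightarrow> X (i + r) = X i" for r
  proof -
    have mult: "X (i + k * r) = X i" if "i + k * r < 3 * M" for i k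
      using that
    proof (induction k)
      case (Suc k)
      have "X (i + Suc k * r) = X (i + k * r)"
        using \<open>\<And>i. i + r < 3 * M \<Longrightarrow> _\<close>[of "i + k * r"] Suc.prems by (simp add: algebra_simps)
      then show ?case using Suc by simp
    qed simp
    define k where "k = (M - 1) div r + 1"
    have "(M - 1) div r * r + (M - 1) mod r = M - 1" by simp
    moreover have "(M - 1) mod r < r" using that by simp
    ultimately have k: "M \<le> k * r" "k * r < 2 * M" using that M unfolding k_def add_mult_distrib by linarith+
    obtain i where i: "i < M" "X (k * r + i) \<noteq> X i" using marker0[of "k * r"] k p0 by fastforce
    then show False using mult[of i k] k by (simp add: add.commute)
  qed
  show ?thesis using q
  proof (induction q arbitrary: n rule: less_induct)
    case (less q)
    have W: "X (q + r) = X r" if "r < 3 * M" for r using less.prems that by simp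
    \<comment> \<open>An occurrence starting fewer than M letters before a copy overlaps the
      beginning of that copy; comparing the two shows the period p i - q.\<close>
    have near: False if "q < p i" "p i < q + M" for i
    proof (rule period)
      fix r assume r: "r + (p i - q) < 3 * M"
      have "X (r + (p i - q)) = X (q + (r + (p i - q)))" using W[OF r] by simp
      also have "\<dots> = X (p i + r)" using that by (simp add: algebra_simps)
      also have "\<dots> = X r" using copy[of r i] l[of i] r by simp
      finally show "X (r + (p i - q)) = X r" .
    qed (use that in auto)
    have noM: "\<not> (\<exists>r<M. X (q + r) \<noteq> X r)" using W M by simp
    show ?case
    proof (cases "q < p 0")
      case True
      have "\<not> M \<le> q \<or> \<not> q + M \<le> p 0" using marker0[of q] noM by blast
      moreover have False if "q < M"
      proof (rule period[of q])
        fix i assume "i + q < 3 * M"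
        then show "X (i + q) = X i" using W[of i] by (simp add: add.commute)
      qed (use that less.prems in auto)
      ultimately show ?thesis using near[of 0] True by fastforce
    next
      case False
      have ge: "j \<le> p j" for j using p by (rule strict_mono_imp_increasing)
      define i where "i = (GREATEST i. p i \<le> q)"
      have bnd: "j \<le> q" if "p j \<le> q" for j using ge[of j] that by (rule order_trans)
      have "p 0 \<le> q" using False by simp
      then have i: "p i \<le> q" unfolding i_def by (rule GreatestI_nat) (rule bnd)
      have "Suc i \<le> i" if "p (Suc i) \<le> q"
        using that unfolding i_def by (rule Greatest_le_nat) (rule bnd)
      then have "\<not> p (Suc i) \<le> q" by auto
      then have i': "q < p (Suc i)" by simp
      show ?thesis
      proof (cases "q = p i")
        case True
        obtain r where "r < l i + C" "X (p i + r) \<noteq> X r" using mismatch by blast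
        then have "n \<le> r" using less.prems(2)[of r] True by fastforce
        then show ?thesis using \<open>r < l i + C\<close> True by (intro exI[of _ i]) auto
      next
        case False
        have "q + M \<le> p (Suc i)" using near[of "Suc i"] i' by fastforce
        then have q1: "q + 3 * M < p i + l i" using marker[of i q] noM by fastforce
        \<comment> \<open>The occurrence starts inside copy i and more than 3M letters before its
          end. It is pulled back to the original prefix, where it starts at q' < q, and the match is
          truncated at the end of the copy; it keeps at least 3M letters, as the induction
          hypothesis demands.\<close>
        define q' where "q' = q - p i"
        have q': "q = p i + q'" "1 \<le> q'" using i False by (auto simp: q'_def)
        have "q' < q" using q' p0 M strict_mono_less_eq[OF p, of 0 i] by simp
        moreover have "X (q' + r) = X r" if "r < min n (l i - q')" for r
          using less.prems(2)[of r] copy[of "q' + r" i] that q' by (simp add: add.assoc)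
        moreover have "3 * M \<le> min n (l i - q')" using less.prems(3) q1 q' by simp
        ultimately obtain j where j: "p j \<le> q'" "q' + min n (l i - q') < p j + l j + C"
          using less.IH q'(2) by blast
        have "p j < l i" using j(1) q1 q' by simp
        \<comment> \<open>The pulled-back match breaks before the end of the prefix of length
          \<open>l i\<close>, so the truncation removed nothing and the match lies inside copy
          i.\<close>
        then have "p j + l j + C \<le> l i" by (rule nested)
        then have "q' + n < l i" using j(2) q1 q' by linarith
        then show ?thesis using i q' by (intro exI[of _ i]) auto
      qed
    qed
  qed
qed

lemma tau_le:
  assumes sub: "subshift ts m S" and x: "x \<in> S" and q: "1 \<le> q"
    and m: "\<And>i. i \<in> {1..int n} \<Longrightarrow> x (i + int q) = x i"
  shows "tau ts (cyl S n x) x \<le> enat q"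
proof -
  have "(shift ts ^^ q) x i = x i" if "i \<in> {1..int n}" for i
    using m[OF that] that by (subst shift_funpow) (auto simp: idx_def)
  then have "(shift ts ^^ q) x \<in> cyl S n x"
    using shift_funpow_in[OF sub x] by (auto simp: cyl_def)
  then show ?thesis using q Least_le[of "\<lambda>n'. 1 \<le> n' \<and> (shift ts ^^ n') x \<in> cyl S n x" q]
    by (auto simp: tau_def)
qed

lemma tau_witness:
  assumes "tau ts (cyl S n x) x = enat q"
  shows "1 \<le> q" "\<And>i. i \<in> {1..int n} \<Longrightarrow> x (i + int q) = x i"
proof -
  let ?P = "\<lambda>k. 1 \<le> k \<and> (shift ts ^^ k) x \<in> cyl S n x"
  have "\<exists>k. ?P k" "q = (LEAST k. ?P k)" using assms by (auto simp: tau_def split: if_splits)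
  then have q: "?P q" by (metis (mono_tags, lifting) LeastI_ex)
  then show "1 \<le> q" by simp
  show "x (i + int q) = x i" if "i \<in> {1..int n}" for i
  proof -
    have "(shift ts ^^ q) x i = x i" using q that by (auto simp: cyl_def)
    then show ?thesis using that by (subst (asm) shift_funpow) (auto simp: idx_def)
  qed
qed

lemma rec_rate_le:
  assumes "tau ts (cyl S n x) x \<le> enat q" "1 \<le> n"
  shows "rec_rate ts S x n \<le> ereal (ln (real q) / real n)"
proof -
  obtain k where k: "tau ts (cyl S n x) x = enat k" "k \<le> q" using assms(1) by (cases "tau ts (cyl S n x) x") auto
  then have "1 \<le> k" using tau_witness by blast
  then have "ln (real k) \<le> ln (real q)" using k by (intro ln_mono) auto
  then show ?thesis using k assms by (simp add: rec_rate_def divide_right_mono)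
qed

lemma rec_rate_ge:
  assumes "enat q \<le> tau ts (cyl S n x) x" "1 \<le> q" "1 \<le> n"
  shows "ereal (ln (real q) / real n) \<le> rec_rate ts S x n"
proof (cases "tau ts (cyl S n x) x")
  case (enat k)
  then have "ln (real q) \<le> ln (real k)" using assms by (intro ln_mono) auto
  then show ?thesis using enat assms by (simp add: rec_rate_def divide_right_mono)
qed (simp add: rec_rate_def)

lemma tau_mono:
  assumes "subshift ts m S" "x \<in> S" "n \<le> n'"
  shows "tau ts (cyl S n x) x \<le> tau ts (cyl S n' x) x"
proof (cases "tau ts (cyl S n' x) x")
  case (enat q)
  show ?thesis unfolding enat using tau_witness[OF enat] assms by (intro tau_le) auto
qed simp

text \<open>For n from l j + C to l (Suc j) the recurrence time is exactly p (Suc j), so the rate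
  decreases from about ln (p (Suc j)) / l j, which tends to b, to ln (p (Suc j)) / l (Suc j), which
  tends to a. The window between l j and l j + C has bounded length and does not affect the
  limits.\<close>

lemma Rset_memI:
  fixes l p :: "nat \<Rightarrow> nat"
  assumes sub: "subshift ts m S" and x: "x \<in> S"
    and p: "\<And>j. 1 \<le> p j" and l: "filterlim l at_top sequentially"
    and up: "\<And>j. tau ts (cyl S (l j) x) x \<le> enat (p j)"
    and low: "\<And>j. enat (p (Suc j)) \<le> tau ts (cyl S (l j + C) x) x"
    and a: "(\<lambda>j. ereal (ln (real (p j)) / real (l j))) \<longlonglongrightarrow> a"
    and b: "(\<lambda>j. ereal (ln (real (p (Suc j))) / real (l j))) \<longlonglongrightarrow> b"
    and C: "1 \<le> C"
  shows "x \<in> Rset ts S a b"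
proof -
  define r where "r = rec_rate ts S x"
  have lC: "filterlim (\<lambda>j. l j + C) at_top sequentially"
    using l by (rule filterlim_at_top_mono) auto
  have quot: "(\<lambda>j. ereal (real (l j) / real (l j + C))) \<longlonglongrightarrow> 1"
  proof -
    have "((\<lambda>y::real. y / (y + real C)) \<longlongrightarrow> 1) at_top" by real_asymp
    moreover have "filterlim (\<lambda>j. real (l j)) at_top sequentially"
      using filterlim_compose[OF filterlim_real_sequentially l] .
    ultimately have "(\<lambda>j. real (l j) / (real (l j) + real C)) \<longlonglongrightarrow> 1" by (rule filterlim_compose)
    then show ?thesis by (simp add: one_ereal_def)
  qed
  have lpos: "\<forall>\<^sub>F j in sequentially. 1 \<le> l j" using l by (simp add: filterlim_at_top)
  have shiftC: "(\<lambda>j. ereal (y j / real (l j + C))) \<longlonglongrightarrow> c"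
    if y: "(\<lambda>j. ereal (y j / real (l j))) \<longlonglongrightarrow> c" for y c
  proof -
    have "(\<lambda>j. ereal (y j / real (l j)) * ereal (real (l j) / real (l j + C))) \<longlonglongrightarrow> c * 1"
      using y quot by (intro tendsto_mult_ereal) auto
    moreover have "\<forall>\<^sub>F j in sequentially.
        ereal (y j / real (l j)) * ereal (real (l j) / real (l j + C)) = ereal (y j / real (l j + C))"
      using lpos by eventually_elim simp
    ultimately have "(\<lambda>j. ereal (y j / real (l j + C))) \<longlonglongrightarrow> c * 1" by (rule Lim_transform_eventually)
    then show ?thesis by simp
  qed
  have a': "(\<lambda>j. ereal (ln (real (p (Suc j))) / real (l (Suc j) + C))) \<longlonglongrightarrow> a"
    using shiftC[OF a] by (rule LIMSEQ_Suc)
  have b': "(\<lambda>j. ereal (ln (real (p (Suc j))) / real (l j + C))) \<longlonglongrightarrow> b" by (rule shiftC[OF b])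
  \<comment> \<open>\<open>l'\<close> is not assumed monotone; the index wanted is the predecessor
    of the first index from j0 on with \<open>l'\<close> beyond n.\<close>
  have sel: "\<exists>j\<ge>j0. l' j \<le> n \<and> n < l' (Suc j)" if "l' j0 \<le> n" and l': "filterlim l' at_top sequentially"
    for l' :: "nat \<Rightarrow> nat" and j0 n
  proof -
    have "\<forall>\<^sub>F j in sequentially. Suc n \<le> l' j" using l' by (simp only: filterlim_at_top)
    then obtain j1 where "\<forall>j\<ge>j1. Suc n \<le> l' j"
      unfolding eventually_sequentially by (rule exE)
    then have "Suc n \<le> l' (max j0 j1)" "j0 \<le> max j0 j1" by (blast intro: max.cobounded2 max.cobounded1)+
    then have ex: "\<exists>j. j0 \<le> j \<and> n < l' j" unfolding Suc_le_eq by blast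
    define j where "j = (LEAST j. j0 \<le> j \<and> n < l' j)"
    have j: "j0 \<le> j" "n < l' j" using LeastI_ex[OF ex] by (auto simp: j_def)
    have "j \<noteq> j0" using j that by auto
    then obtain i where i: "j = Suc i" "j0 \<le> i" using j by (cases j) auto
    then have "\<not> (j0 \<le> i \<and> n < l' i)" using not_less_Least[of i "\<lambda>j. j0 \<le> j \<and> n < l' j"] by (auto simp: j_def)
    then show ?thesis using i j by auto
  qed
  have liminf_ge: "a \<le> liminf r"
  proof (rule le_Liminf_iff[THEN iffD2], intro allI impI)
    fix c assume "c < a"
    then have "\<forall>\<^sub>F j in sequentially. c < ereal (ln (real (p (Suc j))) / real (l (Suc j) + C))"
      using a' by (rule order_tendstoD(1)[rotated])
    then obtain j0 where j0: "\<And>j. j \<ge> j0 \<Longrightarrow> c < ereal (ln (real (p (Suc j))) / real (l (Suc j) + C))"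
      by (auto simp: eventually_sequentially)
    show "\<forall>\<^sub>F n in sequentially. c < r n"
      using eventually_ge_at_top[of "l j0 + C"]
    proof eventually_elim
      case (elim n)
      obtain j where j: "j \<ge> j0" "l j + C \<le> n" "n < l (Suc j) + C" using sel[OF elim lC] by blast
      have "enat (p (Suc j)) \<le> tau ts (cyl S n x) x"
        using low[of j] tau_mono[OF sub x j(2)] by (rule order_trans)
      then have "ereal (ln (real (p (Suc j))) / real n) \<le> r n"
        using p j C unfolding r_def by (intro rec_rate_ge) auto
      moreover have "ln (real (p (Suc j))) / real (l (Suc j) + C) \<le> ln (real (p (Suc j))) / real n"
        using j C p[of "Suc j"] by (intro divide_left_mono) auto
      ultimately show ?case using j0[OF j(1)] by (meson ereal_less_eq(3) less_le_trans)
    qed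
  qed
  have limsup_le: "limsup r \<le> b"
  proof (rule Limsup_le_iff[THEN iffD2], intro allI impI)
    fix c assume "b < c"
    then have "\<forall>\<^sub>F j in sequentially. ereal (ln (real (p (Suc j))) / real (l j)) < c"
      using b by (rule order_tendstoD(2)[rotated])
    then obtain j0 where j0: "\<And>j. j \<ge> j0 \<Longrightarrow> ereal (ln (real (p (Suc j))) / real (l j)) < c \<and> 1 \<le> l j"
      using lpos by (auto simp: eventually_sequentially) (meson linear order_trans)
    have l1: "filterlim (\<lambda>j. l j + 1) at_top sequentially"
      using l by (rule filterlim_at_top_mono) auto
    show "\<forall>\<^sub>F n in sequentially. r n < c"
      using eventually_ge_at_top[of "l j0 + 1"]
    proof eventually_elim
      case (elim n)
      obtain j where j: "j \<ge> j0" "l j + 1 \<le> n" "n < l (Suc j) + 1" using sel[OF elim l1] by blast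
      have "n \<le> l (Suc j)" using j by simp
      from tau_mono[OF sub x this] up[of "Suc j"] have "tau ts (cyl S n x) x \<le> enat (p (Suc j))"
        by (rule order_trans)
      then have "r n \<le> ereal (ln (real (p (Suc j))) / real n)"
        using j unfolding r_def by (intro rec_rate_le) auto
      moreover have "ln (real (p (Suc j))) / real n \<le> ln (real (p (Suc j))) / real (l j)"
        using j j0[OF j(1)] p[of "Suc j"] by (intro divide_left_mono) auto
      ultimately show ?case using j0[OF j(1)] by (meson ereal_less_eq(3) le_less_trans)
    qed
  qed
  have liminf_le: "liminf r \<le> a"
  proof -
    have "liminf r \<le> liminf (\<lambda>j. r (l j))"
    proof (rule le_Liminf_iff[THEN iffD2], intro allI impI)
      fix y assume "y < liminf r"
      then have "\<forall>\<^sub>F n in sequentially. y < r n" by (rule less_LiminfD)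
      then show "\<forall>\<^sub>F j in sequentially. y < r (l j)" using l by (rule eventually_compose_filterlim)
    qed
    also have "liminf (\<lambda>j. r (l j)) \<le> liminf (\<lambda>j. ereal (ln (real (p j)) / real (l j)))"
      using lpos by (intro Liminf_mono) (auto elim!: eventually_mono simp: r_def intro!: rec_rate_le up)
    also have "\<dots> = a" using a by (simp add: lim_imp_Liminf)
    finally show ?thesis .
  qed
  have limsup_ge: "b \<le> limsup r"
  proof -
    have "b = limsup (\<lambda>j. ereal (ln (real (p (Suc j))) / real (l j + C)))" using b' by (simp add: lim_imp_Limsup)
    also have "\<dots> \<le> limsup (\<lambda>j. r (l j + C))"
    proof (intro Limsup_mono always_eventually allI)
      show "ereal (ln (real (p (Suc j))) / real (l j + C)) \<le> r (l j + C)" for j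
        unfolding r_def by (intro rec_rate_ge low p) (use C in simp)
    qed
    also have "\<dots> \<le> limsup r"
    proof (rule Limsup_le_iff[THEN iffD2], intro allI impI)
      fix y assume "limsup r < y"
      then have "\<forall>\<^sub>F n in sequentially. r n < y" by (rule Limsup_lessD)
      then show "\<forall>\<^sub>F j in sequentially. r (l j + C) < y" using lC by (rule eventually_compose_filterlim)
    qed
    finally show ?thesis .
  qed
  show ?thesis
    using liminf_ge limsup_le liminf_le limsup_ge x unfolding r_def Rset_def
    by (auto intro: order_antisym)
qed

section \<open>A schedule for the insertions\<close>

text \<open>A positive real stand-in for a, tending to a as y grows. It treats 0 and \<infinity> on
  the same footing as the other values and allows division by it.\<close>

definition clamp :: "ereal \<Rightarrow> real \<Rightarrow> real" where
  "clamp a y = real_of_ereal (min (max a (ereal (1 / sqrt y))) (ereal (sqrt y)))"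

lemma ereal_clamp:
  assumes "y \<ge> 1"
  shows "ereal (clamp a y) = min (max a (ereal (1 / sqrt y))) (ereal (sqrt y))"
proof -
  have "\<bar>min (max a (ereal (1 / sqrt y))) (ereal (sqrt y))\<bar> \<noteq> \<infinity>"
    by (cases a) (auto simp: min_def max_def)
  then show ?thesis unfolding clamp_def by (rule ereal_real')
qed

lemma clamp_bounds:
  assumes "y \<ge> 1"
  shows "1 / sqrt y \<le> clamp a y" "clamp a y \<le> sqrt y"
proof -
  have "1 \<le> sqrt y" using assms by simp
  then have "1 / sqrt y \<le> sqrt y" using assms by (simp add: field_simps)
  then have "ereal (1 / sqrt y) \<le> ereal (clamp a y)" "ereal (clamp a y) \<le> ereal (sqrt y)"
    unfolding ereal_clamp[OF assms] by auto
  then show "1 / sqrt y \<le> clamp a y" "clamp a y \<le> sqrt y" by simp_all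
qed

lemma clamp_pos:
  assumes "y \<ge> 1"
  shows "0 < clamp a y"
proof -
  have "0 < 1 / sqrt y" using assms by simp
  then show ?thesis using clamp_bounds(1)[OF assms] by (rule less_le_trans)
qed

lemma clamp_mono:
  assumes "y \<ge> 1" "a \<le> b"
  shows "clamp a y \<le> clamp b y"
proof -
  have "ereal (clamp a y) \<le> ereal (clamp b y)"
    unfolding ereal_clamp[OF assms(1)] using assms(2) by (intro min.mono max.mono) auto
  then show ?thesis by simp
qed

text \<open>For finite a the product is min (max (a y) (sqrt y)) (y sqrt y), and each of the three
  expressions increases with y.\<close>

lemma clamp_mult_mono:
  assumes "0 \<le> a" "1 \<le> y" "y \<le> z"
  shows "clamp a y * y \<le> clamp a z * z"
proof (cases a)
  case PInf
  then show ?thesis using assms by (auto simp: clamp_def intro!: mult_mono)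
next
  case (real r)
  have *: "clamp a y * y = min (max (r * y) (sqrt y)) (y * sqrt y)" if "1 \<le> y" for y
  proof -
    have "clamp a y = min (max r (1 / sqrt y)) (sqrt y)"
      using ereal_clamp[OF that, of a] real by (simp add: ereal_max[symmetric] ereal_min[symmetric] del: ereal_max ereal_min)
    moreover have "1 / sqrt y * y = sqrt y" using that by (simp add: real_div_sqrt)
    ultimately show ?thesis using that
      by (simp only: min_mult_distrib_right max_mult_distrib_right) (simp add: mult.commute)
  qed
  have "0 \<le> r" using assms real by simp
  then show ?thesis unfolding *[OF assms(2)] *[OF order_trans[OF assms(2,3)]] using assms
    by (intro min.mono max.mono mult_mono) auto
qed (use assms in auto)

lemma clamp_tendsto:
  assumes "0 \<le> a" and y: "filterlim y at_top sequentially" "\<And>j. 1 \<le> y j"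
  shows "(\<lambda>j. ereal (clamp a (y j))) \<longlonglongrightarrow> a"
proof -
  have "((\<lambda>y::real. 1 / sqrt y) \<longlongrightarrow> 0) at_top" by real_asymp
  then have 1: "(\<lambda>j. ereal (1 / sqrt (y j))) \<longlonglongrightarrow> ereal 0"
    using y(1) by (intro tendsto_ereal) (rule filterlim_compose)
  have "filterlim (\<lambda>y::real. sqrt y) at_top at_top" by real_asymp
  then have "filterlim (\<lambda>j. sqrt (y j)) at_top sequentially" using y(1) by (rule filterlim_compose)
  then have 2: "(\<lambda>j. ereal (sqrt (y j))) \<longlonglongrightarrow> \<infinity>" by (simp add: tendsto_PInfty_eq_at_top)
  have "(\<lambda>j. min (max a (ereal (1 / sqrt (y j)))) (ereal (sqrt (y j)))) \<longlonglongrightarrow> min (max a (ereal 0)) \<infinity>"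
    by (intro tendsto_min tendsto_max 1 2 tendsto_const)
  moreover have "min (max a (ereal 0)) \<infinity> = a"
    using assms(1) by (auto simp: max_def zero_ereal_def min_def)
  ultimately show ?thesis by (simp add: ereal_clamp[OF y(2)])
qed

text \<open>Let A j and B j be the clamped values of a and b at y j, put lam j = y (Suc j), and let
  s j be about exp (B j * y j). Then ln (s (Suc j)) / lam j is about B (Suc j), which tends to b;
  choosing y (Suc j) about (B j / A j) y j makes ln (s j) / lam j about A j, which tends to a. Since
  B j * y j is at least sqrt (y j) while lam j is at most quadratic in y j, s j dominates the square
  of lam j + 1 times any fixed constant, once the starting value Y0 is large. The remaining
  inequalities follow from this.\<close>

lemma insertion_schedule:
  fixes a b :: ereal and c D :: nat
  assumes ab: "0 \<le> a" "a \<le> b" and c: "1 \<le> c"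
  obtains lam s :: "nat \<Rightarrow> nat" where "mono lam" "\<And>j. j \<le> lam j" "strict_mono s"
    "\<And>j. 2 * c dvd s j" "\<And>j. (\<Sum>i\<le>j. D * (lam i + 1)) \<le> s j" "\<And>j. (lam j + 1)\<^sup>2 \<le> s j"
    "\<And>j. 2 * c * lam j + c < s j"
    "(\<lambda>j. ereal (ln (real (s j)) / real (lam j))) \<longlonglongrightarrow> a"
    "(\<lambda>j. ereal (ln (real (s (Suc j))) / real (lam j))) \<longlonglongrightarrow> b"
proof -
  \<comment> \<open>The fourth power arises because lam j + 1 is at most (y j + 2)^2 and its square
    has to stay below exp (e j).\<close>
  have "\<forall>\<^sub>F y::real in at_top. (real D + 1) * (y + 2) ^ 4 \<le> exp (sqrt y)" by real_asymp
  then obtain Y where Y: "\<And>y. y \<ge> Y \<Longrightarrow> (real D + 1) * (y + 2) ^ 4 \<le> exp (sqrt y)"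
    by (auto simp: eventually_at_top_linorder)
  define Y0 where "Y0 = max 1 (nat \<lceil>Y\<rceil>)"
  \<comment> \<open>The term sqrt n forces growth even for a = b and is negligible compared with
    n.\<close>
  define g where "g n = nat \<lceil>clamp b (real n) / clamp a (real n) * real n + sqrt (real n)\<rceil>" for n
  define y where "y = rec_nat Y0 (\<lambda>_. g)"
  have y_simps: "y 0 = Y0" "y (Suc j) = g (y j)" for j by (simp_all add: y_def)
  have g: "real n + sqrt (real n) \<le> clamp b (real n) / clamp a (real n) * real n + sqrt (real n)"
    "clamp b (real n) / clamp a (real n) * real n + sqrt (real n) \<le> real (g n)"
    "real (g n) \<le> clamp b (real n) / clamp a (real n) * real n + sqrt (real n) + 1"
    "real (g n) \<le> real n * real n + sqrt (real n) + 1" if "1 \<le> n" for n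
  proof -
    let ?A = "clamp a (real n)" and ?B = "clamp b (real n)"
    have n: "1 \<le> real n" using that by simp
    have A: "0 < ?A" using n by (rule clamp_pos)
    have AB: "?A \<le> ?B" using n ab(2) by (rule clamp_mono)
    then have "1 \<le> ?B / ?A" using A by simp
    then have "1 * real n \<le> ?B / ?A * real n" by (rule mult_right_mono) simp
    then show g1: "real n + sqrt (real n) \<le> ?B / ?A * real n + sqrt (real n)" by simp
    then have "0 \<le> ?B / ?A * real n + sqrt (real n)" 
      using real_sqrt_ge_zero[of "real n"] n by linarith
    then show "?B / ?A * real n + sqrt (real n) \<le> real (g n)"
      and g3: "real (g n) \<le> ?B / ?A * real n + sqrt (real n) + 1" unfolding g_def by linarith+
    have "?B / ?A \<le> sqrt (real n) / (1 / sqrt (real n))"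
      by (rule frac_le) (use clamp_bounds[OF n] n in simp_all)
    also have "\<dots> = real n" by simp
    finally have "?B / ?A * real n \<le> real n * real n" by (intro mult_right_mono) auto
    then show "real (g n) \<le> real n * real n + sqrt (real n) + 1" using g3 by simp
  qed
  have g_gt: "n < g n" if "1 \<le> n" for n
  proof -
    have "real n < real n + sqrt (real n)" using that by simp
    then have "real n < real (g n)" using g(1,2)[OF that] by linarith
    then show ?thesis by simp
  qed
  have yge: "Y0 + j \<le> y j" for j
  proof (induction j)
    case (Suc j)
    have "1 \<le> y j" using Suc by (simp add: Y0_def)
    then show ?case using g_gt[of "y j"] Suc by (simp add: y_simps)
  qed (simp add: y_simps)
  have y1: "1 \<le> y j" and yj: "j \<le> y j" and yY: "Y \<le> real (y j)" for j
    using yge[of j] by (auto simp: Y0_def) linarith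
  have ymono: "mono y" using g_gt y1 by (intro incseq_SucI) (simp add: y_simps less_imp_le)
  have ylim: "filterlim (\<lambda>j. real (y j)) at_top sequentially"
    by (rule filterlim_at_top_mono[OF filterlim_real_sequentially]) (use yj in auto)
  define e where "e j = clamp b (real (y j)) * real (y j)" for j
  define lam where "lam j = y (Suc j)" for j
  \<comment> \<open>Adding j prevents ties caused by rounding, so that \<open>s\<close> is strictly
    increasing.\<close>
  define s where "s j = 2 * c * (nat \<lceil>exp (e j)\<rceil> + j)" for j
  have e_ge: "sqrt (real (y j)) \<le> e j" for j
  proof -
    have "sqrt (real (y j)) = 1 / sqrt (real (y j)) * real (y j)" using y1[of j] by (simp add: real_div_sqrt)
    also have "\<dots> \<le> e j" unfolding e_def using clamp_bounds(1) y1[of j] by (intro mult_right_mono) auto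
    finally show ?thesis .
  qed
  have emono: "e i \<le> e j" if "i \<le> j" for i j
    unfolding e_def using ab y1[of i] monoD[OF ymono that] by (intro clamp_mult_mono) auto
  have s_ge: "2 * real c * exp (e j) \<le> real (s j)" for j
  proof -
    have "exp (e j) \<le> real (nat \<lceil>exp (e j)\<rceil> + j)" by linarith
    then have "2 * real c * exp (e j) \<le> 2 * real c * real (nat \<lceil>exp (e j)\<rceil> + j)" by (intro mult_left_mono) auto
    then show ?thesis by (simp add: s_def)
  qed
  have Eb: "(real D + 1) * (real (y j) + 2) ^ 4 \<le> exp (e j)" for j
    using Y[OF yY[of j]] e_ge[of j] by (meson exp_le_cancel_iff order_trans)
  have lam1: "real (lam j) + 1 \<le> (real (y j) + 2)\<^sup>2" for j
  proof -
    have "sqrt (real (y j)) \<le> real (y j)" 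
      using y1[of j] by (intro real_le_lsqrt self_le_power) auto
    then show ?thesis using g(4)[OF y1[of j]] y1[of j]
      unfolding lam_def y_simps by (simp add: power2_eq_square algebra_simps)
  qed
  have lam2: "(real D + 1) * (real (lam j) + 1)\<^sup>2 \<le> exp (e j)" for j
  proof -
    have "(real (lam j) + 1)\<^sup>2 \<le> ((real (y j) + 2)\<^sup>2)\<^sup>2" using lam1[of j] by (intro power_mono) auto
    also have "\<dots> = (real (y j) + 2) ^ 4" by (simp flip: power_mult)
    finally have "(real D + 1) * (real (lam j) + 1)\<^sup>2 \<le> (real D + 1) * (real (y j) + 2) ^ 4" by (intro mult_left_mono) auto
    then show ?thesis using Eb[of j] by linarith
  qed
  have c1: "1 \<le> 2 * real c" using c by simp
  have s_ge': "exp (e j) \<le> real (s j)" for j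
  proof -
    have "1 * exp (e j) \<le> 2 * real c * exp (e j)" using c1 by (rule mult_right_mono) simp
    then show ?thesis using s_ge[of j] by linarith
  qed
  have lams: "(D + 1) * (lam j + 1)\<^sup>2 \<le> s j" for j
  proof -
    have "real ((D + 1) * (lam j + 1)\<^sup>2) \<le> real (s j)" 
      unfolding of_nat_mult of_nat_add of_nat_power of_nat_1 using lam2[of j] s_ge'[of j] by (rule order_trans)
    then show ?thesis by (simp only: of_nat_le_iff)
  qed
  have lam_mono: "mono lam" unfolding lam_def using ymono by (auto simp: mono_def)
  have lamj: "j \<le> lam j" for j using yj[of "Suc j"] by (simp add: lam_def)
  have spos: "0 < real (s j)" for j using s_ge'[of j] by (meson exp_gt_zero less_le_trans)
  have ln_s: "e j \<le> ln (real (s j))" "ln (real (s j)) \<le> e j + ln (6 * real c)" for j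
  proof -
    show "e j \<le> ln (real (s j))" using s_ge'[of j] spos[of j] by (simp add: ln_ge_iff)
    have "1 \<le> exp (e j)" 
    proof -
      have "0 \<le> sqrt (real (y j))" by simp
      then have "0 \<le> e j" using e_ge[of j] by (rule order_trans)
      then show ?thesis by simp
    qed
    moreover have "real j \<le> exp (e j)"
    proof -
      have "real j \<le> (real D + 1) * (real (lam j) + 1)\<^sup>2"
      proof -
        have "real j \<le> real (lam j) + 1" using lamj[of j] by simp
        also have "\<dots> \<le> (real (lam j) + 1)\<^sup>2" by (intro self_le_power) auto
        also have "\<dots> \<le> (real D + 1) * (real (lam j) + 1)\<^sup>2"
          using mult_right_mono[of 1 "real D + 1" "(real (lam j) + 1)\<^sup>2"] by simp
        finally show ?thesis .
      qed
      then show ?thesis using lam2[of j] by linarith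
    qed
    ultimately have "real (nat \<lceil>exp (e j)\<rceil> + j) \<le> 3 * exp (e j)" by linarith
    then have "2 * real c * real (nat \<lceil>exp (e j)\<rceil> + j) \<le> 2 * real c * (3 * exp (e j))" by (intro mult_left_mono) auto
    then have "real (s j) \<le> 6 * real c * exp (e j)" by (simp add: s_def)
    then have "ln (real (s j)) \<le> ln (6 * real c * exp (e j))" using spos[of j] by (intro ln_mono) auto
    also have "\<dots> = e j + ln (6 * real c)" using c by (simp add: ln_mult)
    finally show "ln (real (s j)) \<le> e j + ln (6 * real c)" .
  qed
  have lamlim: "filterlim (\<lambda>j. real (lam j)) at_top sequentially"
    by (rule filterlim_at_top_mono[OF filterlim_real_sequentially]) (use lamj in auto)
  have lampos: "0 < real (lam j)" for j using y1[of "Suc j"] by (simp add: lam_def)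
  have err: "(\<lambda>j. ereal (ln (real (s (k j))) / real (lam j))) \<longlonglongrightarrow> l"
    if "(\<lambda>j. ereal (e (k j) / real (lam j))) \<longlonglongrightarrow> l" for k l
  proof -
    have z: "(\<lambda>j. (ln (real (s (k j))) - e (k j)) / real (lam j)) \<longlonglongrightarrow> 0"
    proof (rule real_tendsto_sandwich[OF _ _ tendsto_const])
      have "((\<lambda>y::real. ln (6 * real c) / y) \<longlongrightarrow> 0) at_top" by real_asymp
      then show "(\<lambda>j. ln (6 * real c) / real (lam j)) \<longlonglongrightarrow> 0" using lamlim by (rule filterlim_compose)
      show "\<forall>\<^sub>F j in sequentially. 0 \<le> (ln (real (s (k j))) - e (k j)) / real (lam j)"
        using ln_s(1) by (intro always_eventually) auto
      show "\<forall>\<^sub>F j in sequentially. (ln (real (s (k j))) - e (k j)) / real (lam j) \<le> ln (6 * real c) / real (lam j)"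
        using ln_s(2) by (intro always_eventually allI divide_right_mono) (auto simp: algebra_simps)
    qed
    have "(\<lambda>j. ereal (e (k j) / real (lam j)) + ereal ((ln (real (s (k j))) - e (k j)) / real (lam j))) \<longlonglongrightarrow> l + ereal 0"
      using that tendsto_ereal[OF z] by (intro tendsto_add_ereal_general1) auto
    then show ?thesis by (simp add: diff_divide_distrib zero_ereal_def[symmetric])
  qed
  show thesis
  proof (rule that[of lam s])
    show "mono lam" by fact
    show "j \<le> lam j" for j by fact
    show "strict_mono s"
    proof (rule strict_mono_Suc_iff[THEN iffD2], intro allI)
      fix j
      have "\<lceil>exp (e j)\<rceil> \<le> \<lceil>exp (e (Suc j))\<rceil>" using emono[of j "Suc j"] by (intro ceiling_mono) simp
      then have "nat \<lceil>exp (e j)\<rceil> + j < nat \<lceil>exp (e (Suc j))\<rceil> + Suc j" by linarith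
      then show "s j < s (Suc j)" using c unfolding s_def by (intro mult_strict_left_mono) auto
    qed
    show "2 * c dvd s j" for j by (simp add: s_def)
    show "(\<Sum>i\<le>j. D * (lam i + 1)) \<le> s j" for j
    proof -
      have "(\<Sum>i\<le>j. D * (lam i + 1)) \<le> (\<Sum>i\<le>j. D * (lam j + 1))"
        using lam_mono by (intro sum_mono mult_left_mono) (auto simp: mono_def)
      also have "\<dots> = D * ((j + 1) * (lam j + 1))" by (simp add: algebra_simps)
      also have "\<dots> \<le> D * ((lam j + 1) * (lam j + 1))" using lamj[of j] by (intro mult_left_mono mult_right_mono) auto
      also have "\<dots> \<le> (D + 1) * (lam j + 1)\<^sup>2" by (simp add: power2_eq_square)
      finally show ?thesis using lams[of j] by linarith
    qed
    show "(lam j + 1)\<^sup>2 \<le> s j" for j using lams[of j] by simp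
    show "2 * c * lam j + c < s j" for j
    proof -
      have "real (lam j) + 1 \<le> (real (lam j) + 1)\<^sup>2" by (intro self_le_power) auto
      also have "\<dots> \<le> (real D + 1) * (real (lam j) + 1)\<^sup>2"
        using mult_right_mono[of 1 "real D + 1" "(real (lam j) + 1)\<^sup>2"] by simp
      also have "\<dots> \<le> exp (e j)" by (rule lam2)
      finally have "2 * real c * (real (lam j) + 1) \<le> 2 * real c * exp (e j)" by (intro mult_left_mono) auto
      then have "2 * real c * (real (lam j) + 1) \<le> real (s j)" using s_ge[of j] by linarith
      moreover have "2 * real c * real (lam j) + real c < 2 * real c * (real (lam j) + 1)" using c by (simp add: algebra_simps)
      ultimately have "real (2 * c * lam j + c) < real (s j)" by simp
      then show ?thesis by (simp only: of_nat_less_iff)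
    qed
    show "(\<lambda>j. ereal (ln (real (s (Suc j))) / real (lam j))) \<longlonglongrightarrow> b"
    proof (rule err)
      have "(\<lambda>j. ereal (clamp b (real (y (Suc j))))) \<longlonglongrightarrow> b"
        using ab y1 by (intro LIMSEQ_Suc[of "\<lambda>j. ereal (clamp b (real (y j)))"] clamp_tendsto ylim) auto
      moreover have "clamp b (real (y (Suc j))) = e (Suc j) / real (lam j)" for j
        using lampos[of j] by (simp add: e_def lam_def)
      ultimately show "(\<lambda>j. ereal (e (Suc j) / real (lam j))) \<longlonglongrightarrow> b" by simp
    qed
    show "(\<lambda>j. ereal (ln (real (s j)) / real (lam j))) \<longlonglongrightarrow> a"
    proof (rule err[of "\<lambda>j. j"])
      define A where "A j = clamp a (real (y j))" for j
      define B where "B j = clamp b (real (y j))" for j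
      have Apos: "0 < A j" for j
        using y1[of j] unfolding A_def by (intro clamp_pos) simp
      have AB: "A j \<le> B j" for j unfolding A_def B_def using ab y1[of j] by (intro clamp_mono) auto
      have "A j * (B j / A j * real (y j) / real (lam j)) = e j / real (lam j)" for j
        using Apos[of j] by (simp add: e_def B_def)
      moreover have "(\<lambda>j. B j / A j * real (y j) / real (lam j)) \<longlonglongrightarrow> 1"
      proof (rule real_tendsto_sandwich[OF _ _ _ tendsto_const])
        have "((\<lambda>y::real. y / (y + sqrt y + 1)) \<longlongrightarrow> 1) at_top" by real_asymp
        then show "(\<lambda>j. real (y j) / (real (y j) + sqrt (real (y j)) + 1)) \<longlonglongrightarrow> 1"
          using ylim by (rule filterlim_compose)
        show "\<forall>\<^sub>F j in sequentially. real (y j) / (real (y j) + sqrt (real (y j)) + 1) \<le> B j / A j * real (y j) / real (lam j)"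
        proof (intro always_eventually allI)
          fix j
          define z where "z = B j / A j * real (y j)"
          have z: "real (y j) \<le> z"
          proof -
            have "1 \<le> B j / A j" using AB[of j] Apos[of j] by simp
            then have "1 * real (y j) \<le> B j / A j * real (y j)" by (rule mult_right_mono) simp
            then show ?thesis by (simp add: z_def)
          qed
          have l: "real (lam j) \<le> z + sqrt (real (y j)) + 1"
            using g(3)[OF y1[of j]] by (simp add: lam_def y_simps z_def A_def B_def)
          have sq: "0 \<le> sqrt (real (y j))" by simp
          \<comment> \<open>This is the monotonicity of z / (z + r) in z, applied to y j \<le> z and
            cleared of denominators.\<close>
          have le: "real (y j) * (z + sqrt (real (y j)) + 1) \<le> z * (real (y j) + sqrt (real (y j)) + 1)"
            using mult_right_mono[OF z, of "sqrt (real (y j)) + 1"] by (simp add: algebra_simps)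
          have "real (y j) / (real (y j) + sqrt (real (y j)) + 1) \<le> z / (z + sqrt (real (y j)) + 1)"
          proof -
            have pos: "0 < real (y j) + sqrt (real (y j)) + 1" "0 < z + sqrt (real (y j)) + 1"
              using z sq of_nat_0_le_iff[of "y j"] by linarith+
            show ?thesis using le pos by (subst frac_le_eq) (auto intro!: divide_nonpos_pos mult_pos_pos)
          qed
          also have "\<dots> \<le> z / real (lam j)" using l lampos[of j] z y1[of j] sq by (intro divide_left_mono mult_pos_pos) auto
          finally show "real (y j) / (real (y j) + sqrt (real (y j)) + 1) \<le> B j / A j * real (y j) / real (lam j)"
            by (simp add: z_def)
        qed
        show "\<forall>\<^sub>F j in sequentially. B j / A j * real (y j) / real (lam j) \<le> 1"
        proof (intro always_eventually allI)
          fix j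
          have "B j / A j * real (y j) + sqrt (real (y j)) \<le> real (lam j)"
            using g(2)[OF y1[of j]] by (simp add: lam_def y_simps A_def B_def)
          moreover have "0 \<le> sqrt (real (y j))" by simp
          ultimately have "B j / A j * real (y j) \<le> real (lam j)" by linarith
          then show "B j / A j * real (y j) / real (lam j) \<le> 1"
            by (rule divide_le_eq_1_pos[OF lampos, THEN iffD2])
        qed
      qed
      then have "(\<lambda>j. ereal (A j) * ereal (B j / A j * real (y j) / real (lam j))) \<longlonglongrightarrow> a * ereal 1"
        using ab y1 ylim unfolding A_def by (intro tendsto_mult_ereal clamp_tendsto tendsto_ereal) auto
      ultimately show "(\<lambda>j. ereal (e j / real (lam j))) \<longlonglongrightarrow> a" by (simp flip: one_ereal_def)
    qed
  qed
qed

section \<open>Inserting prefixes\<close>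

lemma sublist_slice:
  assumes "length a \<le> q" "q + n \<le> length a + length y"
  shows "sublist (map (\<lambda>r. (a @ y @ d) ! (q + r)) [0..<n]) y"
proof -
  have "map (\<lambda>r. (a @ y @ d) ! (q + r)) [0..<n] = take n (drop (q - length a) y)"
    using assms by (intro nth_equalityI) (auto simp: nth_append)
  then show ?thesis using sublist_drop sublist_take sublist_order.order_trans by metis
qed

text \<open>Roles of the numerical hypotheses: \<open>D * (lam j + 1)\<close> will bound the length
  inserted at step s j (\<open>insert_length\<close>). The sum condition then keeps all insertions
  together below one letter per step; the square condition makes each insertion at most of the order
  of the square root of its position, so that prefix lengths overshoot \<open>lam j\<close> only
  slightly; and the last one guarantees that the prefix to be copied is complete before step s
  j.\<close>

locale insertion =
  fixes ts :: bool and m :: nat and S :: "(int \<Rightarrow> nat) set" and G F :: "nat list set"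
    and V W :: "nat list" and t N c D :: nat and lam s :: "nat \<Rightarrow> nat"
  assumes sub: "subshift ts m S"
    and join: "\<And>u v. gap_chain ts S G t u \<Longrightarrow> gap_chain ts S G t v \<Longrightarrow>
      \<exists>w. length w \<le> t \<and> gap_chain ts S G t (u @ w @ v)"
    and N: "1 \<le> N" "t \<le> N"
    and F: "finite F" "F \<noteq> {}" "\<And>f. f \<in> F \<Longrightarrow> length f = N" "\<And>f. f \<in> F \<Longrightarrow> gap_chain ts S G t f"
    and V: "gap_chain ts S G t V" "N \<le> length V" "avoids (pieces m t F) V"
    and W: "gap_chain ts S G t W" "1 \<le> length W" "avoids (pieces m t (insert V F)) W"
    and c: "c = 3 * length W + length V + t + 1"
    and D: "D = length W + (N + t + 1) * (2 * c) + length V + 2 * t"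
    and lam: "mono lam" "\<And>j. j \<le> lam j"
    and s: "strict_mono s" "\<And>j. 2 * c dvd s j" "\<And>j. (\<Sum>i\<le>j. D * (lam i + 1)) \<le> s j"
      "\<And>j. (lam j + 1)\<^sup>2 \<le> s j" "\<And>j. 2 * c * lam j + c < s j"
begin

text \<open>The step at whose end the prefix copied at step s j stops. The alternative
  \<open>s j \<le> k\<close> makes the minimum exist and stay at most s j for any R, so that the
  recursion is well founded before any length is known; \<open>cut_props\<close> shows that in a run
  the first alternative decides.\<close>

definition cut :: "(nat \<Rightarrow> nat list) \<Rightarrow> nat \<Rightarrow> nat" where
  "cut R j = (LEAST k. (k mod (2 * c) = c \<and> lam j \<le> length (R k)) \<or> s j \<le> k)"

text \<open>An insertion step also ends with a block, so every step carries an input that can be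
  read off the end of R.\<close>

definition step_right :: "(nat \<Rightarrow> nat list \<times> nat list) \<Rightarrow> (nat \<Rightarrow> nat list) \<Rightarrow> nat \<Rightarrow> nat list \<Rightarrow> bool" where
  "step_right \<omega> R k r \<longleftrightarrow> (\<exists>u1 u2 u3. length u1 \<le> t \<and> length u2 \<le> t \<and> length u3 \<le> t \<and>
     r = R k @ (if k \<in> range s then u1 @ R (cut R (inv s k)) @ u2 @ V else []) @ u3 @ fst (\<omega> k))"

definition step_left :: "(nat \<Rightarrow> nat list \<times> nat list) \<Rightarrow> (nat \<Rightarrow> nat list) \<Rightarrow> nat \<Rightarrow> nat list \<Rightarrow> bool" where
  "step_left \<omega> L k l \<longleftrightarrow> (if ts then \<exists>u. length u \<le> t \<and> l = snd (\<omega> k) @ u @ L k else l = [])"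

text \<open>\<open>R k\<close> is the part of the point to the right of the origin after \<open>k\<close> steps, \<open>L k\<close> the part to the
  left. Step \<open>s j\<close> inserts the copy of the prefix \<open>R (cut R j)\<close>, whose length is close to \<open>lam j\<close>.\<close>

definition run :: "(nat \<Rightarrow> nat list \<times> nat list) \<Rightarrow> (nat \<Rightarrow> nat list) \<Rightarrow> (nat \<Rightarrow> nat list) \<Rightarrow> bool" where
  "run \<omega> R L \<longleftrightarrow> R 0 = W \<and> L 0 = [] \<and> (\<forall>k. step_right \<omega> R k (R (Suc k))) \<and> (\<forall>k. step_left \<omega> L k (L (Suc k)))
     \<and> (\<forall>k. gap_chain ts S G t (R k) \<and> gap_chain ts S G t (L k @ R k))"

definition inputs :: "(nat list \<times> nat list) set" where
  "inputs = F \<times> (if ts then F else {[]})"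

lemma inj_s: "inj s"
  using s(1) by (rule strict_mono_imp_inj_on)

lemma cut_le: "cut R j \<le> s j"
  unfolding cut_def by (rule Least_le) simp

lemma cut_cong:
  assumes "\<And>k. k \<le> s j \<Longrightarrow> length (R k) = length (R' k)"
  shows "cut R j = cut R' j"
  unfolding cut_def by (rule arg_cong[where f = Least]) (use assms in \<open>auto simp: fun_eq_iff not_le\<close>)

text \<open>The new word is joined to the whole of l r, which keeps the two-sided word admissible,
  so the gap depends on l. The right part must remain a chain on its own, because it is going to be
  copied; it does, since factors of words of the language are in the language.\<close>

lemma join_right:
  assumes "gap_chain ts S G t (l @ r)" "gap_chain ts S G t r" "gap_chain ts S G t v"
  shows "\<exists>w. length w \<le> t \<and> gap_chain ts S G t (l @ (r @ w @ v)) \<and> gap_chain ts S G t (r @ w @ v)"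
proof -
  obtain w where w: "length w \<le> t" "gap_chain ts S G t (l @ r @ w @ v)"
    using join[OF assms(1,3)] by auto
  then have lang: "l @ r @ w @ v \<in> language ts S" by (simp add: gap_chain_def)
  have "sublist w (l @ r @ w @ v)" "sublist (r @ w @ v) (l @ r @ w @ v)"
    by (auto simp: sublist_def) (metis append_assoc, metis append.right_neutral)
  then have "gap_chain ts S G t (r @ w @ v)"
    using gap_chain_join[OF assms(2,3) _ w(1)] language_sublist[OF lang] by blast
  then show ?thesis using w by auto
qed

text \<open>Dependent choice along the steps: an insertion refers to the word at its cut, which has
  a smaller index. In each step the right part is extended first, against the old left part, and the
  left part afterwards.\<close>

lemma ex_run:
  assumes \<omega>: "range \<omega> \<subseteq> inputs"
  shows "\<exists>R L. run \<omega> R L"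
proof -
  define gc where "gc = gap_chain ts S G t"
  define P where "P f k r \<longleftrightarrow> gc (fst r) \<and> gc (snd r @ fst r) \<and>
      (case k of 0 \<Rightarrow> r = (W, []) | Suc k \<Rightarrow> step_right \<omega> (fst \<circ> f) k (fst r) \<and> step_left \<omega> (snd \<circ> f) k (snd r))"
    for f :: "nat \<Rightarrow> nat list \<times> nat list" and k r
  have "\<exists>f. \<forall>k. P f k (f k)"
  proof (rule dependent_wf_choice[OF wf_less_than])
    fix f g :: "nat \<Rightarrow> nat list \<times> nat list" and k r
    assume fg: "\<And>i. (i, k) \<in> less_than \<Longrightarrow> f i = g i"
    show "P f k r = P g k r"
    proof (cases k)
      case (Suc k')
      have "step_right \<omega> (fst \<circ> f) k' q = step_right \<omega> (fst \<circ> g) k' q" for q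
      proof (cases "k' \<in> range s")
        case True
        then have inv: "s (inv s k') = k'" by (rule f_inv_into_f)
        have "cut (fst \<circ> f) (inv s k') = cut (fst \<circ> g) (inv s k')"
          by (rule cut_cong) (use fg Suc inv in auto)
        moreover have "cut (fst \<circ> g) (inv s k') < k" using cut_le[of "fst \<circ> g" "inv s k'"] inv Suc by simp
        ultimately show ?thesis using fg Suc by (simp add: step_right_def)
      qed (use fg Suc in \<open>simp add: step_right_def\<close>)
      moreover have "step_left \<omega> (snd \<circ> f) k' q = step_left \<omega> (snd \<circ> g) k' q" for q
        using fg Suc by (simp add: step_left_def)
      ultimately show ?thesis using Suc by (simp add: P_def)
    qed (simp add: P_def)
  next
    fix k and f :: "nat \<Rightarrow> nat list \<times> nat list"
    assume IH: "\<And>i. (i, k) \<in> less_than \<Longrightarrow> P f i (f i)"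
    show "\<exists>r. P f k r"
    proof (cases k)
      case 0
      then show ?thesis using W by (intro exI[of _ "(W, [])"]) (simp add: P_def gc_def)
    next
      case (Suc k')
      have gc: "gc (fst (f i))" "gc (snd (f i) @ fst (f i))" if "i \<le> k'" for i
        using IH[of i] that Suc by (auto simp: P_def)
      have \<omega>k: "gc (fst (\<omega> k'))" "ts \<Longrightarrow> gc (snd (\<omega> k'))"
      proof -
        have *: "\<omega> k' \<in> F \<times> (if ts then F else {[]})" using \<omega> unfolding inputs_def by blast
        show "gc (fst (\<omega> k'))" using * F(4) by (simp add: gc_def mem_Times_iff)
        show "gc (snd (\<omega> k'))" if ts using * F(4) that by (simp add: gc_def mem_Times_iff)
      qed
      define l where "l = snd (f k')"
      have "\<exists>r. gc (l @ r) \<and> gc r \<and> step_right \<omega> (fst \<circ> f) k' r"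
      proof (cases "k' \<in> range s")
        case True
        define \<kappa> where "\<kappa> = cut (fst \<circ> f) (inv s k')"
        have "s (inv s k') = k'" using True by (rule f_inv_into_f)
        then have "\<kappa> \<le> k'" using cut_le[of "fst \<circ> f" "inv s k'"] by (simp add: \<kappa>_def)
        obtain u1 where u1: "length u1 \<le> t" "gc (l @ (fst (f k') @ u1 @ fst (f \<kappa>)))" "gc (fst (f k') @ u1 @ fst (f \<kappa>))"
          using join_right[of l "fst (f k')" "fst (f \<kappa>)"] gc[OF order_refl] gc[OF \<open>\<kappa> \<le> k'\<close>] unfolding gc_def l_def by blast
        obtain u2 where u2: "length u2 \<le> t" "gc (l @ ((fst (f k') @ u1 @ fst (f \<kappa>)) @ u2 @ V))"
          "gc ((fst (f k') @ u1 @ fst (f \<kappa>)) @ u2 @ V)"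
          using join_right[OF u1(2,3)[unfolded gc_def] V(1)] unfolding gc_def by blast
        obtain u3 where u3: "length u3 \<le> t" "gc (l @ (((fst (f k') @ u1 @ fst (f \<kappa>)) @ u2 @ V) @ u3 @ fst (\<omega> k')))"
          "gc (((fst (f k') @ u1 @ fst (f \<kappa>)) @ u2 @ V) @ u3 @ fst (\<omega> k'))"
          using join_right[OF u2(2,3)[unfolded gc_def] \<omega>k(1)[unfolded gc_def]] unfolding gc_def by blast
        have "step_right \<omega> (fst \<circ> f) k' (((fst (f k') @ u1 @ fst (f \<kappa>)) @ u2 @ V) @ u3 @ fst (\<omega> k'))"
          unfolding step_right_def using True u1(1) u2(1) u3(1)
          by (intro exI[of _ u1] exI[of _ u2] exI[of _ u3]) (simp add: \<kappa>_def)
        then show ?thesis using u3 by blast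
      next
        case False
        obtain u3 where u3: "length u3 \<le> t" "gc (l @ (fst (f k') @ u3 @ fst (\<omega> k')))" "gc (fst (f k') @ u3 @ fst (\<omega> k'))"
          using join_right[of l "fst (f k')" "fst (\<omega> k')"] gc[OF order_refl] \<omega>k(1) unfolding gc_def l_def by blast
        have "step_right \<omega> (fst \<circ> f) k' (fst (f k') @ u3 @ fst (\<omega> k'))"
          unfolding step_right_def using False u3(1)
          by (intro exI[of _ "[]"] exI[of _ u3]) auto
        then show ?thesis using u3 by blast
      qed
      then obtain r where r: "gc (l @ r)" "gc r" "step_right \<omega> (fst \<circ> f) k' r" by blast
      have "\<exists>l'. gc (l' @ r) \<and> step_left \<omega> (snd \<circ> f) k' l'"
      proof (cases ts)
        case True
        obtain u where u: "length u \<le> t" "gc (snd (\<omega> k') @ u @ l @ r)"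
          using join[OF \<omega>k(2)[OF True, unfolded gc_def] r(1)[unfolded gc_def]] unfolding gc_def by blast
        have "step_left \<omega> (snd \<circ> f) k' (snd (\<omega> k') @ u @ l)"
          unfolding step_left_def using True u(1) by (auto simp: l_def)
        then show ?thesis using u(2) by (intro exI[of _ "snd (\<omega> k') @ u @ l"]) simp
      next
        case False
        have "step_left \<omega> (snd \<circ> f) k' []" unfolding step_left_def using False by simp
        then show ?thesis using r by (intro exI[of _ "[]"]) simp
      qed
      then obtain l' where "gc (l' @ r)" "step_left \<omega> (snd \<circ> f) k' l'" by blast
      then show ?thesis using r Suc by (intro exI[of _ "(r, l')"]) (simp add: P_def)
    qed
  qed
  then obtain f where f: "\<And>k. P f k (f k)" by blast
  have "run \<omega> (fst \<circ> f) (snd \<circ> f)"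
    using f[of 0] f[of "Suc _"] f by (simp add: run_def P_def gc_def)
  then show ?thesis by blast
qed

end

section \<open>Prefixes, cuts and the right half of a single run\<close>

locale insertion_run = insertion +
  fixes \<omega> :: "nat \<Rightarrow> nat list \<times> nat list" and R L :: "nat \<Rightarrow> nat list"
  assumes \<omega>: "range \<omega> \<subseteq> inputs" and run: "run \<omega> R L"
begin

lemma \<omega>_in: "\<omega> k \<in> F \<times> (if ts then F else {[]})"
  using \<omega> unfolding inputs_def by blast

lemma fst_\<omega>: "fst (\<omega> k) \<in> F"
  using \<omega>_in[of k] by (simp add: mem_Times_iff)

lemma snd_\<omega>: "ts \<Longrightarrow> snd (\<omega> k) \<in> F" "\<not> ts \<Longrightarrow> snd (\<omega> k) = []"
  using \<omega>_in[of k] by (simp_all add: mem_Times_iff)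

lemma c_pos: "1 \<le> c"
  by (simp add: c)

lemma R_0: "R 0 = W"
  using run by (simp add: run_def)

lemma R_letters: "set (R k) \<subseteq> {..<m}"
  using run language_letters[OF sub] by (simp add: run_def gap_chain_def)

lemma R_Suc_free:
  assumes "k \<notin> range s"
  obtains u where "length u \<le> t" "set u \<subseteq> {..<m}" "R (Suc k) = R k @ u @ fst (\<omega> k)"
proof -
  have "step_right \<omega> R k (R (Suc k))" using run by (simp add: run_def)
  then obtain u where u: "length u \<le> t" "R (Suc k) = R k @ u @ fst (\<omega> k)"
    unfolding step_right_def if_not_P[OF assms] append_Nil by blast
  moreover have "set u \<subseteq> {..<m}" using R_letters[of "Suc k"] u by auto
  ultimately show thesis using that by blast
qed

lemma R_Suc_insert:
  obtains u1 u2 u3 where "length u1 \<le> t" "length u2 \<le> t" "length u3 \<le> t"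
    "set u1 \<subseteq> {..<m}" "set u2 \<subseteq> {..<m}" "set u3 \<subseteq> {..<m}"
    "R (Suc (s j)) = R (s j) @ u1 @ R (cut R j) @ u2 @ V @ u3 @ fst (\<omega> (s j))"
proof -
  have "step_right \<omega> R (s j) (R (Suc (s j)))" using run by (simp add: run_def)
  then obtain u1 u2 u3 where u: "length u1 \<le> t" "length u2 \<le> t" "length u3 \<le> t"
    "R (Suc (s j)) = R (s j) @ (u1 @ R (cut R j) @ u2 @ V) @ u3 @ fst (\<omega> (s j))"
    unfolding step_right_def if_P[OF rangeI] inv_f_f[OF inj_s] by blast
  moreover have "set u1 \<subseteq> {..<m}" "set u2 \<subseteq> {..<m}" "set u3 \<subseteq> {..<m}"
    using R_letters[of "Suc (s j)"] u(4) by auto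
  ultimately show thesis using that by simp
qed

lemma R_Suc: "\<exists>z. R (Suc k) = R k @ z \<and> N \<le> length z"
proof (cases "k \<in> range s")
  case True
  then obtain j where "k = s j" by blast
  obtain u1 u2 u3 where "R (Suc (s j)) = R (s j) @ u1 @ R (cut R j) @ u2 @ V @ u3 @ fst (\<omega> (s j))"
    by (rule R_Suc_insert)
  then show ?thesis using F(3)[OF fst_\<omega>[of k]] \<open>k = s j\<close> by simp
next
  case False
  then obtain u where "R (Suc k) = R k @ u @ fst (\<omega> k)" by (rule R_Suc_free)
  then show ?thesis using F(3)[OF fst_\<omega>[of k]] by simp
qed

lemma R_prefix: "k \<le> k' \<Longrightarrow> \<exists>z. R k' = R k @ z \<and> (k' - k) * N \<le> length z"
proof (induction k' rule: dec_induct)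
  case (step k')
  then obtain z z' where "R k' = R k @ z" "(k' - k) * N \<le> length z" "R (Suc k') = R k' @ z'" "N \<le> length z'"
    using R_Suc by blast
  then show ?case using step by (intro exI[of _ "z @ z'"]) (auto simp: Suc_diff_le)
qed simp

lemma R_length_mono: "k \<le> k' \<Longrightarrow> length (R k) \<le> length (R k')"
  using R_prefix by force

lemma R_length_ge: "length W + k * N \<le> length (R k)"
  using R_prefix[of 0 k] by (auto simp: R_0)

lemma R_length_ge': "k \<le> length (R k)"
proof -
  have "k * 1 \<le> k * N" using N(1) by (rule mult_le_mono2)
  then show ?thesis using R_length_ge[of k] by linarith
qed

lemma R_free:
  assumes "k \<le> k'" "\<And>i. k \<le> i \<Longrightarrow> i < k' \<Longrightarrow> i \<notin> range s"
  shows "\<exists>ps. set ps \<subseteq> pieces m t F \<and> R k' = R k @ concat ps \<and> (k' - k) * N \<le> length (concat ps)"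
  using assms
proof (induction k' rule: dec_induct)
  case base
  show ?case by (intro exI[of _ "[]"]) simp
next
  case (step k')
  then obtain ps where ps: "set ps \<subseteq> pieces m t F" "R k' = R k @ concat ps" "(k' - k) * N \<le> length (concat ps)" by auto
  obtain u where u: "length u \<le> t" "set u \<subseteq> {..<m}" "R (Suc k') = R k' @ u @ fst (\<omega> k')"
    using R_Suc_free[of k'] step by auto
  have "u @ fst (\<omega> k') \<in> pieces m t F" using u fst_\<omega>[of k'] by (auto simp: pieces_def)
  then show ?case using ps u F(3)[OF fst_\<omega>[of k']] step(1)
    by (intro exI[of _ "ps @ [u @ fst (\<omega> k')]"]) (auto simp: Suc_diff_le)
qed

lemma cut_props: "cut R j < s j" "cut R j mod (2 * c) = c" "lam j \<le> length (R (cut R j))"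
  "cut R j \<le> 2 * c * lam j + c"
proof -
  let ?P = "\<lambda>k. (k mod (2 * c) = c \<and> lam j \<le> length (R k)) \<or> s j \<le> k"
  \<comment> \<open>This k has the residue required of a cut, and R k has at least k \<ge> lam j
    letters, since each step adds at least one.\<close>
  define k where "k = 2 * c * lam j + c"
  have "k mod (2 * c) = c" using c_pos by (simp add: k_def)
  moreover have "lam j \<le> length (R k)"
  proof -
    have "lam j \<le> k" using c_pos by (simp add: k_def trans_le_add1)
    then show ?thesis using R_length_ge'[of k] by linarith
  qed
  ultimately have "?P k" by simp
  then have le: "cut R j \<le> k" unfolding cut_def by (rule Least_le)
  have "?P (cut R j)" unfolding cut_def by (rule LeastI[of ?P k]) fact
  moreover show lt: "cut R j < s j" using le s(5)[of j] by (simp add: k_def)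
  ultimately show "cut R j mod (2 * c) = c" "lam j \<le> length (R (cut R j))" by auto
  show "cut R j \<le> 2 * c * lam j + c" using le by (simp add: k_def)
qed

lemma cut_least:
  assumes "k mod (2 * c) = c" "lam j \<le> length (R k)"
  shows "cut R j \<le> k"
  unfolding cut_def by (rule Least_le) (use assms in simp)

lemma cut_mono: "i \<le> j \<Longrightarrow> cut R i \<le> cut R j"
  using cut_props[of j] monoD[OF lam(1)] by (intro cut_least) (auto intro: order_trans)

lemma cut_ge: "c \<le> cut R j"
  using cut_props(2)[of j] by (metis mod_less_eq_dividend)

lemma not_insert:
  assumes "k mod (2 * c) \<noteq> 0"
  shows "k \<notin> range s"
  using assms s(2) by (auto simp: dvd_eq_mod_eq_0)

text \<open>The common limit of the words R k; after Suc i steps position i has been filled for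
  good.\<close>

definition X :: "nat \<Rightarrow> nat" where "X i = R (Suc i) ! i"

lemma R_nth: "i < length (R k) \<Longrightarrow> R k ! i = X i"
proof -
  assume i: "i < length (R k)"
  have i': "i < length (R (Suc i))" using R_length_ge'[of "Suc i"] by simp
  show ?thesis
  proof (cases "k \<le> Suc i")
    case True
    then obtain z where "R (Suc i) = R k @ z" using R_prefix by blast
    then show ?thesis using i by (simp add: X_def nth_append)
  next
    case False
    then obtain z where "R k = R (Suc i) @ z" using R_prefix[of "Suc i" k] by auto
    then show ?thesis using i' by (simp add: X_def nth_append)
  qed
qed

lemma X_slice:
  assumes "R k = a @ y @ d" "r < length y"
  shows "X (length a + r) = y ! r"
  using R_nth[of "length a + r" k] assms by (simp add: nth_append)

lemma sublist_X:
  assumes "R k = a @ y @ d" "length a \<le> q" "q + n \<le> length a + length y"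
  shows "sublist (map (\<lambda>r. X (q + r)) [0..<n]) y"
proof -
  have "map (\<lambda>r. X (q + r)) [0..<n] = map (\<lambda>r. (a @ y @ d) ! (q + r)) [0..<n]"
    using assms R_nth[of _ k] by (intro map_cong) auto
  then show ?thesis using sublist_slice[OF assms(2,3)] by metis
qed

lemma W_eq: "W = map X [0..<length W]"
  using R_nth[of _ 0] by (intro nth_equalityI) (auto simp: R_0)

text \<open>The trailing \<open>u\<close> is a gap that leads to a copy rather than to a block.
  Appending any word of F to it yields a concatenation of pieces, which W avoids.\<close>

lemma not_marker:
  assumes y: "R k = a @ (concat ps @ u) @ d" "set ps \<subseteq> pieces m t (insert V F)" "length u \<le> t" "set u \<subseteq> {..<m}"
    and q: "length a \<le> q" "q + length W \<le> length a + length (concat ps @ u)"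
  shows "\<exists>r<length W. X (q + r) \<noteq> X r"
proof (rule ccontr)
  assume "\<not> ?thesis"
  then have "map (\<lambda>r. X (q + r)) [0..<length W] = W" using W_eq by (metis (no_types, lifting) atLeastLessThan_iff map_cong set_upt)
  then have W': "sublist W (concat ps @ u)" using sublist_X[OF y(1) q] by simp
  obtain f where f: "f \<in> F" using F(2) by blast
  have "sublist W (concat (ps @ [u @ f]))" 
  proof -
    obtain b b' where "concat ps @ u = b @ W @ b'" using W' by (auto simp: sublist_def)
    then have "concat (ps @ [u @ f]) = b @ W @ (b' @ f)" by simp
    then show ?thesis unfolding sublist_def by blast
  qed
  moreover have "set (ps @ [u @ f]) \<subseteq> pieces m t (insert V F)" using y f by (auto simp: pieces_def)
  ultimately show False using W(3) unfolding avoids_def by blast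
qed

end

lemma no_multiple_near:
  fixes c :: nat
  assumes "k mod (2 * c) = c" "k < i + c" "i < k + c"
  shows "i mod (2 * c) \<noteq> 0"
proof
  assume "i mod (2 * c) = 0"
  then obtain b where b: "i = 2 * c * b" by auto
  define a where "a = k div (2 * c)"
  have a: "k = 2 * c * a + c" using assms(1) by (metis a_def mult_div_mod_eq)
  have "2 * c * a < 2 * c * b" "2 * c * b < 2 * c * (a + 1)" using assms(2,3) a b by (auto simp: algebra_simps)
  then have "a < b" "b < a + 1" by (simp_all only: mult_less_cancel1)
  then show False by simp
qed

section \<open>The hypotheses of \<open>prefix_occurrence\<close> for a run\<close>

context insertion_run
begin

lemma c_bounds: "3 * length W < c" "t + length V < c"
  using c by linarith+

definition gap_spec :: "nat \<Rightarrow> nat list \<times> nat list \<times> nat list \<Rightarrow> bool" where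
  "gap_spec j us \<longleftrightarrow> (case us of (u1, u2, u3) \<Rightarrow> length u1 \<le> t \<and> length u2 \<le> t \<and> length u3 \<le> t \<and>
    set u1 \<subseteq> {..<m} \<and> set u2 \<subseteq> {..<m} \<and> set u3 \<subseteq> {..<m} \<and>
    R (Suc (s j)) = R (s j) @ u1 @ R (cut R j) @ u2 @ V @ u3 @ fst (\<omega> (s j)))"

text \<open>The gap words need not be unique; one choice is fixed so that \<open>p\<close> becomes a
  function of j.\<close>

definition gaps :: "nat \<Rightarrow> nat list \<times> nat list \<times> nat list" where
  "gaps j = (SOME us. gap_spec j us)"

definition "g1 j = fst (gaps j)"
definition "g2 j = fst (snd (gaps j))"
definition "g3 j = snd (snd (gaps j))"

lemma gap_spec: "gap_spec j (g1 j, g2 j, g3 j)"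
proof -
  obtain u1 u2 u3 where "length u1 \<le> t" "length u2 \<le> t" "length u3 \<le> t"
    "set u1 \<subseteq> {..<m}" "set u2 \<subseteq> {..<m}" "set u3 \<subseteq> {..<m}"
    "R (Suc (s j)) = R (s j) @ u1 @ R (cut R j) @ u2 @ V @ u3 @ fst (\<omega> (s j))" by (rule R_Suc_insert)
  then have "gap_spec j (u1, u2, u3)" by (simp add: gap_spec_def)
  then have "gap_spec j (gaps j)" unfolding gaps_def by (rule someI)
  then show ?thesis by (simp add: g1_def g2_def g3_def)
qed

lemma g_length: "length (g1 j) \<le> t" "length (g2 j) \<le> t" "length (g3 j) \<le> t"
  and g_letters: "set (g1 j) \<subseteq> {..<m}" "set (g2 j) \<subseteq> {..<m}" "set (g3 j) \<subseteq> {..<m}"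
  and R_insert: "R (Suc (s j)) = R (s j) @ g1 j @ R (cut R j) @ g2 j @ V @ g3 j @ fst (\<omega> (s j))"
  using gap_spec[of j] by (simp_all add: gap_spec_def)

text \<open>Since X is indexed from 0, the position of copy j is also the return time that this copy
  causes.\<close>

definition p :: "nat \<Rightarrow> nat" where "p j = length (R (s j)) + length (g1 j)"

definition l :: "nat \<Rightarrow> nat" where "l j = length (R (cut R j))"

lemma W_l: "3 * length W \<le> l j"
  using cut_ge[of j] R_length_ge'[of "cut R j"] c_bounds(1) unfolding l_def by linarith

lemma l_mono: "i \<le> j \<Longrightarrow> l i \<le> l j"
  unfolding l_def by (intro R_length_mono cut_mono)

lemma strict_mono_p: "strict_mono p"
proof (rule strict_mono_Suc_iff[THEN iffD2], intro allI)
  fix j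
  have "length (R (Suc (s j))) = p j + length (R (cut R j)) + length (g2 j) + length V + length (g3 j) + length (fst (\<omega> (s j)))"
    by (simp add: R_insert p_def)
  then have "p j < length (R (Suc (s j)))" using V(2) N(1) by linarith
  also have "\<dots> \<le> length (R (s (Suc j)))" using s(1) by (intro R_length_mono) (simp add: strict_mono_Suc_iff Suc_leI)
  also have "\<dots> \<le> p (Suc j)" by (simp add: p_def)
  finally show "p j < p (Suc j)" .
qed

lemma copy: "r < l i \<Longrightarrow> X (p i + r) = X r"
  using X_slice[of "Suc (s i)" "R (s i) @ g1 i" "R (cut R i)" _ r] R_nth[of r "cut R i"]
  by (simp add: R_insert p_def l_def)

lemma pieces_insert: "set ps \<subseteq> pieces m t F \<Longrightarrow> set ps \<subseteq> pieces m t (insert V F)"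
  by (rule order_trans) (auto simp: pieces_eq_image)

lemma marker_first:
  assumes "length W \<le> q" "q + length W \<le> p 0"
  shows "\<exists>r<length W. X (q + r) \<noteq> X r"
proof -
  have "i \<notin> range s" if "i < s 0" for i
    using that strict_mono_less_eq[OF s(1), of 0] by (auto simp: not_le[symmetric])
  then obtain ps where ps: "set ps \<subseteq> pieces m t F" "R (s 0) = R 0 @ concat ps" using R_free[of 0 "s 0"] by auto
  show ?thesis
  proof (rule not_marker[of "Suc (s 0)" W ps "g1 0"])
    show "R (Suc (s 0)) = W @ (concat ps @ g1 0) @ R (cut R 0) @ g2 0 @ V @ g3 0 @ fst (\<omega> (s 0))"
      by (simp add: R_insert ps R_0)
  qed (use ps assms pieces_insert g_length g_letters in \<open>auto simp: p_def R_0\<close>)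
qed

text \<open>The steps just before the cut are free of insertions. Hence the last 3|W| letters of
  copy i, the word V and everything up to the next copy form a concatenation of pieces over F and V,
  followed by a gap.\<close>

lemma marker_between:
  assumes "p i + l i \<le> q + 3 * length W" "q + length W \<le> p (Suc i)"
  shows "\<exists>r<length W. X (q + r) \<noteq> X r"
proof -
  define \<kappa> where "\<kappa> = cut R i"
  have \<kappa>: "c \<le> \<kappa>" "\<kappa> mod (2 * c) = c" using cut_ge cut_props(2) by (auto simp: \<kappa>_def)
  have "j \<notin> range s" if "\<kappa> - (c - 1) \<le> j" "j < \<kappa>" for j
    using no_multiple_near[OF \<kappa>(2), of j] that \<kappa>(1) c_pos by (intro not_insert) auto
  then obtain ps0 where ps0: "set ps0 \<subseteq> pieces m t F" "R \<kappa> = R (\<kappa> - (c - 1)) @ concat ps0"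
    "(\<kappa> - (\<kappa> - (c - 1))) * N \<le> length (concat ps0)"
    using R_free[of "\<kappa> - (c - 1)" \<kappa>] by auto
  have "(c - 1) * 1 \<le> (c - 1) * N" using N(1) by (rule mult_le_mono2)
  moreover have \<kappa>c: "\<kappa> - (\<kappa> - (c - 1)) = c - 1" using \<kappa>(1) by simp
  ultimately have len0: "3 * length W \<le> length (concat ps0)"
    using ps0(3)[unfolded \<kappa>c] c_bounds(1) by linarith
  have "j \<notin> range s" if "Suc (s i) \<le> j" "j < s (Suc i)" for j
  proof
    assume "j \<in> range s"
    then obtain k where "j = s k" by blast
    then have "i < k" "k < Suc i" using that strict_mono_less[OF s(1)] by (auto simp: Suc_le_eq)
    then show False by simp
  qed
  moreover have "Suc (s i) \<le> s (Suc i)" using s(1) by (simp add: strict_mono_Suc_iff Suc_leI)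
  ultimately obtain ps1 where ps1: "set ps1 \<subseteq> pieces m t F" "R (s (Suc i)) = R (Suc (s i)) @ concat ps1"
    using R_free[of "Suc (s i)" "s (Suc i)"] by auto
  define ps where "ps = ps0 @ [g2 i @ V, g3 i @ fst (\<omega> (s i))] @ ps1"
  define a where "a = R (s i) @ g1 i @ R (\<kappa> - (c - 1))"
  have R_eq: "R (s (Suc i)) = a @ concat ps"
    using ps0(2) by (simp add: ps1 R_insert ps_def a_def \<kappa>_def)
  have "g2 i @ V \<in> pieces m t (insert V F)" "g3 i @ fst (\<omega> (s i)) \<in> pieces m t (insert V F)"
    using g_length[of i] g_letters[of i] fst_\<omega>[of "s i"] unfolding pieces_def by blast+
  then have ps: "set ps \<subseteq> pieces m t (insert V F)"
    using pieces_insert[OF ps0(1)] pieces_insert[OF ps1(1)] by (simp add: ps_def)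
  show ?thesis
  proof (rule not_marker[OF _ ps g_length(1) g_letters(1)])
    show "R (Suc (s (Suc i))) = a @ (concat ps @ g1 (Suc i)) @ R (cut R (Suc i)) @ g2 (Suc i) @ V @ g3 (Suc i) @ fst (\<omega> (s (Suc i)))"
      by (simp add: R_insert R_eq)
    have "length a + length (concat ps0) = p i + l i"
      using arg_cong[OF ps0(2), of length] by (simp add: a_def p_def l_def \<kappa>_def)
    then show "length a \<le> q" using assms(1) len0 by simp
    have "length (R (s (Suc i))) = length a + length (concat ps)" by (simp add: R_eq)
    then show "q + length W \<le> length a + length (concat ps @ g1 (Suc i))" using assms(2) by (simp add: p_def)
  qed
qed

text \<open>If the match extended beyond V, then V would also occur after the original prefix, at
  most t letters from its end. But the c steps following the cut are free of insertions, they fill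
  at least t + |V| letters, and V avoids their concatenation.\<close>

lemma mismatch: "\<exists>r < l i + (t + length V). X (p i + r) \<noteq> X r"
proof (rule ccontr)
  assume "\<not> ?thesis"
  then have eq: "X (p i + r) = X r" if "r < l i + (t + length V)" for r using that by blast
  define \<kappa> where "\<kappa> = cut R i"
  have \<kappa>: "c \<le> \<kappa>" "\<kappa> mod (2 * c) = c" using cut_ge cut_props(2) by (auto simp: \<kappa>_def)
  have "j \<notin> range s" if "\<kappa> \<le> j" "j < \<kappa> + c" for j
    using no_multiple_near[OF \<kappa>(2), of j] that c_pos by (intro not_insert) auto
  then obtain ps where ps: "set ps \<subseteq> pieces m t F" "R (\<kappa> + c) = R \<kappa> @ concat ps" "c * N \<le> length (concat ps)"
    using R_free[of \<kappa> "\<kappa> + c"] by auto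
  have "c * 1 \<le> c * N" using N(1) by (rule mult_le_mono2)
  then have len: "t + length V \<le> length (concat ps)" using ps(3) c_bounds(2) by linarith
  have V_nth: "V ! r = X (l i + length (g2 i) + r)" if "r < length V" for r
  proof -
    have "V ! r = X (length (R (s i) @ g1 i @ R \<kappa> @ g2 i) + r)"
      using that by (intro X_slice[symmetric, of "Suc (s i)" _ _ "g3 i @ fst (\<omega> (s i))"]) (simp_all add: R_insert \<kappa>_def)
    also have "\<dots> = X (p i + (l i + length (g2 i) + r))" by (simp add: p_def l_def \<kappa>_def add.assoc)
    also have "\<dots> = X (l i + length (g2 i) + r)" using that g_length(2)[of i] by (intro eq) simp
    finally show ?thesis .
  qed
  have "map (\<lambda>r. X (l i + length (g2 i) + r)) [0..<length V] = V"
    using V_nth by (intro nth_equalityI) auto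
  moreover have "sublist (map (\<lambda>r. X (l i + length (g2 i) + r)) [0..<length V]) (concat ps)"
  proof (rule sublist_X)
    show "R (\<kappa> + c) = R \<kappa> @ concat ps @ []" using ps by simp
  qed (use len g_length(2)[of i] in \<open>auto simp: l_def \<kappa>_def\<close>)
  ultimately show False using V(3) ps(1) by (auto simp: avoids_def)
qed

text \<open>If copy j begins within the prefix of length \<open>l i\<close>, the cut comes after
  step s j, so the prefix contains that step entirely: the copy, V and a final block, whose N \<ge>
  t letters account for the summand t.\<close>

lemma nested:
  assumes "p j < l i"
  shows "p j + l j + (t + length V) \<le> l i"
proof -
  have "\<not> cut R i \<le> s j" using R_length_mono[of "cut R i" "s j"] assms by (auto simp: p_def l_def)
  then have "length (R (Suc (s j))) \<le> l i" unfolding l_def by (intro R_length_mono) simp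
  then show ?thesis using F(3)[OF fst_\<omega>[of "s j"]] N(2) by (simp add: R_insert p_def l_def)
qed

lemma occurrence:
  assumes "1 \<le> q" "\<And>r. r < n \<Longrightarrow> X (q + r) = X r" "3 * length W \<le> n"
  shows "\<exists>i. p i \<le> q \<and> q + n < p i + l i + (t + length V)"
proof (rule prefix_occurrence[where M = "length W" and X = X and p = p and l = l])
  show "3 * length W \<le> p 0" 
    using R_length_ge'[of "s 0"] s(5)[of 0] c_bounds(1) unfolding p_def by linarith
  show "0 < length W" using W(2) by linarith
  show "\<exists>r<length W. X (q + r) \<noteq> X r" if "length W \<le> q" "q + length W \<le> p 0" for q
    using that by (rule marker_first)
  show "\<exists>r<length W. X (q + r) \<noteq> X r" if "p i + l i \<le> q + 3 * length W" "q + length W \<le> p (Suc i)" for i q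
    using that by (rule marker_between)
qed (fact W_l strict_mono_p copy mismatch nested assms)+

text \<open>Coordinate 1 is the first letter of W and coordinate 0 the last letter of the left
  words. These grow to the left; reversing them gives coordinate i the fixed list index -i.\<close>

definition point :: "int \<Rightarrow> nat" where
  "point i = (if 1 \<le> i then X (nat (i - 1)) else if ts then rev (L (Suc (nat (- i)))) ! nat (- i) else 0)"

lemma L_Suc: "ts \<Longrightarrow> \<exists>u. length u \<le> t \<and> L (Suc k) = snd (\<omega> k) @ u @ L k" "\<not> ts \<Longrightarrow> L k = []"
proof -
  have *: "step_left \<omega> L k (L (Suc k))" for k using run by (simp add: run_def)
  show "\<exists>u. length u \<le> t \<and> L (Suc k) = snd (\<omega> k) @ u @ L k" if ts using * that unfolding step_left_def by simp
  show "L k = []" if "\<not> ts"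
  proof (cases k)
    case 0
    then show ?thesis using run by (simp add: run_def)
  next
    case (Suc k')
    then show ?thesis using *[of k'] that unfolding step_left_def by simp
  qed
qed

lemma L_suffix:
  assumes ts "k \<le> k'"
  shows "\<exists>z. L k' = z @ L k \<and> (k' - k) * N \<le> length z"
  using assms(2)
proof (induction k' rule: dec_induct)
  case (step k')
  then obtain z u where "L k' = z @ L k" "(k' - k) * N \<le> length z" "L (Suc k') = snd (\<omega> k') @ u @ L k'"
    using L_Suc(1)[OF assms(1)] by blast
  then show ?case using step F(3)[OF snd_\<omega>(1)[OF assms(1), of k']]
    by (intro exI[of _ "snd (\<omega> k') @ u @ z"]) (auto simp: Suc_diff_le)
qed simp

lemma L_length_ge: "ts \<Longrightarrow> k \<le> length (L k)"
proof -
  assume ts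
  obtain z where "L k = z @ L 0" "k * N \<le> length z" using L_suffix[OF \<open>ts\<close>, of 0 k] by auto
  moreover have "k * 1 \<le> k * N" using N(1) by (rule mult_le_mono2)
  moreover have "length (L k) = length z + length (L 0)" using \<open>L k = z @ L 0\<close> by simp
  ultimately show ?thesis by linarith
qed

lemma L_length_le: "length (L k) \<le> (N + t) * k"
proof (cases ts)
  case True
  show ?thesis
  proof (induction k)
    case (Suc k)
    then show ?case using L_Suc(1)[OF True, of k] F(3)[OF snd_\<omega>(1)[OF True, of k]] by auto
  qed (use run in \<open>simp add: run_def\<close>)
qed (simp add: L_Suc(2))

lemma L_nth: "i < length (L k) \<Longrightarrow> rev (L k) ! i = point (- int i)"
proof (cases ts)
  case True
  assume i: "i < length (L k)"
  have i': "i < length (L (Suc i))" using L_length_ge[OF True, of "Suc i"] by simp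
  have "rev (L k) ! i = rev (L (Suc i)) ! i"
  proof (cases "k \<le> Suc i")
    case le: True
    then obtain z where "L (Suc i) = z @ L k" using L_suffix[OF True] by blast
    then show ?thesis using i by (simp add: nth_append)
  next
    case False
    then obtain z where "L k = z @ L (Suc i)" using L_suffix[OF True, of "Suc i" k] by auto
    then show ?thesis using i' by (simp add: nth_append)
  qed
  moreover have "point (- int i) = rev (L (Suc i)) ! i" unfolding point_def using True by simp
  ultimately show ?thesis by simp
qed (simp add: L_Suc(2))

lemma point_right: "map point [1..int (length (R k))] = R k"
  by (intro nth_equalityI) (auto simp: point_def R_nth)

lemma point_left: "map point [1 - int (length (L k))..0] = L k"
proof (intro nth_equalityI)
  fix i assume "i < length (map point [1 - int (length (L k))..0])"
  then have i: "i < length (L k)" by simp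
  then have "map point [1 - int (length (L k))..0] ! i = point (- int (length (L k) - Suc i))"
    by (simp add: of_nat_diff algebra_simps)
  also have "\<dots> = rev (L k) ! (length (L k) - Suc i)" using i by (intro L_nth[symmetric]) simp
  also have "\<dots> = L k ! i" using i by (simp add: rev_nth)
  finally show "map point [1 - int (length (L k))..0] ! i = L k ! i" .
qed simp

lemma point_window: "map point [1 - int (length (L k))..int (length (R k))] = L k @ R k"
proof -
  have "[1 - int (length (L k))..int (length (R k))] = [1 - int (length (L k))..0] @ [1..int (length (R k))]"
    using upto_split2[of "1 - int (length (L k))" 0 "int (length (R k))"] by (cases "L k = []") (auto simp: Suc_le_eq)
  then show ?thesis by (simp add: point_left point_right)
qed

lemma point_in: "point \<in> S"
proof (rule subshiftI[OF sub])
  show "point i = 0" if "i \<notin> idx ts" for i using that by (auto simp: point_def idx_def split: if_splits)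
  show "map point [(if ts then - int n else 1)..int n] \<in> language ts S" for n
  proof (cases "n = 0 \<and> \<not> ts")
    case True
    then show ?thesis using language_Nil[OF sub] by simp
  next
    case False
    define lo where "lo = (if ts then - int n else 1)"
    define a where "a = 1 - int (length (L (n + 1)))"
    define b where "b = int (length (R (n + 1)))"
    have lo: "a \<le> lo" "lo \<le> int n" "int n \<le> b"
      using L_length_ge[of "n + 1"] R_length_ge'[of "n + 1"] False by (auto simp: lo_def a_def b_def L_Suc(2))
    have "[a..b] = [a..lo - 1] @ [lo..int n] @ [int n + 1..b]"
      using lo upto_split1[of a lo b] upto_split2[of lo "int n" b] by simp
    then have "L (n + 1) @ R (n + 1) = map point [a..lo - 1] @ map point [lo..int n] @ map point [int n + 1..b]"
      using point_window[of "n + 1"] by (simp add: a_def b_def)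
    then have "sublist (map point [lo..int n]) (L (n + 1) @ R (n + 1))" unfolding sublist_def by blast
    moreover have "L (n + 1) @ R (n + 1) \<in> language ts S" using run by (simp add: run_def gap_chain_def)
    ultimately show ?thesis using language_sublist by (simp add: lo_def)
  qed
qed

section \<open>Length estimates for prefixes and insertions\<close>

lemma R_Suc_le: "length (R (Suc k)) \<le> length (R k) + (N + t) +
    (if k \<in> range s then length (R (cut R (inv s k))) + length V + 2 * t else 0)"
proof (cases "k \<in> range s")
  case True
  then obtain j where j: "k = s j" by blast
  then show ?thesis using R_insert[of j] g_length[of j] F(3)[OF fst_\<omega>[of k]] inv_f_f[OF inj_s, of j] by simp
next
  case False
  then obtain u where "length u \<le> t" "R (Suc k) = R k @ u @ fst (\<omega> k)" by (rule R_Suc_free)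
  then show ?thesis using False F(3)[OF fst_\<omega>[of k]] by simp
qed

lemma finite_insertions: "finite {j. k \<le> s j \<and> s j < k'}"
proof (rule finite_subset)
  show "{j. k \<le> s j \<and> s j < k'} \<subseteq> {..k'}"
    using strict_mono_imp_increasing[OF s(1)] by (auto intro: order_trans less_imp_le)
qed simp

text \<open>The bound on the inserted lengths is assumed only for insertions before k', which is all
  that the induction in \<open>R_length_le\<close> can supply.\<close>

lemma R_length_sum:
  assumes "\<And>j. s j < k' \<Longrightarrow> length (R (cut R j)) + length V + 2 * t \<le> D * (lam j + 1)" "k \<le> k'"
  shows "length (R k') \<le> length (R k) + (k' - k) * (N + t) + (\<Sum>j | k \<le> s j \<and> s j < k'. D * (lam j + 1))"
  using assms(2,1)
proof (induction k' rule: dec_induct)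
  case (step k')
  have IH: "length (R k') \<le> length (R k) + (k' - k) * (N + t) + (\<Sum>j | k \<le> s j \<and> s j < k'. D * (lam j + 1))"
    using step by simp
  show ?case
  proof (cases "k' \<in> range s")
    case True
    then obtain i where i: "k' = s i" by blast
    have "{j. k \<le> s j \<and> s j < Suc k'} = insert i {j. k \<le> s j \<and> s j < k'}"
      using step(1) i inj_s by (auto simp: less_Suc_eq inj_eq)
    moreover have "i \<notin> {j. k \<le> s j \<and> s j < k'}" using i by simp
    moreover have "length (R (cut R i)) + length V + 2 * t \<le> D * (lam i + 1)" using step.prems i by simp
    ultimately show ?thesis
      using IH R_Suc_le[of k'] True i step(1) inj_s finite_insertions[of k k'] by (simp add: Suc_diff_le)
  next
    case False
    then have "{j. k \<le> s j \<and> s j < Suc k'} = {j. k \<le> s j \<and> s j < k'}" by (auto simp: less_Suc_eq)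
    then show ?thesis using IH R_Suc_le[of k'] False step(1) by (simp add: Suc_diff_le)
  qed
qed simp

lemma insert_length_aux:
  assumes "length (R (cut R j)) \<le> length W + (N + t + 1) * cut R j"
  shows "length (R (cut R j)) + length V + 2 * t \<le> D * (lam j + 1)"
proof -
  have "(N + t + 1) * cut R j \<le> (N + t + 1) * (2 * c * (lam j + 1))"
    using cut_props(4)[of j] by (intro mult_le_mono2) (simp add: algebra_simps)
  moreover have "length W + length V + 2 * t \<le> (length W + length V + 2 * t) * (lam j + 1)" by simp
  moreover have "D * (lam j + 1) = (length W + length V + 2 * t) * (lam j + 1) + (N + t + 1) * (2 * c * (lam j + 1))"
    unfolding D by (simp add: algebra_simps)
  ultimately show ?thesis using assms by linarith
qed

text \<open>A copied prefix ends before the step that inserts it, so its length is already under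
  control by strong induction, and the insertion costs at most D (lam j + 1). By the schedule, all
  insertions before step k cost at most k letters in total: this is the 1 in N + t + 1.\<close>

lemma R_length_le: "length (R k) \<le> length W + (N + t + 1) * k"
proof (induction k rule: less_induct)
  case (less k)
  have "length (R (cut R j)) + length V + 2 * t \<le> D * (lam j + 1)" if "s j < k" for j
    using less[of "cut R j"] cut_props(1)[of j] that by (intro insert_length_aux) auto
  then have *: "length (R k) \<le> length W + k * (N + t) + (\<Sum>j | s j < k. D * (lam j + 1))"
    using R_length_sum[of k 0] by (simp add: R_0)
  have "(\<Sum>j | s j < k. D * (lam j + 1)) \<le> k"
  proof (cases "{j. s j < k} = {}")
    case False
    have fin: "finite {j. s j < k}" using finite_insertions[of 0 k] by simp
    define i where "i = Max {j. s j < k}"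
    have "s i < k" using Max_in[OF fin False] by (simp add: i_def)
    have "(\<Sum>j | s j < k. D * (lam j + 1)) \<le> (\<Sum>j\<le>i. D * (lam j + 1))"
      using Max_ge[OF fin] by (intro sum_mono2) (auto simp: i_def)
    then show ?thesis using s(3)[of i] \<open>s i < k\<close> by linarith
  qed (simp only: sum.empty)
  then show ?case using * by (simp add: algebra_simps)
qed

lemma insert_length: "length (R (cut R j)) + length V + 2 * t \<le> D * (lam j + 1)"
  by (intro insert_length_aux R_length_le)

lemma l_ge: "lam j \<le> l j"
  unfolding l_def by (rule cut_props)

text \<open>The previous admissible cut \<kappa>' gives a prefix shorter than lam j. From \<kappa>'
  to the actual cut, only step \<kappa>' + c can be an insertion, the one of some index i. It costs
  at most D (lam i + 1), and the square of lam i + 1 is at most \<kappa>' + c, hence at most lam j +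
  c.\<close>

lemma l_le: "real (l j) \<le> real (lam j) + real D + real D * sqrt (real (lam j) + real c)"
proof (cases "cut R j = c")
  case True
  have "l j \<le> length W + (N + t + 1) * c" using R_length_le[of c] True by (simp add: l_def)
  also have "\<dots> \<le> D" by (simp add: D)
  finally have "real (l j) \<le> real D" by simp
  moreover have "0 \<le> real D * sqrt (real (lam j) + real c)" by simp
  ultimately show ?thesis by linarith
next
  case False
  define \<kappa> where "\<kappa> = cut R j"
  have \<kappa>: "c < \<kappa>" "\<kappa> mod (2 * c) = c" using False cut_ge[of j] cut_props(2)[of j] by (auto simp: \<kappa>_def)
  define a where "a = \<kappa> div (2 * c)"
  have a: "\<kappa> = 2 * c * a + c" using \<kappa>(2) by (metis a_def mult_div_mod_eq)
  then obtain a' where a': "a = Suc a'" using \<kappa>(1) by (cases a) auto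
  define \<kappa>' where "\<kappa>' = 2 * c * a' + c"
  have k': "\<kappa> = \<kappa>' + 2 * c" by (simp add: \<kappa>'_def a a' algebra_simps)
  have "\<not> lam j \<le> length (R \<kappa>')"
  proof
    assume "lam j \<le> length (R \<kappa>')"
    then have "\<kappa> \<le> \<kappa>'" unfolding \<kappa>_def using c_pos by (intro cut_least) (auto simp: \<kappa>'_def)
    then show False using k' c_pos by simp
  qed
  then have lt: "length (R \<kappa>') < lam j" by simp
  define J where "J = {i. \<kappa>' \<le> s i \<and> s i < \<kappa>}"
  have J: "i = i' \<and> s i = \<kappa>' + c" if "i \<in> J" "i' \<in> J" for i i'
  proof -
    have "s i = \<kappa>' + c" if "i \<in> J" for i
    proof -
      obtain b where b: "s i = 2 * c * b" using s(2)[of i] by (auto elim: dvdE)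
      define u where "u = 2 * c"
      have u: "c < u" using c_pos by (simp add: u_def)
      have "u * a' + c \<le> u * b" "u * b < u * a' + u + c"
        using that k' unfolding J_def b[folded u_def, symmetric] by (auto simp: \<kappa>'_def u_def)
      moreover have "u * (a' + 2) = u * a' + u + u" by simp
      ultimately have "u * a' < u * b" "u * b < u * (a' + 2)" using u c_pos by linarith+
      then have "a' < b" "b < a' + 2" by (simp_all only: mult_less_cancel1)
      then have "b = Suc a'" by simp
      then show ?thesis by (simp add: b \<kappa>'_def)
    qed
    then have "s i = \<kappa>' + c" "s i' = \<kappa>' + c" using that by auto
    then show ?thesis using injD[OF inj_s, of i i'] by simp
  qed
  have sum_le: "real (\<Sum>i\<in>J. D * (lam i + 1)) \<le> real D * sqrt (real (lam j) + real c)"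
  proof (cases "J = {}")
    case False
    then obtain i where i: "i \<in> J" by blast
    then have Ji: "J = {i}" "s i = \<kappa>' + c" using J by auto
    have "(real (lam i) + 1)\<^sup>2 \<le> real (lam j) + real c"
    proof -
      have "(lam i + 1)\<^sup>2 \<le> lam j + c" using s(4)[of i] Ji(2) lt R_length_ge'[of \<kappa>'] by linarith
      then have "real ((lam i + 1)\<^sup>2) \<le> real (lam j + c)" by (rule of_nat_mono)
      then show ?thesis by (simp add: add.commute)
    qed
    then have "real (lam i) + 1 \<le> sqrt (real (lam j) + real c)" by (rule real_le_rsqrt)
    then have "real D * (real (lam i) + 1) \<le> real D * sqrt (real (lam j) + real c)" by (rule mult_left_mono) simp
    then show ?thesis using Ji by (simp add: algebra_simps)
  qed simp
  have "l j \<le> length (R \<kappa>') + 2 * c * (N + t) + (\<Sum>i\<in>J. D * (lam i + 1))"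
    using R_length_sum[OF insert_length, of \<kappa>' \<kappa>] k' by (simp add: l_def \<kappa>_def J_def)
  moreover have "2 * c * (N + t) \<le> D" by (simp add: D algebra_simps)
  ultimately have "l j \<le> lam j + D + (\<Sum>i\<in>J. D * (lam i + 1))" using lt by linarith
  then have "real (l j) \<le> real (lam j + D + (\<Sum>i\<in>J. D * (lam i + 1)))" by (rule of_nat_mono)
  then show ?thesis using sum_le by simp
qed

lemma p_ge: "s j \<le> p j"
  using R_length_ge'[of "s j"] by (simp add: p_def)

lemma p_le: "p j \<le> (length W + N + 2 * t + 1) * s j"
proof -
  have "1 \<le> s j" using s(5)[of j] by simp
  then have "(length W + t) * 1 \<le> (length W + t) * s j" by (rule mult_le_mono2)
  then have "length W + t + (N + t + 1) * s j \<le> (length W + t) * s j + (N + t + 1) * s j"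
    by (intro add_right_mono) simp
  moreover have "p j \<le> length W + t + (N + t + 1) * s j"
    using add_mono[OF R_length_le[of "s j"] g_length(1)[of j]] by (simp add: p_def ac_simps)
  ultimately have "p j \<le> (length W + t) * s j + (N + t + 1) * s j" by (rule order_trans[rotated])
  also have "\<dots> = (length W + N + 2 * t + 1) * s j" by (simp add: algebra_simps)
  finally show ?thesis .
qed

end

section \<open>Coding and dimension\<close>

text \<open>Passage from steps to letters: a bounded factor inside the logarithm and an error of
  order sqrt lam in the denominator leave the limit unchanged. The limit may be infinite, hence the
  limit laws in \<open>ereal\<close>.\<close>

lemma tendsto_ln_ratio:
  fixes \<sigma> \<pi> lam l :: "nat \<Rightarrow> nat" and v :: ereal and K D c :: nat
  assumes lim: "(\<lambda>j. ereal (ln (real (\<sigma> j)) / real (lam j))) \<longlonglongrightarrow> v"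
    and \<pi>: "\<And>j. 1 \<le> \<sigma> j" "\<And>j. \<sigma> j \<le> \<pi> j" "\<And>j. \<pi> j \<le> K * \<sigma> j"
    and l: "\<And>j. lam j \<le> l j" "\<And>j. real (l j) \<le> real (lam j) + real D + real D * sqrt (real (lam j) + real c)"
    and lam: "filterlim lam at_top sequentially"
  shows "(\<lambda>j. ereal (ln (real (\<pi> j)) / real (l j))) \<longlonglongrightarrow> v"
proof -
  have lam': "filterlim (\<lambda>j. real (lam j)) at_top sequentially"
    using filterlim_compose[OF filterlim_real_sequentially lam] .
  have ev: "\<forall>\<^sub>F j in sequentially. 1 \<le> lam j" using lam by (simp add: filterlim_at_top)
  have K: "1 \<le> K" using \<pi>(1)[of 0] \<pi>(2,3)[of 0] by (cases K) auto
  have 1: "(\<lambda>j. real (lam j) / real (l j)) \<longlonglongrightarrow> 1"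
  proof (rule real_tendsto_sandwich[OF _ _ _ tendsto_const])
    have "((\<lambda>y::real. y / (y + real D + real D * sqrt (y + real c))) \<longlongrightarrow> 1) at_top" by real_asymp
    then show "(\<lambda>j. real (lam j) / (real (lam j) + real D + real D * sqrt (real (lam j) + real c))) \<longlonglongrightarrow> 1"
      using lam' by (rule filterlim_compose)
    show "\<forall>\<^sub>F j in sequentially. real (lam j) / (real (lam j) + real D + real D * sqrt (real (lam j) + real c)) \<le> real (lam j) / real (l j)"
      using ev
    proof eventually_elim
      case (elim j)
      then have "0 < real (l j)" using l(1)[of j] by simp
      then show ?case using l(2)[of j] by (intro divide_left_mono mult_pos_pos) auto
    qed
    show "\<forall>\<^sub>F j in sequentially. real (lam j) / real (l j) \<le> 1"
      using ev
    proof eventually_elim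
      case (elim j)
      then show ?case using l(1)[of j] by simp
    qed
  qed
  have 2: "(\<lambda>j. (ln (real (\<pi> j)) - ln (real (\<sigma> j))) / real (l j)) \<longlonglongrightarrow> 0"
  proof (rule real_tendsto_sandwich[OF _ _ tendsto_const])
    have "((\<lambda>y::real. ln (real K) / y) \<longlongrightarrow> 0) at_top" by real_asymp
    then show "(\<lambda>j. ln (real K) / real (lam j)) \<longlonglongrightarrow> 0" using lam' by (rule filterlim_compose)
    show "\<forall>\<^sub>F j in sequentially. 0 \<le> (ln (real (\<pi> j)) - ln (real (\<sigma> j))) / real (l j)"
    proof (intro always_eventually allI divide_nonneg_nonneg)
      fix j
      have "ln (real (\<sigma> j)) \<le> ln (real (\<pi> j))" using \<pi>(1,2)[of j] by (intro ln_mono) auto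
      then show "0 \<le> ln (real (\<pi> j)) - ln (real (\<sigma> j))" by simp
    qed simp
    show "\<forall>\<^sub>F j in sequentially. (ln (real (\<pi> j)) - ln (real (\<sigma> j))) / real (l j) \<le> ln (real K) / real (lam j)"
      using ev
    proof eventually_elim
      case (elim j)
      have \<sigma>pos: "0 < real (\<sigma> j)" and \<pi>pos: "0 < real (\<pi> j)" using \<pi>(1,2)[of j] by auto
      have "real (\<pi> j) \<le> real (K * \<sigma> j)" using \<pi>(3)[of j] by (rule of_nat_mono)
      then have "ln (real (\<pi> j)) \<le> ln (real K * real (\<sigma> j))" using \<pi>pos by (intro ln_mono) auto
      also have "\<dots> = ln (real K) + ln (real (\<sigma> j))" using \<sigma>pos K by (simp add: ln_mult)
      finally have "(ln (real (\<pi> j)) - ln (real (\<sigma> j))) / real (l j) \<le> ln (real K) / real (l j)"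
        by (intro divide_right_mono) auto
      also have "\<dots> \<le> ln (real K) / real (lam j)" using l(1)[of j] elim K by (intro divide_left_mono mult_pos_pos) auto
      finally show ?case .
    qed
  qed
  have "(\<lambda>j. ereal (ln (real (\<sigma> j)) / real (lam j)) * ereal (real (lam j) / real (l j))
      + ereal ((ln (real (\<pi> j)) - ln (real (\<sigma> j))) / real (l j))) \<longlonglongrightarrow> v * ereal 1 + ereal 0"
    using lim tendsto_ereal[OF 1] tendsto_ereal[OF 2]
    by (intro tendsto_add_ereal_general1 tendsto_mult_ereal) auto
  moreover have "\<forall>\<^sub>F j in sequentially. ereal (ln (real (\<sigma> j)) / real (lam j)) * ereal (real (lam j) / real (l j))
      + ereal ((ln (real (\<pi> j)) - ln (real (\<sigma> j))) / real (l j)) = ereal (ln (real (\<pi> j)) / real (l j))"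
    using ev
  proof eventually_elim
    case (elim j)
    then have "0 < real (lam j)" by simp
    then show ?case by (simp add: diff_divide_distrib)
  qed
  ultimately have "(\<lambda>j. ereal (ln (real (\<pi> j)) / real (l j))) \<longlonglongrightarrow> v * ereal 1 + ereal 0"
    by (rule Lim_transform_eventually)
  then show ?thesis by (simp flip: one_ereal_def zero_ereal_def)
qed

section \<open>Recurrence times of the point of a run\<close>

context insertion_run
begin

lemma point_X:
  assumes "1 \<le> i"
  shows "point (i + int q) = X (nat (i - 1) + q)"
proof -
  have "nat (i + int q - 1) = nat (i - 1) + q" using assms by linarith
  then show ?thesis using assms by (simp add: point_def)
qed

lemma tau_insertion: "tau ts (cyl S (l j) point) point \<le> enat (p j)"
proof (rule tau_le[OF sub point_in])
  show "1 \<le> p j" using p_ge[of j] s(5)[of j] by simp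
  fix i assume i: "i \<in> {1..int (l j)}"
  have "point (i + int (p j)) = X (p j + nat (i - 1))" using i by (simp add: point_X add.commute)
  also have "\<dots> = X (nat (i - 1))" using i by (intro copy) auto
  also have "\<dots> = point i" using i by (simp add: point_def)
  finally show "point (i + int (p j)) = point i" .
qed

text \<open>By \<open>occurrence\<close>, a match of length l j + t + |V| starts no earlier than
  some copy i with l i > l j. Prefix lengths are monotone, so i > j.\<close>

lemma tau_next_insertion: "enat (p (Suc j)) \<le> tau ts (cyl S (l j + (t + length V)) point) point"
proof (rule ccontr)
  assume "\<not> ?thesis"
  then obtain q where q: "tau ts (cyl S (l j + (t + length V)) point) point = enat q" "q < p (Suc j)"
    by (cases "tau ts (cyl S (l j + (t + length V)) point) point") auto
  note w = tau_witness[OF q(1)]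
  have "\<exists>i. p i \<le> q \<and> q + (l j + (t + length V)) < p i + l i + (t + length V)"
  proof (rule occurrence[OF w(1)])
    fix r assume r: "r < l j + (t + length V)"
    then have "point (int (Suc r) + int q) = point (int (Suc r))" by (intro w(2)) auto
    then show "X (q + r) = X r" by (simp add: point_def nat_add_distrib add.commute)
  qed (use W_l[of j] in simp)
  then obtain i where i: "p i \<le> q" "q + l j < p i + l i" by auto
  then have "p i < p (Suc j)" using q(2) by simp
  then have "i < Suc j" using strict_mono_less[OF strict_mono_p] by blast
  then have "l i \<le> l j" by (intro l_mono) simp
  then show False using i by simp
qed

lemma point_in_Rset:
  assumes "(\<lambda>j. ereal (ln (real (s j)) / real (lam j))) \<longlonglongrightarrow> a"
    and "(\<lambda>j. ereal (ln (real (s (Suc j))) / real (lam j))) \<longlonglongrightarrow> b"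
  shows "point \<in> Rset ts S a b"
proof (rule Rset_memI[OF sub point_in])
  have s1: "1 \<le> s j" for j using s(5)[of j] by simp
  then show "1 \<le> p j" for j using p_ge[of j] by (rule order_trans)
  have lam_lim: "filterlim lam at_top sequentially"
    by (rule filterlim_at_top_mono[OF filterlim_ident]) (use lam in auto)
  then show "filterlim l at_top sequentially"
    by (rule filterlim_at_top_mono) (use l_ge in auto)
  show "tau ts (cyl S (l j) point) point \<le> enat (p j)" for j by (rule tau_insertion)
  show "enat (p (Suc j)) \<le> tau ts (cyl S (l j + (t + length V)) point) point" for j by (rule tau_next_insertion)
  show "1 \<le> t + length V" using V(2) N(1) by linarith
  show "(\<lambda>j. ereal (ln (real (p j)) / real (l j))) \<longlonglongrightarrow> a"
    using assms(1) s1 p_ge p_le l_ge l_le lam_lim by (rule tendsto_ln_ratio)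
  show "(\<lambda>j. ereal (ln (real (p (Suc j))) / real (l j))) \<longlonglongrightarrow> b"
    using assms(2) s1 p_ge p_le l_ge l_le lam_lim by (rule tendsto_ln_ratio)
qed

end

section \<open>Reading the inputs back and counting them\<close>

context insertion
begin

text \<open>Total length of the gaps in step k, expressed by lengths of R because a run does not
  record its gap words. In a run the subtractions are exact, by the lemma
  \<open>gap_right\<close>.\<close>

definition gap_right :: "(nat \<Rightarrow> nat list) \<Rightarrow> nat \<Rightarrow> nat" where
  "gap_right R k = length (R (Suc k)) - length (R k) - N
     - (if k \<in> range s then length (R (cut R (inv s k))) + length V else 0)"

definition gap_left :: "(nat \<Rightarrow> nat list) \<Rightarrow> nat \<Rightarrow> nat" where
  "gap_left L k = (if ts then length (L (Suc k)) - length (L k) - N else 0)"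

end

context insertion_run
begin

lemma gap_right: "gap_right R k \<le> 3 * t"
  "length (R (Suc k)) = length (R k) + N + (if k \<in> range s then length (R (cut R (inv s k))) + length V else 0) + gap_right R k"
proof -
  have "step_right \<omega> R k (R (Suc k))" using run by (simp add: run_def)
  then obtain u1 u2 u3 where u: "length u1 \<le> t" "length u2 \<le> t" "length u3 \<le> t"
    "R (Suc k) = R k @ (if k \<in> range s then u1 @ R (cut R (inv s k)) @ u2 @ V else []) @ u3 @ fst (\<omega> k)"
    unfolding step_right_def by blast
  have "length (R (Suc k)) = length (R k) + N + (if k \<in> range s then length (R (cut R (inv s k))) + length V else 0)
      + (if k \<in> range s then length u1 + length u2 + length u3 else length u3)"
    using u(4) F(3)[OF fst_\<omega>[of k]] by simp
  then show "gap_right R k \<le> 3 * t"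
    "length (R (Suc k)) = length (R k) + N + (if k \<in> range s then length (R (cut R (inv s k))) + length V else 0) + gap_right R k"
    using u(1,2,3) by (auto simp: gap_right_def)
qed

lemma gap_left: "gap_left L k \<le> (if ts then t else 0)"
  "length (L (Suc k)) = length (L k) + (if ts then N else 0) + gap_left L k"
proof -
  have "gap_left L k \<le> (if ts then t else 0) \<and> length (L (Suc k)) = length (L k) + (if ts then N else 0) + gap_left L k"
  proof (cases ts)
    case True
    obtain u where "length u \<le> t" "L (Suc k) = snd (\<omega> k) @ u @ L k" using L_Suc(1)[OF True] by blast
    then show ?thesis using F(3)[OF snd_\<omega>(1)[OF True, of k]] True unfolding gap_left_def by simp
  next
    case False
    then show ?thesis using L_Suc(2)[OF False] unfolding gap_left_def by simp
  qed
  then show "gap_left L k \<le> (if ts then t else 0)"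
    "length (L (Suc k)) = length (L k) + (if ts then N else 0) + gap_left L k" by auto
qed

lemma fst_\<omega>_eq: "fst (\<omega> k) = drop (length (R (Suc k)) - N) (R (Suc k))"
proof -
  have "step_right \<omega> R k (R (Suc k))" using run by (simp add: run_def)
  then obtain y where "R (Suc k) = y @ fst (\<omega> k)" unfolding step_right_def by (metis append_assoc)
  then show ?thesis using F(3)[OF fst_\<omega>[of k]] by simp
qed

lemma snd_\<omega>_eq: "snd (\<omega> k) = (if ts then take N (L (Suc k)) else [])"
proof (cases ts)
  case True
  obtain u where "L (Suc k) = snd (\<omega> k) @ u @ L k" using L_Suc(1)[OF True] by blast
  then show ?thesis using F(3)[OF snd_\<omega>(1)[OF True, of k]] True by simp
qed (simp add: snd_\<omega>)

lemma agree_words: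
  assumes "agree n point z"
  shows "length (R k) < n \<Longrightarrow> R k = map z [1..int (length (R k))]"
    "length (L k) < n \<Longrightarrow> L k = map z [1 - int (length (L k))..0]"
proof -
  have eq: "map point [a..b] = map z [a..b]" if "- int n < a" "b < int n" for a b
    using assms that by (intro map_cong) (auto simp: agree_def)
  show "R k = map z [1..int (length (R k))]" if "length (R k) < n"
    using point_right[of k] eq[of 1 "int (length (R k))"] that by simp
  show "L k = map z [1 - int (length (L k))..0]" if "length (L k) < n"
    using point_left[of k] eq[of "1 - int (length (L k))" 0] that by simp
qed

end

context insertion
begin

text \<open>The words \<open>R i\<close>, \<open>L i\<close> are windows of \<open>z\<close>, so only their lengths remain to be determined,
  and these depend on the inputs only through the lengths of the gaps.\<close>

lemma decode:
  assumes 1: "insertion_run ts m S G F V W t N c D lam s \<omega> R L"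
    and 2: "insertion_run ts m S G F V W t N c D lam s \<omega>' R' L'"
    and z: "\<And>i. i \<le> k \<Longrightarrow> R i = map z [1..int (length (R i))]" "\<And>i. i \<le> k \<Longrightarrow> R' i = map z [1..int (length (R' i))]"
      "\<And>i. i \<le> k \<Longrightarrow> L i = map z [1 - int (length (L i))..0]" "\<And>i. i \<le> k \<Longrightarrow> L' i = map z [1 - int (length (L' i))..0]"
    and g: "\<And>i. i < k \<Longrightarrow> gap_right R i = gap_right R' i" "\<And>i. i < k \<Longrightarrow> gap_left L i = gap_left L' i"
    and i: "i < k"
  shows "\<omega> i = \<omega>' i"
proof -
  interpret A: insertion_run ts m S G F V W t N c D lam s \<omega> R L by (rule 1)
  interpret B: insertion_run ts m S G F V W t N c D lam s \<omega>' R' L' by (rule 2)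
  have eq: "R i = R' i \<and> L i = L' i" if "i \<le> k" for i
    using that
  proof (induction i rule: less_induct)
    case (less i)
    have "length (R i) = length (R' i) \<and> length (L i) = length (L' i)"
    proof (cases i)
      case 0
      then show ?thesis using A.run B.run by (simp add: run_def)
    next
      case (Suc i')
      have IH: "R j = R' j" "L j = L' j" if "j \<le> i'" for j using less.IH[of j] less.prems that Suc by auto
      have "(if i' \<in> range s then length (R (cut R (inv s i'))) + length V else 0)
          = (if i' \<in> range s then length (R' (cut R' (inv s i'))) + length V else 0)"
      proof (cases "i' \<in> range s")
        case True
        then have inv: "s (inv s i') = i'" by (rule f_inv_into_f)
        have "cut R (inv s i') = cut R' (inv s i')" using IH inv by (intro cut_cong) simp
        moreover have "cut R' (inv s i') \<le> i'" using cut_le[of R' "inv s i'"] inv by simp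
        ultimately show ?thesis using IH by simp
      qed simp
      then show ?thesis
        using A.gap_right(2)[of i'] B.gap_right(2)[of i'] A.gap_left(2)[of i'] B.gap_left(2)[of i']
          IH[of i'] g[of i'] less.prems Suc by simp
    qed
    then show ?case using z[OF less.prems] by metis
  qed
  show ?thesis
    using eq[of "Suc i"] i A.fst_\<omega>_eq[of i] B.fst_\<omega>_eq[of i] A.snd_\<omega>_eq[of i] B.snd_\<omega>_eq[of i]
    by (intro prod_eqI) auto
qed

definition runs :: "(nat \<Rightarrow> nat list \<times> nat list) \<Rightarrow> (nat \<Rightarrow> nat list) \<times> (nat \<Rightarrow> nat list)" where
  "runs \<omega> = (SOME RL. run \<omega> (fst RL) (snd RL))"

definition coding :: "(nat \<Rightarrow> nat list \<times> nat list) \<Rightarrow> int \<Rightarrow> nat" where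
  "coding \<omega> = insertion_run.point ts (fst (runs \<omega>)) (snd (runs \<omega>))"

lemma insertion_run_runs:
  assumes "range \<omega> \<subseteq> inputs"
  shows "insertion_run ts m S G F V W t N c D lam s \<omega> (fst (runs \<omega>)) (snd (runs \<omega>))"
proof -
  obtain R L where "run \<omega> (fst (R, L)) (snd (R, L))" using ex_run[OF assms] by auto
  then have "run \<omega> (fst (runs \<omega>)) (snd (runs \<omega>))" unfolding runs_def by (rule someI)
  then show ?thesis using assms by unfold_locales
qed

text \<open>All R i and L i with i \<le> k fit into the coordinates on which the point agrees with
  z, so \<open>decode\<close> applies: the first k inputs are a function of the list of gap lengths,
  and the bound is the number of such lists.\<close>

lemma card_compatible:
  assumes n: "length W + (N + t + 1) * k < n"
  shows "card {map \<omega> [0..<k] | \<omega>. range \<omega> \<subseteq> inputs \<and> agree n (coding \<omega>) z}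
    \<le> ((3 * t + 1) * (if ts then t + 1 else 1)) ^ k"
proof -
  define A where "A = {\<omega>. range \<omega> \<subseteq> inputs \<and> agree n (coding \<omega>) z}"
  define f where "f \<omega> = map \<omega> [0..<k]" for \<omega> :: "nat \<Rightarrow> nat list \<times> nat list"
  define g where "g \<omega> = map (\<lambda>i. (gap_right (fst (runs \<omega>)) i, gap_left (snd (runs \<omega>)) i)) [0..<k]" for \<omega>
  define E where "E = {..3 * t} \<times> {..(if ts then t else 0)}"
  define C where "C = {xs. set xs \<subseteq> E \<and> length xs = k}"
  have finC: "finite C" unfolding C_def E_def by (intro finite_lists_length_eq) auto
  have gC: "g \<omega> \<in> C" if "\<omega> \<in> A" for \<omega>
  proof -
    interpret insertion_run ts m S G F V W t N c D lam s \<omega> "fst (runs \<omega>)" "snd (runs \<omega>)"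
      using that by (intro insertion_run_runs) (simp add: A_def)
    show ?thesis using gap_right(1) gap_left(1) by (auto simp: C_def g_def E_def)
  qed
  have windows: "fst (runs \<omega>) i = map z [1..int (length (fst (runs \<omega>) i))] \<and>
      snd (runs \<omega>) i = map z [1 - int (length (snd (runs \<omega>) i))..0]" if "\<omega> \<in> A" "i \<le> k" for \<omega> i
  proof -
    interpret insertion_run ts m S G F V W t N c D lam s \<omega> "fst (runs \<omega>)" "snd (runs \<omega>)"
      using that by (intro insertion_run_runs) (simp add: A_def)
    have ag: "agree n point z" using that by (simp add: A_def coding_def)
    have "(N + t + 1) * i \<le> (N + t + 1) * k" using that(2) by (rule mult_le_mono2)
    moreover have "(N + t) * i \<le> (N + t + 1) * i" by (intro mult_le_mono1) simp
    ultimately have "length (fst (runs \<omega>) i) < n" "length (snd (runs \<omega>) i) < n"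
      using R_length_le[of i] L_length_le[of i] n by linarith+
    then show ?thesis using agree_words[OF ag] by blast
  qed
  have fg: "f \<omega> = f \<omega>'" if "\<omega> \<in> A" "\<omega>' \<in> A" "g \<omega> = g \<omega>'" for \<omega> \<omega>'
  proof -
    have "\<omega> i = \<omega>' i" if "i < k" for i
    proof (rule decode)
      show "insertion_run ts m S G F V W t N c D lam s \<omega> (fst (runs \<omega>)) (snd (runs \<omega>))"
        using \<open>\<omega> \<in> A\<close> by (intro insertion_run_runs) (simp add: A_def)
      show "insertion_run ts m S G F V W t N c D lam s \<omega>' (fst (runs \<omega>')) (snd (runs \<omega>'))"
        using \<open>\<omega>' \<in> A\<close> by (intro insertion_run_runs) (simp add: A_def)
      show "gap_right (fst (runs \<omega>)) i = gap_right (fst (runs \<omega>')) i"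
        "gap_left (snd (runs \<omega>)) i = gap_left (snd (runs \<omega>')) i" if "i < k" for i
        using \<open>g \<omega> = g \<omega>'\<close> that by (auto simp: g_def)
    qed (use windows[OF \<open>\<omega> \<in> A\<close>] windows[OF \<open>\<omega>' \<in> A\<close>] \<open>i < k\<close> in blast)+
    then show ?thesis by (simp add: f_def)
  qed
  have "f ` A \<subseteq> (\<lambda>x. f (SOME \<omega>. \<omega> \<in> A \<and> g \<omega> = x)) ` C"
  proof
    fix y assume "y \<in> f ` A"
    then obtain \<omega> where \<omega>: "\<omega> \<in> A" "y = f \<omega>" by blast
    define \<omega>' where "\<omega>' = (SOME \<omega>'. \<omega>' \<in> A \<and> g \<omega>' = g \<omega>)"
    have "\<omega>' \<in> A \<and> g \<omega>' = g \<omega>" unfolding \<omega>'_def by (rule someI[of _ \<omega>]) (simp add: \<omega>)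
    then have "y = f \<omega>'" using fg \<omega> by metis
    then show "y \<in> (\<lambda>x. f (SOME \<omega>. \<omega> \<in> A \<and> g \<omega> = x)) ` C"
      using gC[OF \<omega>(1)] unfolding \<omega>'_def by (rule image_eqI)
  qed
  then have "card (f ` A) \<le> card C" using finC by (rule surj_card_le[rotated])
  also have "card C = card E ^ k" unfolding C_def by (rule card_lists_length_eq) (simp add: E_def)
  also have "card E = (3 * t + 1) * (if ts then t + 1 else 1)" by (simp add: E_def card_cartesian_product)
  finally show ?thesis by (simp add: A_def f_def setcompr_eq_image)
qed

text \<open>A ball of radius exp (-n) with n about Q k is compatible with at most E^k input words
  out of (card inputs)^k, and \<open>E * exp (\<theta> * Q)\<close> is at most
  \<open>card inputs\<close>; so its mass is O(exp (-\<theta> n)). In the two-sided case there are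
  (card F)^2 inputs, and the t + 1 gap lengths on the left are paid for by the second factor 3t +
  1.\<close>

lemma coding_hmeasure:
  fixes h :: real
  assumes h: "0 < h" and F_large: "(3 * real t + 1) * exp (h * (real N + real t + 1)) \<le> real (card F)"
  shows "hmeasure ((if ts then 2 else 1) * h) (coding ` {\<omega>. range \<omega> \<subseteq> inputs}) > 0"
proof -
  define \<theta> where "\<theta> = (if ts then 2 else 1) * h"
  define Q where "Q = N + t + 1"
  define E where "E = (3 * t + 1) * (if ts then t + 1 else 1)"
  \<comment> \<open>Pays for the letters among the first n that the product Q k does not account
    for; see \<open>kn\<close>.\<close>
  define B where "B = exp (\<theta> * real (length W + 1 + Q))"
  have \<theta>: "\<theta> > 0" using h by (simp add: \<theta>_def)
  have fin: "finite inputs" "inputs \<noteq> {}" using F by (auto simp: inputs_def)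
  have Fl: "(3 * real t + 1) * exp (h * real Q) \<le> real (card F)" using F_large by (simp add: Q_def add.commute add.left_commute)
  have card_inputs: "real E * exp (\<theta> * real Q) \<le> real (card inputs)"
  proof (cases ts)
    case True
    have "real E * exp (\<theta> * real Q) = ((3 * real t + 1) * exp (h * real Q)) * ((real t + 1) * exp (h * real Q))"
      unfolding E_def \<theta>_def using True by (simp add: algebra_simps flip: exp_add)
    also have "\<dots> \<le> ((3 * real t + 1) * exp (h * real Q)) * ((3 * real t + 1) * exp (h * real Q))"
      by (intro mult_left_mono mult_right_mono) auto
    also have "\<dots> \<le> real (card F) * real (card F)" by (intro mult_mono Fl) auto
    also have "\<dots> = real (card inputs)" unfolding inputs_def using True by (simp add: card_cartesian_product)
    finally show ?thesis .
  next
    case False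
    then show ?thesis using Fl unfolding E_def \<theta>_def inputs_def by (simp add: card_cartesian_product add.commute)
  qed
  have "0 < hmeasure \<theta> (coding ` {\<omega>. range \<omega> \<subseteq> inputs})"
  proof (rule hmeasure_pos[OF fin \<theta>])
    fix n z
    \<comment> \<open>The largest k to which \<open>card_compatible\<close> applies; for short n it
      is 0, and the trivial count 1 is used.\<close>
    define k where "k = (n - 1 - length W) div Q"
    have Q: "0 < Q" by (simp add: Q_def)
    have kn: "n \<le> length W + 1 + Q + Q * k"
      using dividend_less_times_div[OF Q, of "n - 1 - length W"] by (simp add: k_def)
    have card: "card {map \<omega> [0..<k] | \<omega>. range \<omega> \<subseteq> inputs \<and> agree n (coding \<omega>) z} \<le> E ^ k" (is "card ?M \<le> _")
    proof (cases "length W + Q * k < n")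
      case True
      then show ?thesis using card_compatible[of k n z] by (simp add: Q_def E_def)
    next
      case False
      have "Q * k \<le> n - 1 - length W" by (simp add: k_def)
      then have "k = 0" using False Q by (cases "n - 1 - length W = 0") auto
      then have "card ?M \<le> card {[] :: (nat list \<times> nat list) list}" by (intro card_mono) auto
      then show ?thesis using \<open>k = 0\<close> by simp
    qed
    have "real (E ^ k) * exp (\<theta> * real Q * real k) = (real E * exp (\<theta> * real Q)) ^ k"
      by (simp add: power_mult_distrib mult.commute flip: exp_of_nat_mult)
    also have "\<dots> \<le> real (card inputs) ^ k" by (intro power_mono card_inputs) simp
    finally have Ek: "real (E ^ k) * exp (\<theta> * real Q * real k) \<le> real (card inputs) ^ k" .
    have "1 \<le> B * exp (- (\<theta> * real n)) * exp (\<theta> * real Q * real k)"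
    proof -
      have "\<theta> * real n \<le> \<theta> * real (length W + 1 + Q + Q * k)"
        using \<theta> kn by (intro mult_left_mono of_nat_mono) auto
      then have "0 \<le> \<theta> * real (length W + 1 + Q) + - (\<theta> * real n) + \<theta> * real Q * real k"
        by (simp add: algebra_simps)
      then show ?thesis unfolding B_def by (simp flip: exp_add)
    qed
    then have "real (E ^ k) * 1 \<le> real (E ^ k) * (B * exp (- (\<theta> * real n)) * exp (\<theta> * real Q * real k))"
      by (rule mult_left_mono) simp
    also have "\<dots> = B * exp (- (\<theta> * real n)) * (real (E ^ k) * exp (\<theta> * real Q * real k))" by (simp only: ac_simps)
    also have "\<dots> \<le> B * exp (- (\<theta> * real n)) * real (card inputs) ^ k"
      using Ek by (intro mult_left_mono) (auto simp: B_def)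
    finally have "real (E ^ k) \<le> B * exp (- (\<theta> * real n)) * real (card inputs) ^ k" by simp
    moreover have "real (card ?M) \<le> real (E ^ k)" using card by (rule of_nat_mono)
    ultimately show "\<exists>k. real (card {map \<omega> [0..<k] | \<omega>. range \<omega> \<subseteq> inputs \<and> agree n (coding \<omega>) z})
        \<le> B * exp (- (\<theta> * real n)) * real (card inputs) ^ k"
      by (intro exI[of _ k]) (rule order_trans)
  qed
  then show ?thesis by (simp add: \<theta>_def)
qed

end

section \<open>Choice of the parameters and comparison of the dimensions\<close>

lemma hmeasure_Rset_pos:
  fixes h :: real and a b :: ereal
  assumes sub: "subshift ts m S" and m: "2 \<le> m"
    and incl: "Cp \<subseteq> language ts S" "G \<subseteq> language ts S" "Cs \<subseteq> language ts S"
    and dec: "decomposes (language ts S) Cp G Cs" and Nil: "[] \<in> G" and spec: "W'_spec ts S G"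
    and gap: "growth (Cp \<union> Cs) < htop ts S"
    and ab: "0 \<le> a" "a \<le> b" and h: "0 < h" "ereal h < htop ts S"
  shows "hmeasure ((if ts then 2 else 1) * h) (Rset ts S a b) > 0"
proof -
  \<comment> \<open>\<open>core_growth\<close> needs a rate above the growth of Cp \<union> Cs, and
    \<open>select_words\<close> needs one strictly above h to absorb gaps and avoided words.\<close>
  have "max (ereal h) (growth (Cp \<union> Cs)) < htop ts S" using gap h by simp
  then obtain h4 where h4: "max (ereal h) (growth (Cp \<union> Cs)) < ereal h4" "ereal h4 < htop ts S"
    using ereal_dense2 by blast
  obtain t where join: "\<And>u v. gap_chain ts S G t u \<Longrightarrow> gap_chain ts S G t v \<Longrightarrow>
      \<exists>w. length w \<le> t \<and> gap_chain ts S G t (u @ w @ v)"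
    using W'_spec_gap_chain[OF spec sub] by blast
  have gen: "gap_chain ts S G t g" if "g \<in> G" for g using gap_chain_gen[OF sub incl(2) Nil that] .
  have freq: "\<exists>\<^sub>F n in sequentially. exp (h4 * real n) \<le> real (card (words_len G n))"
    using h4 by (intro core_growth[OF sub dec incl]) auto
  have finG: "finite (words_len G n)" for n
    using incl(2) by (intro finite_subset[OF _ finite_words_len[OF sub, of n]]) (auto simp: words_len_def)
  have "h < h4" "0 \<le> h" "1 \<le> m" using h4 h m by auto
  obtain N F V W where sel: "1 \<le> N" "t \<le> N" "F \<subseteq> G" "finite F" "F \<noteq> {}" "\<And>f. f \<in> F \<Longrightarrow> length f = N"
    "V \<in> G" "N \<le> length V" "W \<in> G" "1 \<le> length W"
    "avoids (pieces m t F) V" "avoids (pieces m t (insert V F)) W"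
    "(3 * real t + 1) * exp (h * (real N + real t + 1)) \<le> real (card F)"
    by (rule select_words[where t = t, OF \<open>0 \<le> h\<close> \<open>h < h4\<close> freq finG \<open>1 \<le> m\<close>]) (rule that)
  define c where "c = 3 * length W + length V + t + 1"
  define D where "D = length W + (N + t + 1) * (2 * c) + length V + 2 * t"
  have "1 \<le> c" by (simp add: c_def)
  obtain lam s :: "nat \<Rightarrow> nat" where sch: "mono lam" "\<And>j. j \<le> lam j" "strict_mono s"
    "\<And>j. 2 * c dvd s j" "\<And>j. (\<Sum>i\<le>j. D * (lam i + 1)) \<le> s j" "\<And>j. (lam j + 1)\<^sup>2 \<le> s j"
    "\<And>j. 2 * c * lam j + c < s j"
    "(\<lambda>j. ereal (ln (real (s j)) / real (lam j))) \<longlonglongrightarrow> a"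
    "(\<lambda>j. ereal (ln (real (s (Suc j))) / real (lam j))) \<longlonglongrightarrow> b"
    by (rule insertion_schedule[where D = D, OF ab \<open>1 \<le> c\<close>]) (rule that)
  interpret insertion ts m S G F V W t N c D lam s
    by unfold_locales (use sub join sel gen sch c_def D_def in auto)
  have "coding ` {\<omega>. range \<omega> \<subseteq> inputs} \<subseteq> Rset ts S a b"
  proof (rule image_subsetI)
    fix \<omega> :: "nat \<Rightarrow> nat list \<times> nat list"
    assume "\<omega> \<in> {\<omega>. range \<omega> \<subseteq> inputs}"
    then interpret insertion_run ts m S G F V W t N c D lam s \<omega> "fst (runs \<omega>)" "snd (runs \<omega>)"
      by (intro insertion_run_runs) simp
    show "coding \<omega> \<in> Rset ts S a b" unfolding coding_def using sch(8,9) by (rule point_in_Rset)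
  qed
  from hmeasure_mono[OF this] show ?thesis
    using coding_hmeasure[OF h(1) sel(13)] by (rule less_le_trans[rotated])
qed

theorem theorem1p1:
  fixes ts :: bool and m :: nat and S :: "(int \<Rightarrow> nat) set"
    and Cp G Cs :: "nat list set" and a b :: ereal
  assumes "2 \<le> m"
    and "subshift ts m S"
    and "Cp \<subseteq> language ts S" and "G \<subseteq> language ts S" and "Cs \<subseteq> language ts S"
    and "decomposes (language ts S) Cp G Cs"
    and "[] \<in> G"
    and "W'_spec ts S G"
    and "growth (Cp \<union> Cs) < htop ts S"
    and "0 \<le> a" and "a \<le> b"
  shows "hdim (Rset ts S a b) = hdim S"
proof (rule antisym)
  show "hdim (Rset ts S a b) \<le> hdim S" by (rule hdim_mono) (auto simp: Rset_def)
  show "hdim S \<le> hdim (Rset ts S a b)"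
    unfolding hdim_def[of "Rset ts S a b"]
  proof (rule Inf_greatest, clarify)
    fix r :: real
    assume r: "0 < r" "hmeasure r (Rset ts S a b) = 0"
    \<comment> \<open>The dimensions are compared through the entropy: an exponent r that is null
      for the recurrence set satisfies htop \<le> r / d, and then every exponent above r is null for
      S.\<close>
    define d where "d = (if ts then 2 else 1 :: real)"
    have d: "0 < d" by (simp add: d_def)
    have "\<not> ereal (r / d) < htop ts S"
    proof
      assume "ereal (r / d) < htop ts S"
      then have "0 < hmeasure (d * (r / d)) (Rset ts S a b)"
        unfolding d_def using assms r d by (intro hmeasure_Rset_pos[where m = m and Cp = Cp and G = G and Cs = Cs]) (auto simp: d_def)
      then show False using r d by simp
    qed
    then have le: "htop ts S \<le> ereal (r / d)" by simp
    show "hdim S \<le> ereal r"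
    proof (rule ereal_le_epsilon2)
      fix e :: real assume e: "0 < e"
      have "htop ts S < ereal (r / d + e / (2 * d))"
        using e d by (intro le_less_trans[OF le]) simp
      moreover have "d * (r / d + e / (2 * d)) < r + e" using e d by (simp add: field_simps)
      ultimately have "hmeasure (r + e) S = 0"
        using assms(2) r e by (intro hmeasure_subshift_eq_0[where h = "r / d + e / (2 * d)"]) (auto simp: d_def)
      then show "hdim S \<le> ereal r + ereal e"
        using r e unfolding hdim_def by (intro Inf_lower) auto
    qed
  qed
qed

end
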